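(* Let $d\ge1$ and $N\ge2$ be integers, $\lambda_1,\dots,\lambda_N>0$, and assume $p\in(0,2)$. Let $a\in\mathcal Y$ be normal. Then there exist a basis $\{b^1,\dots,b^{dN}\}$ of $\mathcal X$ and real numbers $p_1,\dots,p_{dN}\le\frac{p}{p+2}$ satisfying the following: for any $x=(x_1,\dots,x_{dN})\in\mathcal X$ (with $x_k\in\mathbb R$) there exist $\delta>0$, $T_0>0$, a solution $P_x(t)=(\alpha_x(t),\beta_x(t))$ of the $N$-body system for $t>T_0$, and $f\in S_{\frac{2p-2}{p+2}}$ such that $$\alpha_x(t)=at^{\frac2{p+2}}+\sum_{k=1}^{dN}x_kb^kt^{p_k}+f(t)+o(t^{-\delta+})\quad\text{as }t\to+\infty.$$ Moreover, for a fixed $a$, the map $x\mapsto P_x$ is injective (that is, if $x\neq y$ then $P_x$ and $P_y$ do not coincide for all large $t$). In particular, if $p\in(0,1)$, these solutions satisfy $$\alpha_x(t)=at^{\frac2{p+2}}+\sum_{k=1}^{dN}x_kb^kt^{p_k}+o\big(t^{-\frac{2-2p}{p+2}+}\big)\quad\text{as }t\to+\infty.$$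
   Context: $\mathbb N$ includes $0$. $\mathcal X=\mathbb R^{dN}=(\mathbb R^d)^N$, with elements written $\alpha=(\alpha_1,\dots,\alpha_N)$, $\alpha_i\in\mathbb R^d$, and $\mathcal Y=\{\alpha\in\mathcal X:\alpha_j\ne\alpha_k\ \forall j\ne k\}$. Set $U(\alpha)=\frac1p\sum_{i<j}\frac{\lambda_i\lambda_j}{|\alpha_i-\alpha_j|^p}$ and $|\alpha|_\lambda^2=\sum_{i=1}^N\lambda_i|\alpha_i|^2$. The $N$-body system is the system for $P=(\alpha,\beta)$, $\alpha(t),\beta(t)\in\mathcal X$, $$\dot\alpha_i=\beta_i,\qquad \lambda_i\dot\beta_i=-\sum_{j\ne i}\frac{\lambda_i\lambda_j(\alpha_i-\alpha_j)}{|\alpha_i-\alpha_j|^{p+2}},\qquad i=1,\dots,N.$$ $a\in\mathcal Y$ is minimal if for every $\tilde a\in\mathcal Y$ with $|\tilde a|_\lambda=|a|_\lambda$ one has $U(\tilde a)\ge U(a)$. $a\in\mathcal Y$ is normal if $a$ is minimal and $\alpha(t)=at^{\frac2{p+2}}$, $\beta(t)=\dot\alpha(t)$ is a solution of the $N$-body system for $t>0$. For $\gamma\in\mathbb R$, $S_\gamma$ is the space of functions of $t\in(0,+\infty)$ $$S_\gamma=\Big\{\sum_{i=1}^m y_it^{q_i}\log^{k_i}(t)\ \Big|\ m\in\mathbb N,\ y_i\in\mathcal X,\ q_i\le\gamma\ (q_i\in\mathbb R),\ k_i\in\mathbb N\Big\}.$$ For a function $g$ of $t$ and $\mu\in\mathbb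 R$, $g(t)=o(t^{\mu+})$ as $t\to+\infty$ means $\lim_{t\to+\infty}g(t)/t^{\mu+\epsilon}=0$ for all $\epsilon>0$. *)

theory Defs
  imports "HOL-Analysis.Analysis"
begin

text \<open>
  A configuration of \<open>N\<close> bodies in \<open>d\<close>-dimensional space is a vector of type
  \<open>real^'d^'n\<close>, where \<open>'d\<close> indexes the coordinates and \<open>'n\<close> the bodies. The order on \<open>'n\<close> is
  needed only for the sum over pairs \<open>i < j\<close> in the potential.
\<close>

definition noncollision :: "(real^'d^'n) set" where
  "noncollision = {\<alpha>. \<forall>j k. j \<noteq> k \<longrightarrow> \<alpha> $ j \<noteq> \<alpha> $ k}"

definition potential ::
    "('n::{finite,linorder} \<Rightarrow> real) \<Rightarrow> real \<Rightarrow> real^'d^('n::{finite,linorder}) \<Rightarrow> real" where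
  "potential lam p \<alpha> =
     (1 / p) * (\<Sum>i\<in>UNIV. \<Sum>j\<in>{j. i < j}. lam i * lam j / norm (\<alpha> $ i - \<alpha> $ j) powr p)"

definition weighted_norm :: "('n::finite \<Rightarrow> real) \<Rightarrow> real^'d^'n \<Rightarrow> real" where
  "weighted_norm lam \<alpha> = sqrt (\<Sum>i\<in>UNIV. lam i * (norm (\<alpha> $ i))\<^sup>2)"

text \<open>
  The function \<open>P = (\<alpha>, \<beta>)\<close> solves the system on \<open>(T, \<infinity>)\<close>; its values for \<open>t \<le> T\<close> are
  irrelevant. The condition \<open>\<alpha>(t) \<in> noncollision\<close> is explicit because the right-hand side is
  undefined at collisions, whereas division by zero is total in HOL.
\<close>

definition nbody_solution ::
    "('n::finite \<Rightarrow> real) \<Rightarrow> real \<Rightarrow> real \<Rightarrow> (real \<Rightarrow> (real^'d^'n) \<times> (real^'d^'n)) \<Rightarrow> bool" where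
  "nbody_solution lam p T P \<longleftrightarrow>
     (\<forall>t>T. fst (P t) \<in> noncollision \<and>
       (\<exists>A B. ((\<lambda>s. fst (P s)) has_vector_derivative A) (at t) \<and>
              ((\<lambda>s. snd (P s)) has_vector_derivative B) (at t) \<and>
              (\<forall>i. A $ i = snd (P t) $ i \<and>
                   lam i *\<^sub>R (B $ i) =
                     - (\<Sum>j\<in>UNIV - {i}.
                          (lam i * lam j / norm (fst (P t) $ i - fst (P t) $ j) powr (p + 2))
                            *\<^sub>R (fst (P t) $ i - fst (P t) $ j)))))"

definition minimal_config ::
    "('n::{finite,linorder} \<Rightarrow> real) \<Rightarrow> real \<Rightarrow> real^'d^('n::{finite,linorder}) \<Rightarrow> bool" where
  "minimal_config lam p a \<longleftrightarrow>
     a \<in> noncollision \<and>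
     (\<forall>a'\<in>(noncollision :: (real^'d^('n::{finite,linorder})) set). weighted_norm lam a' = weighted_norm lam a \<longrightarrow>
        potential lam p a' \<ge> potential lam p a)"

definition normal_config ::
    "('n::{finite,linorder} \<Rightarrow> real) \<Rightarrow> real \<Rightarrow> real^'d^('n::{finite,linorder}) \<Rightarrow> bool" where
  "normal_config lam p a \<longleftrightarrow>
     minimal_config lam p a \<and>
     (let \<alpha> = (\<lambda>t::real. t powr (2 / (p + 2)) *\<^sub>R a)
      in nbody_solution lam p 0 (\<lambda>t. (\<alpha> t, vector_derivative \<alpha> (at t))))"

text \<open>
  Power-logarithm sums with exponents at most \<open>\<gamma>\<close>. As these are functions on \<open>(0, \<infinity>)\<close>, values
  at \<open>t \<le> 0\<close> are left unconstrained.
\<close>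

definition powlog_space :: "real \<Rightarrow> (real \<Rightarrow> real^'d^'n) set" where
  "powlog_space \<gamma> =
     {f. \<exists>(m::nat) (y::nat \<Rightarrow> real^'d^'n) (q::nat \<Rightarrow> real) (k::nat \<Rightarrow> nat).
           (\<forall>i\<in>{1..m}. q i \<le> \<gamma>) \<and>
           (\<forall>t>0. f t = (\<Sum>i=1..m. (t powr q i * ln t ^ k i) *\<^sub>R y i))}"

text \<open>\<open>g(t) = o(t\<^sup>\<mu>\<^sup>+)\<close> as \<open>t\<close> tends to infinity.\<close>

definition little_o_plus :: "real \<Rightarrow> (real \<Rightarrow> 'a::real_normed_vector) \<Rightarrow> bool" where
  "little_o_plus \<mu> g \<longleftrightarrow>
     (\<forall>\<epsilon>>0. ((\<lambda>t. g t /\<^sub>R (t powr (\<mu> + \<epsilon>))) \<longlongrightarrow> 0) at_top)"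

text \<open>
  A basis of the configuration space indexed, like the coordinates of a configuration
  under the identification of \<open>R\<^sup>d\<^sup>N\<close> with \<open>(R\<^sup>d)\<^sup>N\<close>, by pairs of a body and a coordinate.
\<close>

definition indexed_basis :: "('n \<times> 'd \<Rightarrow> real^'d^'n) \<Rightarrow> bool" where
  "indexed_basis b \<longleftrightarrow> inj b \<and> independent (range b) \<and> span (range b) = UNIV"

text \<open>
  The expression \<open>a t\<^bsup>2/(p+2)\<^esup> + \<Sum>\<^sub>k x\<^sub>k b\<^sub>k t\<^bsup>q\<^sub>k\<^esup>\<close>, with \<open>k = (i, j)\<close> and \<open>x\<^sub>k = x $ i $ j\<close>.
\<close>

definition leading_part ::
    "real \<Rightarrow> real^'d^'n \<Rightarrow> ('n \<times> 'd \<Rightarrow> real^'d^'n) \<Rightarrow> ('n \<times> 'd \<Rightarrow> real) \<Rightarrow>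
     real^'d^'n \<Rightarrow> real \<Rightarrow> real^'d^'n" where
  "leading_part p a b q x t =
     t powr (2 / (p + 2)) *\<^sub>R a + (\<Sum>(i, j)\<in>UNIV. (x $ i $ j * t powr q (i, j)) *\<^sub>R b (i, j))"

end

theory Submission
  imports Defs "HOL-Library.Landau_Symbols" "HOL-Real_Asymp.Real_Asymp"
begin

text \<open>
  Put \<open>s = 2/(p+2)\<close>, \<open>\<eta> = (2-p)/(p+2)\<close> and \<open>\<alpha>(t) = t\<^sup>s (a + u(ln t))\<close>. In the logarithmic time the
  equation for \<open>u\<close> is autonomous, and in an eigenbasis \<open>b\<^sub>k\<close> of the linearized force (which is
  self-adjoint for the mass inner product) its components satisfy
  \<open>(D - \<nu>\<^sub>k)(D - \<omega>\<^sub>k) y\<^sub>k = R\<^sub>k(y)\<close> with a quadratic \<open>R\<close>. Here \<open>s + \<nu>\<^sub>k\<close>, \<open>s + \<omega>\<^sub>k\<close> are the roots of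
  \<open>q(q-1) = \<mu>\<^sub>k\<close>, and minimality of \<open>a\<close> gives \<open>\<mu>\<^sub>k \<ge> -s(1-s)\<close>, that is \<open>\<nu>\<^sub>k \<le> -\<eta> < 0 \<le> \<omega>\<^sub>k\<close>.

  Solutions with \<open>y\<^sub>k\<close> close to \<open>x\<^sub>k exp(\<nu>\<^sub>k \<theta>)\<close> are obtained from a contraction. A term
  \<open>exp(\<nu>\<^sub>k \<theta>)\<close> with \<open>\<nu>\<^sub>k \<le> -2\<eta>\<close> belongs to the space of the correction \<open>f\<close>, so its coefficient may
  be prescribed as a bounded injective function of \<open>x\<^sub>k\<close> through the value at the initial time; the
  initial time then depends only on the other coordinates, and injectivity follows from these
  coordinates being visible in the asymptotics and from backward uniqueness. Finally, replacing
  \<open>R\<close> by Taylor polynomials and solving first-order linear equations repeatedly improves the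
  expansion by a factor \<open>exp(-\<eta>\<theta>)\<close> at each step.
\<close>

text \<open>Logarithmic time makes the law autonomous because the force is homogeneous of degree
  -(p+1) and s(p+2) = 2. The constant \<eta> equals 2s-1: at the extreme value -s(1-s) of the
  eigenvalue the equation q(q-1) = -s(1-s) has the roots s and 1-s, and p < 2 makes their gap
  positive. A quadratic remainder of functions of size exp(-\<eta>\<theta>) has size
  exp(-2\<eta>\<theta>), which is the source of the bound s-2\<eta> = (2p-2)/(p+2) on the exponents
  of f. The obstacle is injectivity. The contraction starts at a time that depends on the size of
  the data, and a coefficient of a fast mode cannot be read off from the expansion, since f may
  contain the same power. Values at starting times can be compared only if two solutions share that
  time. The contraction is measured at a rate d strictly between \<eta> and 2\<eta> that differs
  from all decay rates of the modes. The linear equations then have bounded solution operators, and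
  resonances, hence logarithms, appear only in the later expansion.\<close>

section \<open>Functions of exponential order and exponential polynomials\<close>

text \<open>\<open>C / l * exp (l * x)\<close> is a primitive of the bound, so adding or subtracting
  \<open>Y\<close> gives a nondecreasing function. The signed quotient covers growth and decay at
  once.\<close>

lemma exp_deriv_bound:
  fixes Y Y' :: "real \<Rightarrow> real"
  assumes "l \<noteq> 0" "u \<le> v" and cont: "continuous_on {u..v} Y"
    and der: "\<And>x. u < x \<Longrightarrow> x < v \<Longrightarrow> (Y has_real_derivative Y' x) (at x)"
    and bd: "\<And>x. u < x \<Longrightarrow> x < v \<Longrightarrow> \<bar>Y' x\<bar> \<le> C * exp (l * x)"
  shows "\<bar>Y v - Y u\<bar> \<le> C / l * (exp (l * v) - exp (l * u))"
proof -
  have d: "((\<lambda>x. C / l * exp (l * x)) has_real_derivative C * exp (l * x)) (at x)" for x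
    using \<open>l \<noteq> 0\<close> by (auto intro!: derivative_eq_intros)
  have c: "continuous_on {u..v} (\<lambda>x. C / l * exp (l * x))" by (intro continuous_intros)
  have "C / l * exp (l * u) - Y u \<le> C / l * exp (l * v) - Y v"
  proof (rule DERIV_nonneg_imp_increasing_open[OF \<open>u \<le> v\<close>])
    show "\<exists>y. ((\<lambda>x. C / l * exp (l * x) - Y x) has_real_derivative y) (at x) \<and> 0 \<le> y"
      if "u < x" "x < v" for x
      using DERIV_diff[OF d der[OF that]] bd[OF that] by (intro exI conjI) auto
  qed (intro continuous_intros c cont)
  moreover have "C / l * exp (l * u) + Y u \<le> C / l * exp (l * v) + Y v"
  proof (rule DERIV_nonneg_imp_increasing_open[OF \<open>u \<le> v\<close>])
    show "\<exists>y. ((\<lambda>x. C / l * exp (l * x) + Y x) has_real_derivative y) (at x) \<and> 0 \<le> y"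
      if "u < x" "x < v" for x
      using DERIV_add[OF d der[OF that]] bd[OF that] by (intro exI conjI) auto
  qed (intro continuous_intros c cont)
  ultimately show ?thesis by (simp add: algebra_simps)
qed

text \<open>Increments of \<open>Y\<close> over [u, v] are dominated by the exponential at u, so
  \<open>Y\<close> is Cauchy at infinity; letting v tend to infinity turns the increment bound into
  the rate of convergence.\<close>

lemma exp_decay_limit:
  fixes Y Y' :: "real \<Rightarrow> real"
  assumes "l < 0" and cont: "continuous_on {T..} Y"
    and der: "\<And>x. T < x \<Longrightarrow> (Y has_real_derivative Y' x) (at x)"
    and bd: "\<And>x. T < x \<Longrightarrow> \<bar>Y' x\<bar> \<le> C * exp (l * x)"
  obtains c where "(Y \<longlongrightarrow> c) at_top" "\<And>x. T \<le> x \<Longrightarrow> \<bar>Y x - c\<bar> \<le> C / - l * exp (l * x)"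
proof -
  have diff: "\<bar>Y v - Y u\<bar> \<le> C / - l * exp (l * u)" if "T \<le> u" "u \<le> v" for u v
  proof -
    have "\<bar>Y v - Y u\<bar> \<le> C / l * (exp (l * v) - exp (l * u))"
      using that by (intro exp_deriv_bound[where Y'=Y'] der bd continuous_on_subset[OF cont])
        (use \<open>l < 0\<close> in auto)
    also have "\<dots> = C / - l * exp (l * u) - C / - l * exp (l * v)"
      by (simp add: algebra_simps)
    also have "\<dots> \<le> C / - l * exp (l * u)"
    proof -
      \<comment> \<open>The sign of \<open>C\<close> is read off from the bound at a single
        point.\<close>
      have "0 \<le> C * exp (l * (T + 1))" using bd[of "T+1"] by (smt (verit))
      then have "0 \<le> C" by (simp add: zero_le_mult_iff)
      then have "0 \<le> C / - l" using \<open>l < 0\<close> by (intro divide_nonneg_pos) auto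
      then have "0 \<le> C / - l * exp (l * v)" by (intro mult_nonneg_nonneg) auto
      then show ?thesis by linarith
    qed
    finally show ?thesis .
  qed
  have z: "((\<lambda>x. C / - l * exp (l * x)) \<longlongrightarrow> 0) at_top"
    using \<open>l < 0\<close> by real_asymp
  have "cauchy_filter (filtermap Y at_top)"
    unfolding cauchy_filter_metric_filtermap
  proof (intro allI impI)
    fix e :: real assume "e > 0"
    from order_tendstoD(2)[OF z, of "e / 2"] \<open>e > 0\<close>
    have "\<forall>\<^sub>F x in at_top. C / - l * exp (l * x) < e / 2" by simp
    with eventually_ge_at_top[of T]
    have "\<forall>\<^sub>F x in at_top. T \<le> x \<and> C / - l * exp (l * x) < e / 2"
      by eventually_elim simp
    then obtain u where u: "T \<le> u" "C / - l * exp (l * u) < e / 2"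
      using eventually_happens by fastforce
    show "\<exists>P. eventually P at_top \<and> (\<forall>x y. P x \<and> P y \<longrightarrow> dist (Y x) (Y y) < e)"
    proof (intro exI conjI allI impI)
      show "eventually (\<lambda>x. x \<ge> u) at_top" by (rule eventually_ge_at_top)
      fix x y assume "u \<le> x \<and> u \<le> y"
      then show "dist (Y x) (Y y) < e"
        using diff[OF u(1), of x] diff[OF u(1), of y] u(2) unfolding dist_real_def by linarith
    qed
  qed
  moreover have "complete (UNIV :: real set)" by (simp add: complete_UNIV)
  ultimately obtain c where c: "(Y \<longlongrightarrow> c) at_top"
    unfolding complete_uniform filterlim_def
    by (metis UNIV_I filtermap_bot_iff principal_UNIV top_greatest trivial_limit_at_top_linorder)
  show ?thesis
  proof
    show "(Y \<longlongrightarrow> c) at_top" by fact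
    fix x assume "T \<le> x"
    have "((\<lambda>v. \<bar>Y v - Y x\<bar>) \<longlongrightarrow> \<bar>c - Y x\<bar>) at_top" by (intro tendsto_intros c)
    then have "\<bar>c - Y x\<bar> \<le> C / - l * exp (l * x)"
    proof (rule tendsto_upperbound)
      show "\<forall>\<^sub>F v in at_top. \<bar>Y v - Y x\<bar> \<le> C / - l * exp (l * x)"
        using eventually_ge_at_top[of x] by eventually_elim (intro diff \<open>T \<le> x\<close>)
    qed simp
    then show "\<bar>Y x - c\<bar> \<le> C / - l * exp (l * x)" by linarith
  qed
qed

text \<open>With x = ln t this is the rate o(t^(r+)). Since every positive e is allowed, O and o
  give the same notion, and powers of x, which become logarithms, cost nothing.\<close>

definition ebound :: "real \<Rightarrow> (real \<Rightarrow> real) \<Rightarrow> bool" where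
  "ebound r g \<longleftrightarrow> (\<forall>e>0. g \<in> O(\<lambda>x. exp ((r + e) * x)))"

lemma bigo_exp_mono: "a \<le> b \<Longrightarrow> (\<lambda>x::real. exp (a * x)) \<in> O(\<lambda>x. exp (b * x))"
  by (rule bigoI[of _ 1]) (use eventually_ge_at_top[of 0] in \<open>eventually_elim, auto intro: mult_right_mono\<close>)

lemma bigo_exp_imp_ebound: "g \<in> O(\<lambda>x. exp (r * x)) \<Longrightarrow> ebound r g"
  unfolding ebound_def by (auto intro: landau_o.big_trans[OF _ bigo_exp_mono])

lemma ebound_smallI:
  assumes "e0 > 0" "\<And>e. 0 < e \<Longrightarrow> e < e0 \<Longrightarrow> g \<in> O(\<lambda>x. exp ((r + e) * x))"
  shows "ebound r g"
  unfolding ebound_def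
proof (intro allI impI)
  fix e :: real assume "e > 0"
  have "g \<in> O(\<lambda>x. exp ((r + min e (e0/2)) * x))" using assms \<open>e > 0\<close> by auto
  then show "g \<in> O(\<lambda>x. exp ((r + e) * x))"
    by (rule landau_o.big_trans) (intro bigo_exp_mono, auto)
qed

lemma ebound_mono: "r \<le> r' \<Longrightarrow> ebound r g \<Longrightarrow> ebound r' g"
  unfolding ebound_def by (auto intro: landau_o.big_trans[OF _ bigo_exp_mono])

lemma power_smallo_exp: "0 < d \<Longrightarrow> (\<lambda>x::real. x ^ k) \<in> o(\<lambda>x. exp (d * x))"
  by real_asymp

lemma monomial_smallo_exp:
  assumes "q < c" shows "(\<lambda>x::real. exp (q * x) * x ^ k) \<in> o(\<lambda>x. exp (c * x))"
proof -
  have "(\<lambda>x. exp (q * x) * x ^ k) \<in> o(\<lambda>x. exp (q * x) * exp ((c - q) * x))"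
    using assms by (intro landau_o.small.mult_left power_smallo_exp) auto
  then show ?thesis by (simp add: exp_add[symmetric] algebra_simps)
qed

lemma ebound_zero [simp]: "ebound r (\<lambda>_. 0)" by (simp add: ebound_def)

lemma ebound_add: "ebound r f \<Longrightarrow> ebound r g \<Longrightarrow> ebound r (\<lambda>x. f x + g x)"
  unfolding ebound_def by (auto intro: sum_in_bigo)

lemma ebound_diff: "ebound r f \<Longrightarrow> ebound r g \<Longrightarrow> ebound r (\<lambda>x. f x - g x)"
  unfolding ebound_def by (auto intro: sum_in_bigo)

lemma ebound_sum: "(\<And>i. i \<in> A \<Longrightarrow> ebound r (f i)) \<Longrightarrow> ebound r (\<lambda>x. \<Sum>i\<in>A. f i x)"
  by (induction A rule: infinite_finite_induct) (auto intro: ebound_add)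

lemma ebound_mult:
  assumes "ebound r f" "ebound s g" shows "ebound (r + s) (\<lambda>x. f x * g x)"
  unfolding ebound_def
proof (intro allI impI)
  fix e :: real assume "e > 0"
  then have "f \<in> O(\<lambda>x. exp ((r + e/2) * x))" "g \<in> O(\<lambda>x. exp ((s + e/2) * x))"
    using assms by (simp_all add: ebound_def)
  from landau_o.big.mult[OF this] show "(\<lambda>x. f x * g x) \<in> O(\<lambda>x. exp ((r + s + e) * x))"
    by (simp add: exp_add[symmetric] algebra_simps)
qed

lemma ebound_power: "ebound r f \<Longrightarrow> ebound (real n * r) (\<lambda>x. f x ^ n)"
proof (induction n)
  case 0
  have "ebound 0 (\<lambda>x. 1)" by (rule bigo_exp_imp_ebound) simp
  then show ?case by simp
next
  case (Suc n)
  then have "ebound (r + real n * r) (\<lambda>x. f x * f x ^ n)" by (intro ebound_mult) auto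
  then show ?case by (simp add: algebra_simps)
qed

lemma ebound_le:
  assumes "ebound r g" "\<forall>\<^sub>F x in at_top. \<bar>f x\<bar> \<le> C * \<bar>g x\<bar>"
  shows "ebound r f"
proof -
  have "f \<in> O(g)" using assms(2) by (intro bigoI[of _ C]) simp
  with assms(1) show ?thesis unfolding ebound_def by (auto intro: landau_o.big_trans)
qed

lemma ebound_abs: "ebound r f \<Longrightarrow> ebound r (\<lambda>x. \<bar>f x\<bar>)"
  by (erule ebound_le[where C=1]) simp

lemma ebound_tendsto_0:
  assumes "ebound r g" "r < s"
  shows "((\<lambda>x. g x * exp (- s * x)) \<longlongrightarrow> 0) at_top"
proof -
  have "g \<in> O(\<lambda>x. exp ((r + (s - r)/2) * x))" using assms by (simp add: ebound_def)
  also have "(\<lambda>x. exp ((r + (s - r)/2) * x)) \<in> o(\<lambda>x. exp (s * x))"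
    using monomial_smallo_exp[of "r + (s - r)/2" s 0] assms(2) by (simp add: field_simps)
  finally have "((\<lambda>x. g x / exp (s * x)) \<longlongrightarrow> 0) at_top" by (auto dest: smalloD_tendsto)
  then show ?thesis by (simp add: exp_minus divide_inverse)
qed

text \<open>Used to identify coefficients: a mode above the error rate cannot hide in the
  error.\<close>

lemma ebound_exp_coeff_zero:
  assumes "ebound r (\<lambda>x. c * exp (s * x))" "r < s" shows "c = 0"
proof -
  have "(\<lambda>x. c * exp (s * x) * exp (- s * x)) = (\<lambda>x. c)"
    by (auto simp: mult.assoc exp_add[symmetric])
  with ebound_tendsto_0[OF assms] show ?thesis
    by (metis (no_types) tendsto_const_iff trivial_limit_at_top_linorder)
qed

text \<open>Variation of constants: exp(-a x) y has derivative exp(-a x) g. For r < a this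
  derivative is integrable at infinity and the limit is the coefficient \<open>c\<close>; for r
  \<ge> a the homogeneous solution is itself of rate r and is left in the error.\<close>

lemma first_order_asymptotics:
  assumes der: "\<And>x. T < x \<Longrightarrow> (y has_real_derivative a * y x + g x) (at x)"
    and g: "ebound r g"
  obtains c where "ebound r (\<lambda>x. y x - c * exp (a * x))"
proof -
  define Y where "Y = (\<lambda>x. exp (- a * x) * y x)"
  have dY: "(Y has_real_derivative exp (- a * x) * g x) (at x)" if "T < x" for x
    unfolding Y_def using der[OF that] by (auto intro!: derivative_eq_intros simp: algebra_simps)
  have yY: "y x = exp (a * x) * Y x" for x
    by (simp add: Y_def exp_add[symmetric] mult.assoc[symmetric])
  have bd: "\<exists>T1 C. T < T1 \<and> (\<forall>x>T1. \<bar>exp (- a * x) * g x\<bar> \<le> C * exp ((r + e - a) * x))"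
    if "e > 0" for e
  proof -
    from g that have "g \<in> O(\<lambda>x. exp ((r + e) * x))" by (simp add: ebound_def)
    then obtain C where "\<forall>\<^sub>F x in at_top. \<bar>g x\<bar> \<le> C * exp ((r + e) * x)"
      by (elim landau_o.bigE) auto
    then obtain T0 where T0: "\<And>x. x \<ge> T0 \<Longrightarrow> \<bar>g x\<bar> \<le> C * exp ((r + e) * x)"
      by (auto simp: eventually_at_top_linorder)
    have "\<bar>exp (- a * x) * g x\<bar> \<le> C * exp ((r + e - a) * x)" if "x \<ge> T0" for x
    proof -
      have "\<bar>exp (- a * x) * g x\<bar> \<le> exp (- a * x) * (C * exp ((r + e) * x))"
        using T0[OF that] by (simp add: abs_mult)
      also have "\<dots> = C * (exp (- a * x) * exp ((r + e) * x))" by simp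
      also have "\<dots> = C * exp ((r + e - a) * x)"
        unfolding exp_add[symmetric] by (simp add: algebra_simps)
      finally show ?thesis .
    qed
    then show ?thesis by (intro exI[of _ "max T0 (T+1)"] exI[of _ C]) auto
  qed
  have cont: "continuous_on {T1..} Y" if "T < T1" for T1
    using that by (intro continuous_at_imp_continuous_on ballI) (auto intro!: DERIV_isCont[OF dY])
  show ?thesis
  proof (cases "r < a")
    case True
    have lim: "\<exists>c. (Y \<longlongrightarrow> c) at_top \<and> (\<lambda>x. y x - c * exp (a * x)) \<in> O(\<lambda>x. exp ((r + e) * x))"
      if "0 < e" "e < a - r" for e
    proof -
      obtain T1 C where T1: "T < T1" "\<And>x. x > T1 \<Longrightarrow> \<bar>exp (- a * x) * g x\<bar> \<le> C * exp ((r + e - a) * x)"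
        using bd[OF \<open>0 < e\<close>] by auto
      have dY1: "(Y has_real_derivative exp (- a * x) * g x) (at x)" if "T1 < x" for x
        using dY T1(1) that by simp
      have neg: "r + e - a < 0" using that by simp
      obtain c where c: "(Y \<longlongrightarrow> c) at_top"
        "\<And>x. T1 \<le> x \<Longrightarrow> \<bar>Y x - c\<bar> \<le> C / - (r + e - a) * exp ((r + e - a) * x)"
        using exp_decay_limit[OF neg cont[OF T1(1)] dY1 T1(2)] by blast
      have "(\<lambda>x. y x - c * exp (a * x)) \<in> O(\<lambda>x. exp ((r + e) * x))"
      proof (rule bigoI)
        show "\<forall>\<^sub>F x in at_top. norm (y x - c * exp (a * x)) \<le> C / - (r + e - a) * norm (exp ((r + e) * x))"
          using eventually_ge_at_top[of T1]
        proof eventually_elim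
          case (elim x)
          have "y x - c * exp (a * x) = exp (a * x) * (Y x - c)" by (simp add: yY algebra_simps)
          then have "norm (y x - c * exp (a * x)) = exp (a * x) * \<bar>Y x - c\<bar>" by (simp add: abs_mult)
          also have "\<dots> \<le> exp (a * x) * (C / - (r + e - a) * exp ((r + e - a) * x))"
            by (intro mult_left_mono c(2) elim) auto
          also have "\<dots> = C / - (r + e - a) * (exp (a * x) * exp ((r + e - a) * x))" by simp
          also have "\<dots> = C / - (r + e - a) * norm (exp ((r + e) * x))"
            unfolding exp_add[symmetric] by (simp add: algebra_simps)
          finally show ?case .
        qed
      qed
      with c(1) show ?thesis by blast
    qed
    obtain c where c: "(Y \<longlongrightarrow> c) at_top" using lim[of "(a - r)/2"] True by auto
    have "ebound r (\<lambda>x. y x - c * exp (a * x))"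
    proof (rule ebound_smallI)
      show "0 < a - r" using True by simp
      fix e assume "0 < e" "e < a - r"
      from lim[OF this] obtain c' where "(Y \<longlongrightarrow> c') at_top"
        "(\<lambda>x. y x - c' * exp (a * x)) \<in> O(\<lambda>x. exp ((r + e) * x))" by blast
      \<comment> \<open>The limit belongs to \<open>Y\<close>, not to the chosen e, so one
        \<open>c\<close> serves all error rates.\<close>
      moreover have "c' = c" using calculation(1) c by (meson tendsto_unique trivial_limit_at_top_linorder)
      ultimately show "(\<lambda>x. y x - c * exp (a * x)) \<in> O(\<lambda>x. exp ((r + e) * x))" by simp
    qed
    then show ?thesis by (rule that)
  next
    case False
    have "ebound r y"
      unfolding ebound_def
    proof (intro allI impI)
      fix e :: real assume "e > 0"
      obtain T1 C where T1: "T < T1" "\<And>x. x > T1 \<Longrightarrow> \<bar>exp (- a * x) * g x\<bar> \<le> C * exp ((r + e - a) * x)"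
        using bd[OF \<open>e > 0\<close>] by auto
      \<comment> \<open>Positive thanks to the extra e, which also takes care of the resonant case r
        = a.\<close>
      define l where "l = r + e - a"
      have "l > 0" using False \<open>e > 0\<close> by (simp add: l_def)
      have Yb: "\<bar>Y x\<bar> \<le> \<bar>Y T1\<bar> + \<bar>C\<bar> / l * exp (l * x)" if "T1 \<le> x" for x
      proof -
        have "\<bar>Y x - Y T1\<bar> \<le> C / l * (exp (l * x) - exp (l * T1))"
          using that T1 \<open>l > 0\<close> dY continuous_on_subset[OF cont[OF T1(1)]] unfolding l_def
          by (intro exp_deriv_bound) (auto simp: Icc_subset_Ici_iff)
        also have "\<dots> \<le> \<bar>C\<bar> / l * (exp (l * x) - exp (l * T1))"
          using that \<open>l > 0\<close> by (intro mult_right_mono divide_right_mono) auto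
        also have "\<dots> \<le> \<bar>C\<bar> / l * exp (l * x)"
          using \<open>l > 0\<close> by (intro mult_left_mono) auto
        finally show ?thesis by linarith
      qed
      have "Y \<in> O(\<lambda>x. exp (l * x))"
      proof (rule bigoI)
        show "\<forall>\<^sub>F x in at_top. norm (Y x) \<le> (\<bar>Y T1\<bar> + \<bar>C\<bar> / l) * norm (exp (l * x))"
          using eventually_ge_at_top[of "max 0 T1"]
        proof eventually_elim
          case (elim x)
          then have "1 \<le> exp (l * x)" using \<open>l > 0\<close> by simp
          then have "\<bar>Y T1\<bar> \<le> \<bar>Y T1\<bar> * exp (l * x)" by (simp add: mult_le_cancel_left1)
          then show ?case using Yb[of x] elim by (simp add: algebra_simps)
        qed
      qed
      then have "(\<lambda>x. exp (a * x) * Y x) \<in> O(\<lambda>x. exp (a * x) * exp (l * x))"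
        by (intro landau_o.big.mult) auto
      then show "y \<in> O(\<lambda>x. exp ((r + e) * x))"
        unfolding exp_add[symmetric] yY[symmetric] by (simp add: l_def algebra_simps)
    qed
    then show ?thesis by (intro that[of 0]) simp
  qed
qed

text \<open>Under x = ln t a product exp(q x) x^k becomes t^q log^k(t), so these are scalar
  power-logarithm sums with exponents at most c.\<close>

inductive exp_poly :: "real \<Rightarrow> (real \<Rightarrow> real) \<Rightarrow> bool" for c where
  monomial: "q \<le> c \<Longrightarrow> exp_poly c (\<lambda>x. A * (exp (q * x) * x ^ k))"
| add: "exp_poly c f \<Longrightarrow> exp_poly c g \<Longrightarrow> exp_poly c (\<lambda>x. f x + g x)"

lemma exp_poly_zero: "exp_poly c (\<lambda>_. 0)"
  using exp_poly.monomial[of c c 0 0] by simp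

lemma exp_poly_exp: "q \<le> c \<Longrightarrow> exp_poly c (\<lambda>x. A * exp (q * x))"
  using exp_poly.monomial[of q c A 0] by simp

lemma exp_poly_mono: "exp_poly c f \<Longrightarrow> c \<le> d \<Longrightarrow> exp_poly d f"
  by (induction rule: exp_poly.induct) (auto intro: exp_poly.intros)

lemma exp_poly_sum: "(\<And>i. i \<in> I \<Longrightarrow> exp_poly c (f i)) \<Longrightarrow> exp_poly c (\<lambda>x. \<Sum>i\<in>I. f i x)"
  by (induction I rule: infinite_finite_induct) (auto intro: exp_poly_zero exp_poly.add)

lemma exp_poly_mult:
  assumes "exp_poly c f" "exp_poly d g" shows "exp_poly (c + d) (\<lambda>x. f x * g x)"
  using assms(1)
proof (induction rule: exp_poly.induct)
  case (monomial q A k)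
  show ?case using assms(2)
  proof (induction rule: exp_poly.induct)
    case (monomial q' A' k')
    have "exp_poly (c + d) (\<lambda>x. (A * A') * (exp ((q + q') * x) * x ^ (k + k')))"
      using monomial \<open>q \<le> c\<close> by (intro exp_poly.monomial) auto
    moreover have "exp ((q + q') * x) = exp (q * x) * exp (q' * x)" for x
      by (simp add: distrib_right exp_add)
    ultimately show ?case by (simp add: power_add mult_ac)
  next
    case (add g h)
    from exp_poly.add[OF add.IH] show ?case by (simp add: algebra_simps)
  qed
next
  case (add f h)
  from exp_poly.add[OF add.IH] show ?case by (simp add: algebra_simps)
qed

lemma exp_poly_cmult: "exp_poly c f \<Longrightarrow> exp_poly c (\<lambda>x. A * f x)"
  using exp_poly_mult[OF exp_poly_exp[of 0 0 A]] by simp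

lemma exp_poly_ebound: "exp_poly c f \<Longrightarrow> ebound c f"
proof (induction rule: exp_poly.induct)
  case (monomial q A k)
  have "(\<lambda>x. exp (q * x) * x ^ k) \<in> O(\<lambda>x. exp ((c + e) * x))" if "e > 0" for e
  proof -
    have "q < c + e" using that monomial by simp
    then show ?thesis by (intro landau_o.small_imp_big monomial_smallo_exp)
  qed
  then show ?case unfolding ebound_def by auto
qed (auto intro: ebound_add)

text \<open>Integration by parts lowers the power of x until only the exponential is left, except at
  resonance q = a, where the power goes up by one. This is how logarithms enter the
  expansion.\<close>

lemma exp_poly_primitive:
  assumes "exp_poly c g"
  obtains G where "exp_poly c G" "\<And>x. (G has_real_derivative a * G x + g x) (at x)"
proof -
  have mono: "\<exists>G. exp_poly c G \<and> (\<forall>x. (G has_real_derivative a * G x + exp (q * x) * x ^ k) (at x))"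
    if "q \<le> c" for q k
  proof (cases "q = a")
    case True
    let ?G = "\<lambda>x. 1 / Suc k * (exp (q * x) * x ^ Suc k)"
    have "(?G has_real_derivative a * ?G x + exp (q * x) * x ^ k) (at x)" for x
    proof -
      have "((\<lambda>x. x ^ Suc k) has_real_derivative real (Suc k) * x ^ k) (at x)"
        using DERIV_pow[of "Suc k" x] by simp
      then show ?thesis
        using True
        by (auto intro!: derivative_eq_intros simp: field_simps simp del: of_nat_Suc power_Suc)
    qed
    moreover have "exp_poly c ?G" by (intro exp_poly.monomial that)
    ultimately show ?thesis by blast
  next
    case False
    then have nz: "q - a \<noteq> 0" by simp
    show ?thesis
    proof (induction k)
      case 0
      let ?G = "\<lambda>x. 1 / (q - a) * (exp (q * x) * x ^ 0)"
      have "(?G has_real_derivative a * ?G x + exp (q * x) * x ^ 0) (at x)" for x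
        using nz by (auto intro!: derivative_eq_intros simp: divide_simps) (simp add: algebra_simps)
      moreover have "exp_poly c ?G" by (intro exp_poly.monomial that)
      ultimately show ?case by blast
    next
      case (Suc k)
      then obtain H where H: "exp_poly c H"
        "\<And>x. (H has_real_derivative a * H x + exp (q * x) * x ^ k) (at x)" by blast
      let ?G = "\<lambda>x. 1 / (q - a) * (exp (q * x) * x ^ Suc k) + (- (Suc k) / (q - a)) * H x"
      have "(?G has_real_derivative a * ?G x + exp (q * x) * x ^ Suc k) (at x)" for x
      proof -
        have "((\<lambda>x. x ^ Suc k) has_real_derivative real (Suc k) * x ^ k) (at x)"
          using DERIV_pow[of "Suc k" x] by simp
        then show ?thesis
          using nz by (auto intro!: derivative_eq_intros H(2) simp: divide_simps
            simp del: of_nat_Suc power_Suc) (simp add: algebra_simps)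
      qed
      moreover have "exp_poly c ?G" by (intro exp_poly.intros exp_poly_cmult H(1) that)
      ultimately show ?case by blast
    qed
  qed
  have "\<exists>G. exp_poly c G \<and> (\<forall>x. (G has_real_derivative a * G x + g x) (at x))"
    using assms
  proof (induction rule: exp_poly.induct)
    case (monomial q A k)
    from mono[OF this, of k] obtain G where G: "exp_poly c G"
      "\<And>x. (G has_real_derivative a * G x + exp (q * x) * x ^ k) (at x)" by blast
    have "((\<lambda>x. A * G x) has_real_derivative a * (A * G x) + A * (exp (q * x) * x ^ k)) (at x)" for x
      by (auto intro!: derivative_eq_intros G(2) simp: algebra_simps)
    with exp_poly_cmult[OF G(1), of A] show ?case by blast
  next
    case (add f g)
    then obtain G H where "exp_poly c G" "exp_poly c H"
      "\<And>x. (G has_real_derivative a * G x + f x) (at x)"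
      "\<And>x. (H has_real_derivative a * H x + g x) (at x)" by blast
    then show ?case
      by (intro exI[of _ "\<lambda>x. G x + H x"] conjI exp_poly.add allI)
        (auto intro!: derivative_eq_intros simp: algebra_simps)
  qed
  then show ?thesis using that by blast
qed

text \<open>Subtracting an exact solution for the exponential polynomial leaves an equation with
  small forcing. The coefficient \<open>A\<close> of the homogeneous solution is identified where
  the lemma is applied.\<close>

lemma first_order_expansion:
  assumes der: "\<And>x. T < x \<Longrightarrow> (y has_real_derivative a * y x + h x) (at x)"
    and E: "exp_poly c E" and hE: "ebound r (\<lambda>x. h x - E x)"
  obtains A G where "exp_poly c G" "ebound r (\<lambda>x. y x - A * exp (a * x) - G x)"
proof -
  obtain G where G: "exp_poly c G" "\<And>x. (G has_real_derivative a * G x + E x) (at x)"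
    using exp_poly_primitive[OF E] by blast
  have "((\<lambda>x. y x - G x) has_real_derivative a * (y x - G x) + (h x - E x)) (at x)" if "T < x" for x
    using DERIV_diff[OF der[OF that] G(2)[of x]] by (simp add: algebra_simps)
  from first_order_asymptotics[OF this hE] obtain A where
    "ebound r (\<lambda>x. y x - G x - A * exp (a * x))" by blast
  then show ?thesis by (intro that[OF G(1), of A]) (simp add: algebra_simps)
qed

section \<open>Stable solutions of a weakly coupled hyperbolic system\<close>

text \<open>The Lyapunov-Perron solution of y' = a y + h for h of size exp(-d x). A mode that grows,
  or decays slower than h, must be integrated from infinity, the limit being the improper integral
  from T; a faster mode is integrated from T and therefore vanishes there.\<close>

definition decaying_solution :: "real \<Rightarrow> real \<Rightarrow> real \<Rightarrow> (real \<Rightarrow> real) \<Rightarrow> real \<Rightarrow> real" where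
  "decaying_solution d T a h x = exp (a * x) *
     (integral {T..x} (\<lambda>s. exp (- a * s) * h s) -
      (if - d < a then Lim at_top (\<lambda>x. integral {T..x} (\<lambda>s. exp (- a * s) * h s)) else 0))"

context
  fixes d T a H :: real and h :: "real \<Rightarrow> real"
  assumes cont_h: "continuous_on {T..} h"
    and bound_h: "\<And>x. T \<le> x \<Longrightarrow> \<bar>h x\<bar> \<le> H * exp (- d * x)"
    and nonres: "a \<noteq> - d"
begin

private definition "I x = integral {T..x} (\<lambda>s. exp (- a * s) * h s)"

private lemma cont: "continuous_on {T..b} (\<lambda>s. exp (- a * s) * h s)"
  by (intro continuous_intros continuous_on_subset[OF cont_h]) auto

private lemma deriv_I: "(I has_real_derivative exp (- a * x) * h x) (at x)" if "T < x"
proof -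
  have "(I has_real_derivative exp (- a * x) * h x) (at x within {T..x+1})"
    unfolding I_def using that by (intro integral_has_real_derivative cont) auto
  moreover have "at x within {T..x+1} = at x" using that by (intro at_within_interior) auto
  ultimately show ?thesis by simp
qed

private lemma cont_I: "continuous_on {T..} I"
proof -
  have "continuous_on {T..b} I" for b
    unfolding I_def by (intro indefinite_integral_continuous_1 integrable_continuous_interval cont)
  then have "continuous (at x within {T..}) I" if "T \<le> x" for x
  proof -
    have "continuous (at x within {T..x+1}) I"
      using \<open>continuous_on {T..x+1} I\<close> that by (auto simp: continuous_on_eq_continuous_within)
    moreover have "at x within {T..x+1} = at x within {T..}"
      by (rule at_within_nhd[of _ "{..<x+1}"]) auto
    ultimately show ?thesis by (simp add: continuous_within)
  qed
  then show ?thesis by (auto simp: continuous_on_eq_continuous_within)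
qed

private lemma deriv_bound: "\<bar>exp (- a * x) * h x\<bar> \<le> H * exp ((- a - d) * x)" if "T \<le> x"
proof -
  have "\<bar>exp (- a * x) * h x\<bar> \<le> exp (- a * x) * (H * exp (- d * x))"
    using bound_h[OF that] by (simp add: abs_mult)
  also have "\<dots> = H * (exp (- a * x) * exp (- d * x))" by simp
  also have "\<dots> = H * exp ((- a - d) * x)" unfolding exp_add[symmetric] by (simp add: algebra_simps)
  finally show ?thesis .
qed

lemma integral_tendsto_Lim:
  assumes "- d < a"
  shows "((\<lambda>x. integral {T..x} (\<lambda>s. exp (- a * s) * h s)) \<longlongrightarrow>
     Lim at_top (\<lambda>x. integral {T..x} (\<lambda>s. exp (- a * s) * h s))) at_top"
    and "T \<le> x \<Longrightarrow> \<bar>integral {T..x} (\<lambda>s. exp (- a * s) * h s) -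
      Lim at_top (\<lambda>x. integral {T..x} (\<lambda>s. exp (- a * s) * h s))\<bar>
      \<le> H / (a + d) * exp ((- a - d) * x)"
proof -
  have neg: "- a - d < 0" using assms by simp
  obtain c where c: "(I \<longlongrightarrow> c) at_top"
    "\<And>x. T \<le> x \<Longrightarrow> \<bar>I x - c\<bar> \<le> H / - (- a - d) * exp ((- a - d) * x)"
    by (rule exp_decay_limit[OF neg cont_I deriv_I deriv_bound]) auto
  have "Lim at_top I = c" by (intro tendsto_Lim c) simp
  with c show "((\<lambda>x. integral {T..x} (\<lambda>s. exp (- a * s) * h s)) \<longlongrightarrow>
     Lim at_top (\<lambda>x. integral {T..x} (\<lambda>s. exp (- a * s) * h s))) at_top"
    "T \<le> x \<Longrightarrow> \<bar>integral {T..x} (\<lambda>s. exp (- a * s) * h s) -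
      Lim at_top (\<lambda>x. integral {T..x} (\<lambda>s. exp (- a * s) * h s))\<bar>
      \<le> H / (a + d) * exp ((- a - d) * x)"
    unfolding I_def by (simp_all add: add.commute)
qed

lemma decaying_solution_deriv:
  assumes "T < x"
  shows "(decaying_solution d T a h has_real_derivative
    a * decaying_solution d T a h x + h x) (at x)"
proof -
  define c where "c = (if - d < a then Lim at_top I else 0)"
  have eq: "decaying_solution d T a h = (\<lambda>x. exp (a * x) * (I x - c))"
    by (auto simp: fun_eq_iff decaying_solution_def I_def[abs_def] c_def)
  have 1: "exp (a * x) * (exp (- a * x) * h x) = h x"
    by (simp add: mult.assoc[symmetric] exp_add[symmetric])
  have "((\<lambda>x. exp (a * x) * (I x - c)) has_real_derivative
    a * (exp (a * x) * (I x - c)) + exp (a * x) * (exp (- a * x) * h x)) (at x)"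
    by (rule derivative_eq_intros deriv_I[OF assms] refl | simp)+
  then show ?thesis unfolding eq 1 .
qed

lemma decaying_solution_continuous: "continuous_on {T..} (decaying_solution d T a h)"
proof -
  have "continuous_on {T..} (\<lambda>x. exp (a * x) * (I x - (if - d < a then Lim at_top I else 0)))"
    by (intro continuous_intros cont_I)
  then show ?thesis unfolding decaying_solution_def[abs_def] I_def[abs_def] .
qed

text \<open>Both directions of integration give the same constant 1/|a + d|. Excluding a = -d avoids
  the resonance, where a factor growing with x would appear.\<close>

lemma decaying_solution_bound:
  assumes "T \<le> x"
  shows "\<bar>decaying_solution d T a h x\<bar> \<le> H / \<bar>a + d\<bar> * exp (- d * x)"
proof -
  define c where "c = (if - d < a then Lim at_top I else 0)"
  have eq: "decaying_solution d T a h x = exp (a * x) * (I x - c)"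
    by (simp add: decaying_solution_def I_def[abs_def] c_def)
  have H: "0 \<le> H"
  proof -
    have "0 \<le> H * exp (- d * T)" using bound_h[of T] by (smt (verit))
    then show ?thesis by (simp add: zero_le_mult_iff)
  qed
  have "\<bar>I x - c\<bar> \<le> H / \<bar>a + d\<bar> * exp ((- a - d) * x)"
  proof (cases "- d < a")
    case True
    with integral_tendsto_Lim(2)[OF True assms] show ?thesis by (simp add: c_def I_def[abs_def])
  next
    case False
    then have pos: "- a - d > 0" using nonres by simp
    have "\<bar>I x - I T\<bar> \<le> H / (- a - d) * (exp ((- a - d) * x) - exp ((- a - d) * T))"
      using pos by (intro exp_deriv_bound[where Y' = "\<lambda>x. exp (- a * x) * h x"] assms deriv_I
          deriv_bound continuous_on_subset[OF cont_I]) auto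
    also have "\<dots> \<le> H / (- a - d) * exp ((- a - d) * x)"
      using pos H by (intro mult_left_mono) auto
    finally show ?thesis using False pos by (simp add: I_def c_def abs_if)
  qed
  then have "\<bar>decaying_solution d T a h x\<bar> \<le>
      exp (a * x) * (H / \<bar>a + d\<bar> * exp ((- a - d) * x))"
    unfolding eq abs_mult abs_exp_cancel by (intro mult_left_mono) auto
  also have "\<dots> = H / \<bar>a + d\<bar> * (exp (a * x) * exp ((- a - d) * x))" by simp
  also have "\<dots> = H / \<bar>a + d\<bar> * exp (- d * x)"
    unfolding exp_add[symmetric] by (simp add: algebra_simps)
  finally show ?thesis .
qed

lemma integrable_exp_mult: "(\<lambda>s. exp (- a * s) * h s) integrable_on {T..x}"
  by (intro integrable_continuous_interval cont)

lemma decaying_solution_start: "a < - d \<Longrightarrow> decaying_solution d T a h T = 0"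
  by (simp add: decaying_solution_def)

end

text \<open>The solution depends linearly on h, but \<open>Lim\<close> is additive only when both
  limits exist. This is why h and h' each carry a decay bound of their own.\<close>

lemma decaying_solution_diff_bound:
  assumes "continuous_on {T..} h" "\<And>x. T \<le> x \<Longrightarrow> \<bar>h x\<bar> \<le> H * exp (- d * x)"
    and "continuous_on {T..} h'" "\<And>x. T \<le> x \<Longrightarrow> \<bar>h' x\<bar> \<le> H' * exp (- d * x)"
    and "\<And>x. T \<le> x \<Longrightarrow> \<bar>h x - h' x\<bar> \<le> L * exp (- d * x)" and "a \<noteq> - d" "T \<le> x"
  shows "\<bar>decaying_solution d T a h x - decaying_solution d T a h' x\<bar> \<le> L / \<bar>a + d\<bar> * exp (- d * x)"
proof -
  let ?I = "\<lambda>h x. integral {T..x} (\<lambda>s. exp (- a * s) * h s)"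
  have I: "?I (\<lambda>x. h x - h' x) x = ?I h x - ?I h' x" for x
    using integral_diff[OF integrable_exp_mult[OF assms(1,2,6)] integrable_exp_mult[OF assms(3,4,6)]]
    by (simp add: right_diff_distrib)
  have "Lim at_top (\<lambda>x. ?I h x - ?I h' x) = Lim at_top (?I h) - Lim at_top (?I h')" if "- d < a"
    using that
    by (intro tendsto_Lim tendsto_diff integral_tendsto_Lim[OF assms(1,2)] integral_tendsto_Lim[OF assms(3,4)]
         assms(6)) auto
  then have eq: "decaying_solution d T a h x - decaying_solution d T a h' x =
      decaying_solution d T a (\<lambda>x. h x - h' x) x"
    unfolding decaying_solution_def I by (cases "- d < a") (simp_all add: right_diff_distrib)
  show ?thesis
    unfolding eq by (rule decaying_solution_bound[OF continuous_on_diff[OF assms(1,3)] assms(5-7)])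
qed

text \<open>\<open>R_lip\<close> is the two-point form of vanishing to second order. It gives the
  contraction, and later the gain of one factor exp(-\<eta> x) when R is compared at two nearby
  functions.\<close>

locale stable_system =
  fixes nu om :: "'k::finite \<Rightarrow> real" and R :: "real^'k \<Rightarrow> real^'k" and \<eta> r C :: real
  assumes eta_pos: "0 < \<eta>" and r_pos: "0 < r" and C_nonneg: "0 \<le> C"
    and nu_le: "nu k \<le> - \<eta>" and om_nonneg: "0 \<le> om k"
    and R_zero: "R 0 = 0"
    and R_lip: "norm u \<le> r \<Longrightarrow> norm v \<le> r \<Longrightarrow>
      norm (R u - R v) \<le> C * (norm u + norm v) * norm (u - v)"
begin

text \<open>The equation (D - nu)(D - om) y = R(y) is split by z = (D - nu) y, so that only scalar
  first-order linear equations have to be solved. The radius \<open>r\<close> keeps y where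
  \<open>R_lip\<close> applies.\<close>

definition solution :: "real \<Rightarrow> (real \<Rightarrow> real^'k) \<Rightarrow> (real \<Rightarrow> real^'k) \<Rightarrow> bool" where
  "solution T y z \<longleftrightarrow> continuous_on {T..} y \<and> continuous_on {T..} z \<and> (\<forall>x\<ge>T. norm (y x) \<le> r) \<and>
     (\<forall>k. \<forall>x>T. ((\<lambda>x. y x $ k) has_real_derivative nu k * y x $ k + z x $ k) (at x) \<and>
       ((\<lambda>x. z x $ k) has_real_derivative om k * z x $ k + R (y x) $ k) (at x))"

lemma R_bound: "norm u \<le> r \<Longrightarrow> norm (R u) \<le> C * (norm u)\<^sup>2"
  using R_lip[of u 0] r_pos by (simp add: R_zero power2_eq_square mult.assoc)

lemma R_lipschitz:
  assumes "norm u \<le> r" "norm v \<le> r" shows "norm (R u - R v) \<le> 2 * C * r * norm (u - v)"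
proof -
  have "C * (norm u + norm v) * norm (u - v) \<le> C * (r + r) * norm (u - v)"
    using assms C_nonneg by (intro mult_right_mono mult_left_mono add_mono) auto
  with R_lip[OF assms] show ?thesis by (simp add: algebra_simps)
qed

lemma R_continuous: "continuous_on (cball 0 r) R"
proof -
  have "(2 * C * r)-lipschitz_on (cball 0 r) R"
    using R_lipschitz C_nonneg r_pos by (intro lipschitz_onI) (auto simp: dist_norm)
  then show ?thesis by (rule lipschitz_on_continuous_on)
qed

text \<open>At error rate d the coefficient b k is visible only if nu k > -d. For faster modes the
  last clause fixes it by the value at the starting time instead.\<close>

definition stable_solution where
  "stable_solution d B T b y z \<longleftrightarrow> solution T y z \<and>
    (\<forall>x\<ge>T. norm (y x) \<le> (B + 1) * exp (- \<eta> * x)) \<and>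
    (\<forall>k. \<exists>D. \<forall>x\<ge>T. \<bar>z x $ k\<bar> \<le> D * exp (- d * x) \<and>
       \<bar>y x $ k - b k * exp (nu k * x)\<bar> \<le> D * exp (- d * x)) \<and>
    (\<forall>k. nu k < - d \<longrightarrow> y T $ k = b k * exp (nu k * T))"

text \<open>Contraction principle in the space of y with exp(\<eta> x) y bounded. The order of
  quantifiers matters: one starting time serves all coefficient vectors of l1 size at most
  \<open>B\<close>.\<close>

lemma exists_solution_family:
  assumes tau: "\<eta> < d" "d < 2 * \<eta>" and nonres: "\<And>k. nu k \<noteq> - d" and "0 \<le> B"
  shows "\<exists>T. \<forall>b. (\<Sum>k\<in>UNIV. \<bar>b k\<bar>) \<le> B \<longrightarrow> (\<exists>y z. stable_solution d B T b y z)"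
proof -
  define d1 d2 where d_def: "d1 k = \<bar>om k + d\<bar>" "d2 k = \<bar>nu k + d\<bar>" for k
  \<comment> \<open>An upper bound for the composition of the two linear solution operators, summed
    over the components.\<close>
  define D where "D = (\<Sum>k\<in>UNIV. 1 / d1 k / d2 k)"
  have "D \<ge> 0" unfolding D_def d_def by (intro sum_nonneg) auto
  \<comment> \<open>Radius of the invariant ball: \<open>B\<close> for the prescribed linear part
    and 1 for the nonlinear correction.\<close>
  define m where "m = B + 1"
  have rho: "1 \<le> m" using \<open>0 \<le> B\<close> by (simp add: m_def)
  have om: "om k \<noteq> - d" for k using om_nonneg[of k] tau eta_pos by linarith
  \<comment> \<open>R(y) has rate 2\<eta> but is measured at rate d, so a late start gains
    exp(-(2\<eta> - d) T). The factor 4 yields the contraction constant 1/2, and with it the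
    invariance of the ball.\<close>
  have "((\<lambda>x. 4 * C * D * m\<^sup>2 * exp (- (2 * \<eta> - d) * x)) \<longlongrightarrow> 0) at_top"
    "((\<lambda>x. m * exp (- \<eta> * x)) \<longlongrightarrow> 0) at_top"
    using tau eta_pos by real_asymp+
  then have "\<forall>\<^sub>F x in at_top. 0 \<le> x \<and> 4 * C * D * m\<^sup>2 * exp (- (2 * \<eta> - d) * x) < 1 \<and> m * exp (- \<eta> * x) < r"
    using r_pos by (intro eventually_conj eventually_ge_at_top order_tendstoD(2)[where a=1] order_tendstoD(2)[where a=r]) auto
  then obtain T where T: "0 \<le> T" "4 * C * D * m\<^sup>2 * exp (- (2 * \<eta> - d) * T) < 1" "m * exp (- \<eta> * T) < r"
    using eventually_happens[of _ "at_top :: real filter"] by auto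
  define \<delta> K where "\<delta> = exp (- (2 * \<eta> - d) * T)" and K_def: "K = C * m\<^sup>2 * \<delta>"
  have delta: "exp (- 2 * \<eta> * x) \<le> \<delta> * exp (- d * x)" if "T \<le> x" for x
  proof -
    have "exp (- 2 * \<eta> * x) = exp (- (2 * \<eta> - d) * x) * exp (- d * x)"
      by (simp add: exp_add[symmetric] algebra_simps)
    also have "\<dots> \<le> \<delta> * exp (- d * x)"
      unfolding \<delta>_def using that tau by (intro mult_right_mono) auto
    finally show ?thesis .
  qed
  show ?thesis
  proof (intro exI[of _ T] allI impI)
    fix b :: "'k \<Rightarrow> real" assume b: "(\<Sum>k\<in>UNIV. \<bar>b k\<bar>) \<le> B"
    \<comment> \<open>The unknown is the bounded function \<open>g\<close>; \<open>y0 g\<close> puts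
      the weight back.\<close>
    define y0 where "y0 g x = exp (- \<eta> * x) *\<^sub>R apply_bcontfun g x" for g :: "real \<Rightarrow>\<^sub>C (real^'k)" and x
    define h where "h g k x = R (y0 g x) $ k" for g k x
    define z where "z g k = decaying_solution d T (om k) (h g k)" for g k
    define w where "w g k = decaying_solution d T (nu k) (z g k)" for g k
    define y where "y g x = (\<chi> k. w g k x + b k * exp (nu k * x))" for g x
    \<comment> \<open>\<open>max T x\<close> extends functions on [T, infinity) constantly to the
      left, as bounded continuous functions live on the whole line here.\<close>
    define \<Phi> where "\<Phi> g = Bcontfun (\<lambda>x. exp (\<eta> * max T x) *\<^sub>R y g (max T x))" for g
    define S where "S = (cball 0 m :: (real \<Rightarrow>\<^sub>C (real^'k)) set)"
    have y0_le: "norm (y0 g x) \<le> m * exp (- \<eta> * x)" if "g \<in> S" for g x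
    proof -
      have "norm (apply_bcontfun g x) \<le> m" using norm_bounded[of g x] that by (simp add: S_def)
      then show ?thesis by (simp add: y0_def)
    qed
    have y0_r: "norm (y0 g x) \<le> r" if "g \<in> S" "T \<le> x" for g x
    proof -
      have "m * exp (- \<eta> * x) \<le> m * exp (- \<eta> * T)" using that rho eta_pos by (intro mult_left_mono) auto
      with y0_le[OF that(1), of x] T(3) show ?thesis by linarith
    qed
    have y0_cont: "continuous_on X (y0 g)" for g X
      unfolding y0_def[abs_def] by (intro continuous_intros continuous_on_apply_bcontfun)
    have h_cont: "continuous_on {T..} (h g k)" if "g \<in> S" for g k
    proof -
      have "continuous_on {T..} (\<lambda>x. R (y0 g x))"
        by (rule continuous_on_compose2[OF R_continuous y0_cont]) (use y0_r[OF that] in auto)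
      then show ?thesis unfolding h_def[abs_def] by (intro continuous_intros)
    qed
    have h_bound: "\<bar>h g k x\<bar> \<le> K * exp (- d * x)" if "g \<in> S" "T \<le> x" for g k x
    proof -
      have "\<bar>h g k x\<bar> \<le> norm (R (y0 g x))" unfolding h_def by (rule component_le_norm_cart)
      also have "\<dots> \<le> C * (norm (y0 g x))\<^sup>2" by (intro R_bound y0_r that)
      also have "\<dots> \<le> C * (m * exp (- \<eta> * x))\<^sup>2"
        using y0_le[OF that(1)] C_nonneg by (intro mult_left_mono power_mono) auto
      also have "\<dots> = C * m\<^sup>2 * exp (- 2 * \<eta> * x)"
        by (simp add: power_mult_distrib exp_double[symmetric] mult.assoc)
      also have "\<dots> \<le> C * m\<^sup>2 * (\<delta> * exp (- d * x))"
        using C_nonneg by (intro mult_left_mono delta that) auto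
      finally show ?thesis by (simp add: K_def mult.assoc)
    qed
    define L where "L g g' = 2 * C * m * \<delta> * dist g g'" for g g' :: "real \<Rightarrow>\<^sub>C (real^'k)"
    have h_diff: "\<bar>h g k x - h g' k x\<bar> \<le> L g g' * exp (- d * x)"
      if "g \<in> S" "g' \<in> S" "T \<le> x" for g g' k x
    proof -
      have "\<bar>h g k x - h g' k x\<bar> \<le> norm (R (y0 g x) - R (y0 g' x))"
        unfolding h_def using component_le_norm_cart[of "R (y0 g x) - R (y0 g' x)" k] by simp
      also have "\<dots> \<le> C * (norm (y0 g x) + norm (y0 g' x)) * norm (y0 g x - y0 g' x)"
        by (intro R_lip y0_r that)
      also have "\<dots> \<le> C * (m * exp (- \<eta> * x) + m * exp (- \<eta> * x)) * (exp (- \<eta> * x) * dist g g')"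
      proof (intro mult_mono mult_left_mono add_mono y0_le that)
        show "norm (y0 g x - y0 g' x) \<le> exp (- \<eta> * x) * dist g g'"
          using dist_bounded[of g x g'] by (simp add: y0_def scaleR_diff_right[symmetric] dist_norm)
      qed (use C_nonneg rho in auto)
      also have "\<dots> = 2 * C * m * dist g g' * exp (- 2 * \<eta> * x)"
      proof -
        have "exp (- 2 * \<eta> * x) = exp (- \<eta> * x) * exp (- \<eta> * x)"
          by (simp add: exp_add[symmetric])
        then show ?thesis by (simp add: mult_ac)
      qed
      also have "\<dots> \<le> 2 * C * m * dist g g' * (\<delta> * exp (- d * x))"
        using C_nonneg rho by (intro mult_left_mono delta that) auto
      finally show ?thesis by (simp add: L_def mult_ac)
    qed
    note dsc = decaying_solution_continuous
    have z_cont: "continuous_on {T..} (z g k)" if "g \<in> S" for g k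
      unfolding z_def by (rule dsc[OF h_cont[OF that] h_bound[OF that] om])
    have z_bound: "\<bar>z g k x\<bar> \<le> K / d1 k * exp (- d * x)" if "g \<in> S" "T \<le> x" for g k x
      unfolding z_def d_def by (rule decaying_solution_bound[OF h_cont[OF that(1)] h_bound[OF that(1)] om that(2)])
    have z_diff: "\<bar>z g k x - z g' k x\<bar> \<le> L g g' / d1 k * exp (- d * x)"
      if "g \<in> S" "g' \<in> S" "T \<le> x" for g g' k x
      unfolding z_def d_def
      by (rule decaying_solution_diff_bound[OF h_cont[OF that(1)] h_bound[OF that(1)]
        h_cont[OF that(2)] h_bound[OF that(2)] h_diff[OF that(1,2)] om that(3)])
    have w_cont: "continuous_on {T..} (w g k)" if "g \<in> S" for g k
      unfolding w_def by (rule dsc[OF z_cont[OF that] z_bound[OF that] nonres])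
    have w_bound: "\<bar>w g k x\<bar> \<le> K / d1 k / d2 k * exp (- d * x)" if "g \<in> S" "T \<le> x" for g k x
      unfolding w_def d_def by (rule decaying_solution_bound[OF z_cont[OF that(1)] z_bound[unfolded d_def, OF that(1)] nonres that(2)])
    have w_diff: "\<bar>w g k x - w g' k x\<bar> \<le> L g g' / d1 k / d2 k * exp (- d * x)"
      if "g \<in> S" "g' \<in> S" "T \<le> x" for g g' k x
      unfolding w_def d_def
      by (rule decaying_solution_diff_bound[OF z_cont[OF that(1)] z_bound[unfolded d_def, OF that(1)]
        z_cont[OF that(2)] z_bound[unfolded d_def, OF that(2)] z_diff[unfolded d_def, OF that(1,2)] nonres that(3)])
    have exp_le: "exp (\<eta> * x) * exp (- d * x) \<le> 1" if "T \<le> x" for x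
    proof -
      have "\<eta> * x \<le> d * x" using that T tau by (intro mult_right_mono) auto
      then show ?thesis by (simp add: exp_add[symmetric])
    qed
    have sum_D: "(\<Sum>k\<in>UNIV. A / d1 k / d2 k * e) = A * D * e" for A e :: real
      unfolding D_def by (simp add: sum_distrib_left sum_distrib_right)
    have y_bound: "norm (exp (\<eta> * x) *\<^sub>R y g x) \<le> m" if "g \<in> S" "T \<le> x" for g x
    proof -
      have "norm (y g x) \<le> (\<Sum>k\<in>UNIV. \<bar>y g x $ k\<bar>)" by (rule norm_le_l1_cart)
      also have "\<dots> \<le> (\<Sum>k\<in>UNIV. K / d1 k / d2 k * exp (- d * x) + \<bar>b k\<bar> * exp (- \<eta> * x))"
      proof (rule sum_mono)
        fix k
        have "\<bar>b k * exp (nu k * x)\<bar> \<le> \<bar>b k\<bar> * exp (- \<eta> * x)"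
        proof -
          have "nu k * x \<le> - \<eta> * x" using nu_le[of k] that T by (intro mult_right_mono) auto
          then show ?thesis by (auto simp: abs_mult intro: mult_left_mono)
        qed
        with w_bound[OF that, of k]
        show "\<bar>y g x $ k\<bar> \<le> K / d1 k / d2 k * exp (- d * x) + \<bar>b k\<bar> * exp (- \<eta> * x)"
          unfolding y_def by simp
      qed
      also have "\<dots> = K * D * exp (- d * x) + (\<Sum>k\<in>UNIV. \<bar>b k\<bar>) * exp (- \<eta> * x)"
        unfolding sum.distrib sum_D by (simp add: sum_distrib_right)
      also have "\<dots> \<le> K * D * exp (- d * x) + B * exp (- \<eta> * x)"
        using b by (intro add_left_mono mult_right_mono) auto
      finally have "exp (\<eta> * x) * norm (y g x) \<le>
          exp (\<eta> * x) * (K * D * exp (- d * x) + B * exp (- \<eta> * x))"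
        by (intro mult_left_mono) auto
      also have "\<dots> = K * D * (exp (\<eta> * x) * exp (- d * x)) + B * (exp (\<eta> * x) * exp (- \<eta> * x))"
        by (simp add: algebra_simps)
      also have "exp (\<eta> * x) * exp (- \<eta> * x) = 1" by (simp add: exp_add[symmetric])
      also have "K * D * (exp (\<eta> * x) * exp (- d * x)) \<le> K * D * 1"
        using C_nonneg \<open>D \<ge> 0\<close> by (intro mult_left_mono exp_le that) (auto simp: \<delta>_def K_def)
      also have "K * D * 1 \<le> 1"
        using T(2) unfolding \<delta>_def[symmetric] K_def by (simp add: mult_ac)
      finally show ?thesis by (simp add: m_def)
    qed
    have y_cont: "continuous_on {T..} (y g)" if "g \<in> S" for g
      unfolding y_def[abs_def]
      by (intro continuous_on_vec_lambda continuous_intros w_cont that)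
    have Phi: "apply_bcontfun (\<Phi> g) = (\<lambda>x. exp (\<eta> * max T x) *\<^sub>R y g (max T x))" if "g \<in> S" for g
      unfolding \<Phi>_def
    proof (intro Bcontfun_inverse bcontfun_normI)
      show "continuous_on UNIV (\<lambda>x. exp (\<eta> * max T x) *\<^sub>R y g (max T x))"
        by (intro continuous_intros continuous_on_compose2[OF y_cont[OF that]]) auto
      show "norm (exp (\<eta> * max T x) *\<^sub>R y g (max T x)) \<le> m" for x
        by (intro y_bound that) auto
    qed
    have "\<exists>!g\<in>S. \<Phi> g = g"
    proof (rule Banach_fix[where c = "1/2"])
      show "complete S" unfolding S_def by (simp add: complete_eq_closed)
      show "S \<noteq> {}" unfolding S_def using rho by auto
      show "\<Phi> ` S \<subseteq> S"
      proof
        fix f assume "f \<in> \<Phi> ` S"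
        then obtain g where g: "g \<in> S" "f = \<Phi> g" by auto
        have "norm (\<Phi> g) \<le> m" by (intro norm_bound) (simp only: Phi[OF g(1)], intro y_bound g, simp)
        then show "f \<in> S" using g by (simp add: S_def)
      qed
      fix g g' assume g: "g \<in> S" "g' \<in> S"
      show "dist (\<Phi> g) (\<Phi> g') \<le> 1/2 * dist g g'"
      proof (rule dist_bound)
        fix x
        define u where "u = max T x"
        have "T \<le> u" by (simp add: u_def)
        have "norm (y g u - y g' u) \<le> (\<Sum>k\<in>UNIV. \<bar>(y g u - y g' u) $ k\<bar>)" by (rule norm_le_l1_cart)
        also have "\<dots> \<le> (\<Sum>k\<in>UNIV. L g g' / d1 k / d2 k * exp (- d * u))"
          using w_diff[OF g \<open>T \<le> u\<close>] by (intro sum_mono) (simp add: y_def)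
        also have "\<dots> = L g g' * D * exp (- d * u)" by (rule sum_D)
        finally have "exp (\<eta> * u) * norm (y g u - y g' u) \<le>
            exp (\<eta> * u) * (L g g' * D * exp (- d * u))"
          by (intro mult_left_mono) auto
        also have "\<dots> = (L g g' * D) * (exp (\<eta> * u) * exp (- d * u))"
          by simp
        also have "\<dots> \<le> (L g g' * D) * 1"
          using C_nonneg rho \<open>D \<ge> 0\<close> by (intro mult_left_mono exp_le \<open>T \<le> u\<close>) (auto simp: \<delta>_def L_def)
        also have "\<dots> = (2 * C * D * m * \<delta>) * dist g g'" by (simp add: L_def)
        also have "\<dots> \<le> 1/2 * dist g g'"
        proof (rule mult_right_mono)
          have "2 * C * D * m * \<delta> * 1 \<le> 2 * C * D * m * \<delta> * m"
            using C_nonneg rho \<open>D \<ge> 0\<close> by (intro mult_left_mono) (auto simp: \<delta>_def)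
          also have "\<dots> = 4 * C * D * m\<^sup>2 * \<delta> / 2" by (simp add: power2_eq_square)
          finally show "2 * C * D * m * \<delta> \<le> 1/2" using T(2) by (simp add: \<delta>_def)
        qed simp
        finally show "dist (apply_bcontfun (\<Phi> g) x) (apply_bcontfun (\<Phi> g') x) \<le> 1/2 * dist g g'"
          by (simp add: Phi g dist_norm u_def scaleR_diff_right[symmetric])
      qed
    qed simp_all
    then obtain g where g: "g \<in> S" "\<Phi> g = g" by blast
    \<comment> \<open>On [T, infinity) the fixed point equation says that the function inserted into
      R is the solution itself.\<close>
    have y0_eq: "y0 g x = y g x" if "T \<le> x" for x
    proof -
      have "apply_bcontfun g x = exp (\<eta> * x) *\<^sub>R y g x"
        using Phi[OF g(1)] g(2) that by (simp add: max_def)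
      then show ?thesis by (simp add: y0_def exp_add[symmetric])
    qed
    define zz where "zz x = (\<chi> k. z g k x)" for x
    have "solution T (y g) zz"
      unfolding solution_def
    proof (intro conjI allI impI)
      show "continuous_on {T..} (y g)" by (rule y_cont[OF g(1)])
      show "continuous_on {T..} zz"
        unfolding zz_def[abs_def] by (intro continuous_on_vec_lambda z_cont g)
      show "norm (y g x) \<le> r" if "T \<le> x" for x using y0_r[OF g(1) that] y0_eq[OF that] by simp
    next
      fix k x assume "T < x"
      have dw: "(w g k has_real_derivative nu k * w g k x + z g k x) (at x)"
        unfolding w_def
        by (rule decaying_solution_deriv[OF z_cont[OF g(1)] z_bound[OF g(1)] nonres \<open>T < x\<close>])
      show "((\<lambda>x. y g x $ k) has_real_derivative nu k * y g x $ k + zz x $ k) (at x)"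
        unfolding y_def zz_def vec_lambda_beta
        by (auto intro!: derivative_eq_intros dw simp: algebra_simps)
      have "(z g k has_real_derivative om k * z g k x + h g k x) (at x)"
        unfolding z_def
        by (rule decaying_solution_deriv[OF h_cont[OF g(1)] h_bound[OF g(1)] om \<open>T < x\<close>])
      then show "((\<lambda>x. zz x $ k) has_real_derivative om k * zz x $ k + R (y g x) $ k) (at x)"
        using \<open>T < x\<close> by (simp add: zz_def h_def y0_eq)
    qed
    moreover have "norm (y g x) \<le> (B + 1) * exp (- \<eta> * x)" if "T \<le> x" for x
      using y0_le[OF g(1), of x] y0_eq[OF that] by (simp add: m_def)
    moreover have "\<exists>D. \<forall>x\<ge>T. \<bar>zz x $ k\<bar> \<le> D * exp (- d * x) \<and>
       \<bar>y g x $ k - b k * exp (nu k * x)\<bar> \<le> D * exp (- d * x)" for k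
    proof (intro exI[of _ "max (K / d1 k) (K / d1 k / d2 k)"] allI impI conjI)
      fix x assume "T \<le> x"
      show "\<bar>zz x $ k\<bar> \<le> max (K / d1 k) (K / d1 k / d2 k) * exp (- d * x)"
        unfolding zz_def vec_lambda_beta
        by (rule order_trans[OF z_bound[OF g(1) \<open>T \<le> x\<close>] mult_right_mono]) auto
      show "\<bar>y g x $ k - b k * exp (nu k * x)\<bar> \<le> max (K / d1 k) (K / d1 k / d2 k) * exp (- d * x)"
        unfolding y_def vec_lambda_beta add_diff_cancel_right'
        by (rule order_trans[OF w_bound[OF g(1) \<open>T \<le> x\<close>] mult_right_mono]) auto
    qed
    moreover have "y g T $ k = b k * exp (nu k * T)" if "nu k < - d" for k
      unfolding y_def vec_lambda_beta w_def
      using decaying_solution_start[OF z_cont[OF g(1)] z_bound[OF g(1)] nonres that] by simp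
    ultimately show "\<exists>y z. stable_solution d B T b y z"
      unfolding stable_solution_def
      by blast
  qed
qed

end

section \<open>Polynomial approximation near the origin\<close>

abbreviation norm_order :: "nat \<Rightarrow> ('a::real_normed_vector \<Rightarrow> real) set" where
  "norm_order m \<equiv> O[nhds 0](\<lambda>u. norm u ^ m)"

text \<open>Encodes polynomials without terms of degree below j, on any normed space and without
  coordinates. The degree bound is what later becomes a decay rate, in
  \<open>poly_order_exp_poly\<close>.\<close>

inductive poly_order :: "nat \<Rightarrow> ('a::real_normed_vector \<Rightarrow> real) \<Rightarrow> bool" where
  const: "poly_order 0 (\<lambda>_. c)"
| linear: "bounded_linear l \<Longrightarrow> poly_order 1 l"
| add: "poly_order j f \<Longrightarrow> poly_order j g \<Longrightarrow> poly_order j (\<lambda>u. f u + g u)"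
| mult: "poly_order i f \<Longrightarrow> poly_order j g \<Longrightarrow> poly_order (i + j) (\<lambda>u. f u * g u)"
| weaken: "poly_order (Suc j) f \<Longrightarrow> poly_order j f"

lemma poly_order_le:
  assumes "poly_order j f" "i \<le> j" shows "poly_order i f"
  using assms(2,1) by (induction rule: inc_induct) (auto intro: poly_order.weaken)

lemma poly_order_sum: "(\<And>i. i \<in> I \<Longrightarrow> poly_order 0 (f i)) \<Longrightarrow> poly_order 0 (\<lambda>u. \<Sum>i\<in>I. f i u)"
  by (induction I rule: infinite_finite_induct) (auto intro: poly_order.const poly_order.add)

lemma poly_order_cmult: "poly_order j f \<Longrightarrow> poly_order j (\<lambda>u. c * f u)"
  using poly_order.mult[OF poly_order.const[of c]] by fastforce

definition affine_plus_quadratic :: "('a::real_normed_vector \<Rightarrow> real) \<Rightarrow> bool" where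
  "affine_plus_quadratic f \<longleftrightarrow>
     (\<exists>c l Q. bounded_linear l \<and> poly_order 2 Q \<and> (\<forall>u. f u = c + l u + Q u))"

lemma affine_plus_quadraticI:
  "bounded_linear l \<Longrightarrow> poly_order 2 Q \<Longrightarrow> (\<And>u. f u = c + l u + Q u) \<Longrightarrow> affine_plus_quadratic f"
  unfolding affine_plus_quadratic_def by blast

lemma affine_plus_quadraticE:
  assumes "affine_plus_quadratic f"
  obtains c l Q where "bounded_linear l" "poly_order 2 Q" "\<And>u. f u = c + l u + Q u"
  using assms unfolding affine_plus_quadratic_def by blast

lemma poly_order_2_zero: "poly_order 2 (\<lambda>_. 0)"
  using poly_order.mult[OF poly_order.linear poly_order.linear, OF bounded_linear_zero bounded_linear_zero]
  by (simp add: numeral_2_eq_2)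

text \<open>Products are multiplied out and everything of degree at least two is collected in Q.
  This is needed because approximating polynomials are first obtained with order 0 only.\<close>

lemma poly_order_decompose: "poly_order j f \<Longrightarrow> affine_plus_quadratic f"
proof (induction rule: poly_order.induct)
  case (const c)
  show ?case by (rule affine_plus_quadraticI[OF bounded_linear_zero poly_order_2_zero, where c = c]) simp
next
  case (linear l)
  show ?case by (rule affine_plus_quadraticI[OF linear poly_order_2_zero, where c = 0]) simp
next
  case (add j f g)
  obtain c l Q where f: "bounded_linear l" "poly_order 2 Q" "\<And>u. f u = c + l u + Q u"
    using add.IH(1) by (rule affine_plus_quadraticE) blast
  obtain c' l' Q' where g: "bounded_linear l'" "poly_order 2 Q'" "\<And>u. g u = c' + l' u + Q' u"
    using add.IH(2) by (rule affine_plus_quadraticE) blast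
  show ?case
    by (rule affine_plus_quadraticI[OF bounded_linear_add[OF f(1) g(1)] poly_order.add[OF f(2) g(2)],
          where c = "c + c'"]) (simp add: f(3) g(3))
next
  case (mult i f j g)
  obtain c l Q where f: "bounded_linear l" "poly_order 2 Q" "\<And>u. f u = c + l u + Q u"
    using mult.IH(1) by (rule affine_plus_quadraticE) blast
  obtain c' l' Q' where g: "bounded_linear l'" "poly_order 2 Q'" "\<And>u. g u = c' + l' u + Q' u"
    using mult.IH(2) by (rule affine_plus_quadraticE) blast
  note l = poly_order.linear[OF f(1)] poly_order.linear[OF g(1)]
  have q: "poly_order 2 (\<lambda>u. l u * l' u)" "poly_order 2 (\<lambda>u. l u * Q' u)"
    "poly_order 2 (\<lambda>u. Q u * l' u)" "poly_order 2 (\<lambda>u. Q u * Q' u)"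
    using poly_order_le[OF poly_order.mult[OF l(1) l(2)], of 2] poly_order_le[OF poly_order.mult[OF l(1) g(2)], of 2]
      poly_order_le[OF poly_order.mult[OF f(2) l(2)], of 2] poly_order_le[OF poly_order.mult[OF f(2) g(2)], of 2]
    by simp_all
  have "poly_order 2 (\<lambda>u. c * Q' u + (c' * Q u + (l u * l' u + (l u * Q' u + (Q u * l' u + Q u * Q' u)))))"
    by (intro poly_order.add[OF poly_order_cmult[OF g(2)]] poly_order.add[OF poly_order_cmult[OF f(2)]]
      poly_order.add[OF q(1)] poly_order.add[OF q(2)] poly_order.add[OF q(3)] q(4))
  moreover have "bounded_linear (\<lambda>u. c * l' u + c' * l u)"
    by (intro bounded_linear_add bounded_linear_const_mult f g)
  ultimately show ?case
    by (intro affine_plus_quadraticI[where c = "c * c'" and l = "\<lambda>u. c * l' u + c' * l u"])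
      (auto simp: f(3) g(3) algebra_simps)
qed

lemma linear_bigo_norm: "bounded_linear l \<Longrightarrow> l \<in> O[F](\<lambda>u. norm u)"
  for l :: "'a::real_normed_vector \<Rightarrow> real"
  by (rule bigoI[of _ "onorm l"]) (use onorm[of l] in auto)

lemma norm_power_bigo_weaken:
  assumes "i \<le> j" shows "(\<lambda>u::'a::real_normed_vector. norm u ^ j) \<in> norm_order i"
proof (rule bigoI[of _ 1])
  have "\<forall>\<^sub>F u::'a in nhds 0. norm u < 1"
    using eventually_nhds_metric[of "\<lambda>u::'a. norm u < 1" 0] by (auto intro: exI[of _ 1])
  then show "\<forall>\<^sub>F u::'a in nhds 0. norm (norm u ^ j) \<le> 1 * norm (norm u ^ i)"
    by eventually_elim (use assms in \<open>simp add: power_decreasing\<close>)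
qed

lemma poly_order_bigo: "poly_order j f \<Longrightarrow> f \<in> norm_order j"
proof (induction rule: poly_order.induct)
  case (linear l)
  then show ?case using linear_bigo_norm[of l] by simp
next
  case (mult i f j g)
  then show ?case unfolding power_add by (intro landau_o.big.mult)
next
  case (weaken j f)
  then show ?case using landau_o.big_trans norm_power_bigo_weaken[of j "Suc j"] by auto
qed (auto intro: sum_in_bigo)

text \<open>Each linear factor contributes one multiple of the rate c, so a polynomial of order 2 in
  functions of rate -\<eta> has rate -2\<eta>. Passing to a lower order is harmless because c \<le>
  0.\<close>

lemma poly_order_exp_poly:
  fixes E :: "real \<Rightarrow> real^'k"
  assumes "poly_order j Q" and E: "\<And>k. exp_poly c (\<lambda>x. E x $ k)" and "c \<le> 0"
  shows "exp_poly (j * c) (\<lambda>x. Q (E x))"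
  using assms(1)
proof (induction rule: poly_order.induct)
  case (const A)
  show ?case using exp_poly_exp[of 0 0 A] by simp
next
  case (linear l)
  interpret bounded_linear l by fact
  have "l (E x) = (\<Sum>k\<in>UNIV. l (axis k 1) * E x $ k)" for x
  proof -
    have "E x = (\<Sum>k\<in>UNIV. E x $ k *\<^sub>R axis k 1)"
      using basis_expansion[of "E x"] by (simp add: scalar_mult_eq_scaleR)
    then have "l (E x) = l (\<Sum>k\<in>UNIV. E x $ k *\<^sub>R axis k 1)" by simp
    also have "\<dots> = (\<Sum>k\<in>UNIV. l (axis k 1) * E x $ k)" by (simp add: sum scaleR mult.commute)
    finally show ?thesis .
  qed
  then show ?case by (auto intro!: exp_poly_sum exp_poly_cmult E)
next
  case (mult i f j g)
  from exp_poly_mult[OF mult.IH] show ?case by (simp add: algebra_simps)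
next
  case (weaken j f)
  then show ?case using \<open>c \<le> 0\<close> by (elim exp_poly_mono) (simp add: algebra_simps)
qed (auto intro: exp_poly.add)

text \<open>Plays the role of smoothness at 0: approximation by polynomials to every order is stable
  under sums, products and composition, so the force can be expanded without higher derivatives in
  several variables.\<close>

definition poly_approx :: "('a::real_normed_vector \<Rightarrow> real) \<Rightarrow> bool" where
  "poly_approx g \<longleftrightarrow> (\<forall>m. \<exists>P. poly_order 0 P \<and> (\<lambda>u. g u - P u) \<in> norm_order m)"

lemma poly_order_0: "poly_order j P \<Longrightarrow> poly_order 0 P"
  by (erule poly_order_le) simp

lemma poly_approx_poly: "poly_order j P \<Longrightarrow> poly_approx P"
  unfolding poly_approx_def using poly_order_0[of j P] by (intro allI exI[of _ P]) simp

lemma poly_approx_const: "poly_approx (\<lambda>_. c)"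
  by (rule poly_approx_poly[OF poly_order.const])

lemma poly_approx_linear: "bounded_linear l \<Longrightarrow> poly_approx l"
  by (rule poly_approx_poly[OF poly_order.linear])

lemma poly_approx_bounded:
  assumes "poly_approx g" shows "g \<in> O[nhds 0](\<lambda>_. 1)"
proof -
  obtain P where P: "poly_order 0 P" "(\<lambda>u. g u - P u) \<in> norm_order 0"
    using assms unfolding poly_approx_def by blast
  from sum_in_bigo(1)[OF P(2) poly_order_bigo[OF P(1)]] show ?thesis by simp
qed

lemma poly_approx_add:
  assumes "poly_approx f" "poly_approx g" shows "poly_approx (\<lambda>u. f u + g u)"
  unfolding poly_approx_def
proof
  fix m
  obtain P Q where "poly_order 0 P" "(\<lambda>u. f u - P u) \<in> norm_order m"
    "poly_order 0 Q" "(\<lambda>u. g u - Q u) \<in> norm_order m"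
    using assms[unfolded poly_approx_def, rule_format, of m] by blast
  moreover from sum_in_bigo(1)[OF this(2,4)]
  have "(\<lambda>u. f u + g u - (P u + Q u)) \<in> norm_order m"
    by (simp add: algebra_simps)
  ultimately show "\<exists>P. poly_order 0 P \<and> (\<lambda>u. f u + g u - P u) \<in> norm_order m"
    by (intro exI[of _ "\<lambda>u. P u + Q u"]) (auto intro: poly_order.add)
qed

lemma poly_approx_mult:
  assumes "poly_approx f" "poly_approx g" shows "poly_approx (\<lambda>u. f u * g u)"
  unfolding poly_approx_def
proof
  fix m
  obtain P Q where P: "poly_order 0 P" "(\<lambda>u. f u - P u) \<in> norm_order m"
    and Q: "poly_order 0 Q" "(\<lambda>u. g u - Q u) \<in> norm_order m"
    using assms[unfolded poly_approx_def, rule_format, of m] by blast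
  have "(\<lambda>u. (f u - P u) * g u) \<in> O[nhds 0](\<lambda>u. norm u ^ m * 1)"
    by (rule landau_o.big.mult[OF P(2) poly_approx_bounded[OF assms(2)]])
  moreover have "(\<lambda>u. P u * (g u - Q u)) \<in> O[nhds 0](\<lambda>u. 1 * norm u ^ m)"
    using landau_o.big.mult[OF poly_order_bigo[OF P(1)] Q(2)] by simp
  ultimately have "(\<lambda>u. (f u - P u) * g u + P u * (g u - Q u)) \<in> norm_order m"
    unfolding mult_1 mult_1_right by (rule sum_in_bigo(1))
  moreover have "(\<lambda>u. (f u - P u) * g u + P u * (g u - Q u)) = (\<lambda>u. f u * g u - P u * Q u)"
    by (simp add: algebra_simps fun_eq_iff)
  moreover have "poly_order 0 (\<lambda>u. P u * Q u)" using poly_order.mult[OF P(1) Q(1)] by simp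
  ultimately show "\<exists>P. poly_order 0 P \<and> (\<lambda>u. f u * g u - P u) \<in> norm_order m"
    by (intro exI[of _ "\<lambda>u. P u * Q u"]) auto
qed

lemma poly_approx_sum: "(\<And>i. i \<in> I \<Longrightarrow> poly_approx (f i)) \<Longrightarrow> poly_approx (\<lambda>u. \<Sum>i\<in>I. f i u)"
  by (induction I rule: infinite_finite_induct) (auto intro: poly_approx_const poly_approx_add)

lemma poly_approx_poly_comp:
  assumes "poly_order j P" "poly_approx g" shows "poly_approx (\<lambda>u. P (g u :: real))"
  using assms(1)
proof (induction rule: poly_order.induct)
  case (linear l)
  interpret bounded_linear l by fact
  have "l x = l 1 * x" for x using scaleR[of x 1] by simp
  then have "(\<lambda>u. l (g u)) = (\<lambda>u. l 1 * g u)" by blast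
  then show ?case using poly_approx_mult[OF poly_approx_const[of "l 1"] assms(2)] by simp
qed (auto intro: poly_approx_const poly_approx_add poly_approx_mult)

text \<open>An error of size |h|^m in f becomes |g u|^m with g u = O(|u|). It remains to insert g
  into a polynomial, which is a matter of sums and products.\<close>

lemma poly_approx_comp:
  assumes f: "poly_approx f" and g: "poly_approx g" and g0: "g \<in> O[nhds 0](\<lambda>u. norm u)"
    and lim: "filterlim g (nhds 0) (nhds 0)"
  shows "poly_approx (\<lambda>u. f (g u :: real))"
  unfolding poly_approx_def
proof
  fix m
  obtain P where P: "poly_order 0 P" "(\<lambda>u. f u - P u) \<in> norm_order m"
    using f unfolding poly_approx_def by blast
  obtain Q where Q: "poly_order 0 Q" "(\<lambda>u. P (g u) - Q u) \<in> norm_order m"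
    using poly_approx_poly_comp[OF P(1) g] unfolding poly_approx_def by blast
  have "(\<lambda>u. f (g u) - P (g u)) \<in> O[nhds 0](\<lambda>u. norm (g u) ^ m)"
    by (rule landau_o.big.compose[OF P(2) lim])
  also have "(\<lambda>u. norm (g u) ^ m) \<in> norm_order m"
    using g0 by (intro landau_o.big_power) simp
  finally have "(\<lambda>u. (f (g u) - P (g u)) + (P (g u) - Q u)) \<in> norm_order m"
    by (rule sum_in_bigo(1)[OF _ Q(2)])
  then show "\<exists>P. poly_order 0 P \<and> (\<lambda>u. f (g u) - P u) \<in> norm_order m"
    using Q(1) by (intro exI[of _ Q]) simp
qed

lemma poly_approx_powr:
  assumes "0 < x0" shows "poly_approx (\<lambda>h. (x0 + h) powr e)"
  unfolding poly_approx_def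
proof
  fix m :: nat
  define df where "df n x = (\<Prod>i<n. e - real i) * x powr (e - real n)" for n x
  have ddf: "(df n has_real_derivative df (Suc n) x) (at x)" if "0 < x" for n x
    unfolding df_def using that
    by (auto intro!: derivative_eq_intros simp: algebra_simps)
  \<comment> \<open>Taylor's theorem with Lagrange remainder needs a positive number of terms, so
    order m + 1 is used and weakened at the end.\<close>
  define M where "M = Suc m"
  define P where "P h = (\<Sum>n<M. df n x0 / fact n * h ^ n)" for h :: real
  have "poly_order 0 (\<lambda>h::real. h ^ n)" for n
  proof (induction n)
    case (Suc n)
    have "poly_order 0 (\<lambda>h::real. h)"
      using poly_order_0[OF poly_order.linear[OF bounded_linear_ident]] by simp
    from poly_order.mult[OF this Suc] show ?case by simp
  qed (simp add: poly_order.const)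
  then have "poly_order 0 P" unfolding P_def[abs_def] by (intro poly_order_sum poly_order_cmult)
  have "continuous_on {x0/2..2*x0} (df M)"
    using assms by (intro continuous_at_imp_continuous_on ballI DERIV_isCont[OF ddf]) auto
  then have "bounded (df M ` {x0/2..2*x0})"
    by (intro compact_imp_bounded compact_continuous_image) auto
  then obtain K where K: "\<And>x. x \<in> {x0/2..2*x0} \<Longrightarrow> \<bar>df M x\<bar> \<le> K"
    unfolding bounded_iff by (metis image_eqI real_norm_def)
  have K0: "0 \<le> K" using K[of x0] assms by (smt (verit) atLeastAtMost_iff field_sum_of_halves)
  have "(\<lambda>h. (x0 + h) powr e - P h) \<in> norm_order M"
  proof (rule bigoI[of _ "K / fact M"])
    have "\<forall>\<^sub>F h in nhds 0. \<bar>h\<bar> < x0/2"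
      using assms eventually_nhds_metric[of "\<lambda>h. \<bar>h\<bar> < x0/2" 0] by (auto intro: exI[of _ "x0/2"])
    then show "\<forall>\<^sub>F h in nhds 0. norm ((x0 + h) powr e - P h) \<le> K / fact M * norm (norm h ^ M)"
    proof eventually_elim
      case (elim h)
      show ?case
      \<comment> \<open>Taylor's theorem is applied at a point different from the centre; at the
        centre only the constant term survives.\<close>
      proof (cases "h = 0")
        case True
        have "P 0 = df 0 x0" unfolding P_def M_def by (simp add: lessThan_Suc_eq_insert_0 sum.reindex)
        then show ?thesis using True K0 by (simp add: df_def)
      next
        case False
        have "\<exists>t. (if x0 + h < x0 then x0 + h < t \<and> t < x0 else x0 < t \<and> t < x0 + h) \<and>
          df 0 (x0 + h) = (\<Sum>n<M. df n x0 / fact n * (x0 + h - x0) ^ n) + df M t / fact M * (x0 + h - x0) ^ M"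
          using False elim ddf by (intro Taylor[where a = "x0/2" and b = "2*x0"]) (auto simp: M_def)
        then obtain t where t': "if x0 + h < x0 then x0 + h < t \<and> t < x0 else x0 < t \<and> t < x0 + h"
          "df 0 (x0 + h) = (\<Sum>n<M. df n x0 / fact n * (x0 + h - x0) ^ n) + df M t / fact M * (x0 + h - x0) ^ M"
          by blast
        then have t: "t \<in> {x0/2..2*x0}" "df 0 (x0 + h) = P h + df M t / fact M * h ^ M"
          using elim by (auto simp: P_def split: if_splits)
        have "\<bar>df M t / fact M * h ^ M\<bar> \<le> K / fact M * \<bar>h\<bar> ^ M"
          using K[OF t(1)] by (simp add: abs_mult power_abs divide_right_mono mult_right_mono)
        then show ?thesis using t(2) by (simp add: df_def power_abs)
      qed
    qed
  qed
  then have "(\<lambda>h. (x0 + h) powr e - P h) \<in> norm_order m"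
    by (rule landau_o.big_trans[OF _ norm_power_bigo_weaken]) (simp add: M_def)
  with \<open>poly_order 0 P\<close> show "\<exists>P. poly_order 0 P \<and> (\<lambda>h. (x0 + h) powr e - P h) \<in> norm_order m"
    by blast
qed

section \<open>Differentials with a two-point quadratic remainder\<close>

abbreviation pair_order :: "('a::real_normed_vector \<times> 'a \<Rightarrow> real) set" where
  "pair_order \<equiv> O[nhds (0, 0)](\<lambda>x. (norm (fst x) + norm (snd x)) * norm (fst x - snd x))"

text \<open>A differential at 0 whose remainder is controlled at pairs of points. Taking the second
  point 0 gives the usual quadratic remainder; the two-point form is the Lipschitz estimate demanded
  by \<open>R_lip\<close>.\<close>

definition quad_deriv :: "('a::real_normed_vector \<Rightarrow> real) \<Rightarrow> ('a \<Rightarrow> real) \<Rightarrow> bool" where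
  "quad_deriv g l \<longleftrightarrow> bounded_linear l \<and>
     (\<lambda>x. g (fst x) - g (snd x) - l (fst x - snd x)) \<in> pair_order"

lemma quad_deriv_const: "quad_deriv (\<lambda>_. c) (\<lambda>_. 0)"
  unfolding quad_deriv_def by (simp add: bounded_linear_zero)

lemma quad_deriv_linear: "bounded_linear l \<Longrightarrow> quad_deriv l l"
  unfolding quad_deriv_def by (simp add: linear_diff[OF bounded_linear.linear])

lemma quad_deriv_add:
  assumes "quad_deriv f l" "quad_deriv g k" shows "quad_deriv (\<lambda>u. f u + g u) (\<lambda>u. l u + k u)"
  using assms sum_in_bigo(1)[OF conjunct2[OF assms(1)[unfolded quad_deriv_def]]
    conjunct2[OF assms(2)[unfolded quad_deriv_def]]]
  unfolding quad_deriv_def by (simp add: bounded_linear_add algebra_simps)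

lemma quad_deriv_sum:
  "(\<And>i. i \<in> I \<Longrightarrow> quad_deriv (f i) (l i)) \<Longrightarrow> quad_deriv (\<lambda>u. \<Sum>i\<in>I. f i u) (\<lambda>u. \<Sum>i\<in>I. l i u)"
  by (induction I rule: infinite_finite_induct) (auto intro: quad_deriv_const quad_deriv_add)

lemma nhds_0_fst_snd:
  "filterlim fst (nhds (0::'a::real_normed_vector)) (nhds (0::'a, 0::'a))"
  "filterlim snd (nhds (0::'a)) (nhds (0::'a, 0::'a))"
  using tendsto_fst[OF filterlim_ident[of "nhds (0::'a, 0::'a)"]]
    tendsto_snd[OF filterlim_ident[of "nhds (0::'a, 0::'a)"]] by simp_all

lemma linear_diff_bigo:
  "bounded_linear l \<Longrightarrow> (\<lambda>x. l (fst x - snd x)) \<in> O[F](\<lambda>x. norm (fst x - snd x))"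
  for l :: "'a::real_normed_vector \<Rightarrow> real"
  by (rule bigoI[of _ "onorm l"]) (use onorm[of l] in auto)

lemma quad_deriv_lipschitz:
  assumes "quad_deriv g l"
  shows "(\<lambda>x. g (fst x) - g (snd x)) \<in> O[nhds (0, 0)](\<lambda>x. norm (fst x - snd x))"
proof -
  have "((\<lambda>x. norm (fst x) + norm (snd x)) \<longlongrightarrow> norm (0::'a) + norm (0::'a)) (nhds (0::'a, 0::'a))"
    using nhds_0_fst_snd by (intro tendsto_add tendsto_norm)
  then have "\<forall>\<^sub>F x in nhds (0::'a, 0::'a). norm (fst x) + norm (snd x) < 1"
    by (rule order_tendstoD) simp
  then have "(\<lambda>x. norm (fst x) + norm (snd x)) \<in> O[nhds (0::'a, 0::'a)](\<lambda>_. 1 :: real)"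
    by (intro bigoI[of _ 1]) (auto elim: eventually_mono)
  from landau_o.big.mult[OF this landau_o.big_refl[of "\<lambda>x. norm (fst x - snd x)"]]
  have "(\<lambda>x. (norm (fst x) + norm (snd x)) * norm (fst x - snd x))
    \<in> O[nhds (0::'a, 0::'a)](\<lambda>x. norm (fst x - snd x))" by simp
  from landau_o.big_trans[OF conjunct2[OF assms[unfolded quad_deriv_def]] this]
  have "(\<lambda>x. g (fst x) - g (snd x) - l (fst x - snd x)) \<in> O[nhds (0, 0)](\<lambda>x. norm (fst x - snd x))" .
  moreover have "(\<lambda>x. l (fst x - snd x)) \<in> O[nhds (0, 0)](\<lambda>x. norm (fst x - snd x))"
    using assms by (intro linear_diff_bigo) (simp add: quad_deriv_def)
  ultimately show ?thesis by (auto dest: sum_in_bigo(1))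
qed

lemma quad_deriv_diff_0:
  assumes "quad_deriv g l" shows "(\<lambda>u. g u - g 0) \<in> O[nhds 0](\<lambda>u. norm u)"
proof -
  have "filterlim (\<lambda>u::'a. (u, 0::'a)) (nhds (0, 0)) (nhds 0)" by (intro tendsto_Pair tendsto_const filterlim_ident)
  from landau_o.big.compose[OF quad_deriv_lipschitz[OF assms] this] show ?thesis by simp
qed

lemma quad_deriv_tendsto:
  assumes "quad_deriv g l" shows "(g \<longlongrightarrow> g 0) (nhds 0)"
proof -
  obtain c where c: "\<forall>\<^sub>F u in nhds 0. norm (g u - g 0) \<le> c * norm (norm u)"
    using landau_o.bigE[OF quad_deriv_diff_0[OF assms]] by blast
  have "((\<lambda>u::'a. c * norm (norm u)) \<longlongrightarrow> c * norm (norm (0::'a))) (nhds 0)"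
    by (intro tendsto_mult tendsto_norm tendsto_const filterlim_ident)
  then have "((\<lambda>u. g u - g 0) \<longlongrightarrow> 0) (nhds 0)"
    by (intro Lim_null_comparison[OF c]) simp
  then show ?thesis by (simp add: LIM_zero_iff)
qed

lemma quad_deriv_mult:
  assumes f: "quad_deriv f l" and g: "quad_deriv g k"
  shows "quad_deriv (\<lambda>u. f u * g u) (\<lambda>u. f 0 * k u + g 0 * l u)"
proof -
  let ?F = "nhds (0::'a, 0::'a)"
  let ?S = "\<lambda>x::'a \<times> 'a. norm (fst x) + norm (snd x)" and ?D = "\<lambda>x::'a \<times> 'a. norm (fst x - snd x)"
  have lin: "bounded_linear l" "bounded_linear k" using f g by (auto simp: quad_deriv_def)
  note fst = nhds_0_fst_snd(1)[where 'a = 'a] and snd = nhds_0_fst_snd(2)[where 'a = 'a]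
  note D = linear_diff_bigo[of _ ?F]
  have S: "(\<lambda>x. norm (fst x)) \<in> O[?F](?S)" "(\<lambda>x. norm (snd x)) \<in> O[?F](?S)"
    by (auto intro!: bigoI[of _ 1])
  have bd: "(\<lambda>x. f (fst x)) \<in> O[?F](\<lambda>_. 1)" "(\<lambda>x. g (snd x)) \<in> O[?F](\<lambda>_. 1)"
    using filterlim_compose[OF quad_deriv_tendsto[OF f] fst] filterlim_compose[OF quad_deriv_tendsto[OF g] snd]
    by (auto intro!: bigoI_tendsto)
  have "(\<lambda>x. f (fst x) * (g (fst x) - g (snd x) - k (fst x - snd x))) \<in> O[?F](\<lambda>x. 1 * (?S x * ?D x))"
    using g by (intro landau_o.big.mult bd) (simp add: quad_deriv_def)
  moreover have "(\<lambda>x. g (snd x) * (f (fst x) - f (snd x) - l (fst x - snd x))) \<in> O[?F](\<lambda>x. 1 * (?S x * ?D x))"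
    using f by (intro landau_o.big.mult bd) (simp add: quad_deriv_def)
  moreover have "(\<lambda>x. (f (fst x) - f 0) * k (fst x - snd x)) \<in> O[?F](\<lambda>x. ?S x * ?D x)"
    by (rule landau_o.big.mult[OF landau_o.big_trans[OF
      landau_o.big.compose[OF quad_deriv_diff_0[OF f] fst] S(1)] D[OF lin(2)]])
  moreover have "(\<lambda>x. (g (snd x) - g 0) * l (fst x - snd x)) \<in> O[?F](\<lambda>x. ?S x * ?D x)"
    by (rule landau_o.big.mult[OF landau_o.big_trans[OF
      landau_o.big.compose[OF quad_deriv_diff_0[OF g] snd] S(2)] D[OF lin(1)]])
  \<comment> \<open>The four terms add up to the exact remainder of the product: two carry the
    remainders of the factors, two the deviation of a factor from its value at 0.\<close>
  ultimately have "(\<lambda>x. (f (fst x) * (g (fst x) - g (snd x) - k (fst x - snd x)) +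
      g (snd x) * (f (fst x) - f (snd x) - l (fst x - snd x))) +
      ((f (fst x) - f 0) * k (fst x - snd x) + (g (snd x) - g 0) * l (fst x - snd x))) \<in> O[?F](\<lambda>x. ?S x * ?D x)"
    (is "(\<lambda>x. ?B x) \<in> _") unfolding mult_1 by (intro sum_in_bigo(1))
  moreover have "?B x = f (fst x) * g (fst x) - f (snd x) * g (snd x) -
      (f 0 * k (fst x - snd x) + g 0 * l (fst x - snd x))" for x
    by (simp add: algebra_simps)
  ultimately show ?thesis
    using lin by (simp add: quad_deriv_def bounded_linear_add bounded_linear_const_mult)
qed

lemma quad_deriv_comp:
  fixes f :: "real \<Rightarrow> real"
  assumes f: "quad_deriv f (\<lambda>h. A * h)" and g: "quad_deriv g l" and "g 0 = 0"
  shows "quad_deriv (\<lambda>u. f (g u)) (\<lambda>u. A * l u)"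
proof -
  let ?F = "nhds (0::'a, 0::'a)"
  let ?S = "\<lambda>x::'a \<times> 'a. norm (fst x) + norm (snd x)" and ?D = "\<lambda>x::'a \<times> 'a. norm (fst x - snd x)"
  note fst = nhds_0_fst_snd(1)[where 'a = 'a] and snd = nhds_0_fst_snd(2)[where 'a = 'a]
  have S: "(\<lambda>x. norm (fst x)) \<in> O[?F](?S)" "(\<lambda>x. norm (snd x)) \<in> O[?F](?S)"
    by (auto intro!: bigoI[of _ 1])
  have "filterlim (\<lambda>x. (g (fst x), g (snd x))) (nhds (0, 0)) ?F"
    using filterlim_compose[OF quad_deriv_tendsto[OF g] fst] filterlim_compose[OF quad_deriv_tendsto[OF g] snd]
    by (intro tendsto_Pair) (simp_all add: \<open>g 0 = 0\<close>)
  from landau_o.big.compose[OF conjunct2[OF f[unfolded quad_deriv_def]] this]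
  have "(\<lambda>x. f (g (fst x)) - f (g (snd x)) - A * (g (fst x) - g (snd x))) \<in>
     O[?F](\<lambda>x. (norm (g (fst x)) + norm (g (snd x))) * norm (g (fst x) - g (snd x)))" by simp
  also have "(\<lambda>x. (norm (g (fst x)) + norm (g (snd x))) * norm (g (fst x) - g (snd x))) \<in> O[?F](\<lambda>x. ?S x * ?D x)"
  proof (intro landau_o.big.mult sum_in_bigo)
    show "(\<lambda>x. norm (g (fst x))) \<in> O[?F](?S)" "(\<lambda>x. norm (g (snd x))) \<in> O[?F](?S)"
      using landau_o.big_trans[OF landau_o.big.compose[OF quad_deriv_diff_0[OF g] fst] S(1)]
        landau_o.big_trans[OF landau_o.big.compose[OF quad_deriv_diff_0[OF g] snd] S(2)]
      by (simp_all add: \<open>g 0 = 0\<close>)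
    show "(\<lambda>x. norm (g (fst x) - g (snd x))) \<in> O[?F](?D)"
      using quad_deriv_lipschitz[OF g] by (simp add:)
  qed
  finally have "(\<lambda>x. f (g (fst x)) - f (g (snd x)) - A * (g (fst x) - g (snd x))) \<in> O[?F](\<lambda>x. ?S x * ?D x)" .
  moreover have "(\<lambda>x. A * (g (fst x) - g (snd x) - l (fst x - snd x))) \<in> O[?F](\<lambda>x. ?S x * ?D x)"
    using g by (simp add: quad_deriv_def)
  ultimately have "(\<lambda>x. (f (g (fst x)) - f (g (snd x)) - A * (g (fst x) - g (snd x))) +
    A * (g (fst x) - g (snd x) - l (fst x - snd x))) \<in> O[?F](\<lambda>x. ?S x * ?D x)"
    by (rule sum_in_bigo(1))
  then show ?thesis using g
    by (simp add: quad_deriv_def algebra_simps bounded_linear_const_mult)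
qed

text \<open>By the mean value theorem the remainder is (u - v)(f' z - f' 0) with z between u and v,
  and the second derivative at 0 bounds f' z - f' 0 by a multiple of |z|.\<close>

lemma quad_deriv_DERIV:
  fixes f f' :: "real \<Rightarrow> real"
  assumes ev: "\<forall>\<^sub>F x in nhds 0. (f has_real_derivative f' x) (at x)"
    and f'': "(f' has_real_derivative D) (at 0)"
  shows "quad_deriv f (\<lambda>h. f' 0 * h)"
proof -
  have "\<forall>\<^sub>F x in at 0. dist ((f' x - f' 0) / (x - 0)) D < 1"
    using f''[unfolded has_field_derivative_iff] by (rule tendstoD) simp
  then have "\<forall>\<^sub>F x in at 0. \<bar>f' x - f' 0\<bar> \<le> (\<bar>D\<bar> + 1) * \<bar>x\<bar>"
  proof eventually_elim
    case (elim x)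
    then have "\<bar>(f' x - f' 0) / x\<bar> \<le> \<bar>D\<bar> + 1" by (auto simp: dist_real_def)
    then show ?case by (cases "x = 0") (auto simp: abs_divide field_simps)
  qed
  then have "\<forall>\<^sub>F x in nhds 0. \<bar>f' x - f' 0\<bar> \<le> (\<bar>D\<bar> + 1) * \<bar>x\<bar>"
    by (simp add: eventually_nhds_conv_at)
  with ev have "\<forall>\<^sub>F x in nhds 0. (f has_real_derivative f' x) (at x) \<and> \<bar>f' x - f' 0\<bar> \<le> (\<bar>D\<bar> + 1) * \<bar>x\<bar>"
    by (rule eventually_conj)
  then obtain d where d: "0 < d" "\<And>x. \<bar>x\<bar> < d \<Longrightarrow> (f has_real_derivative f' x) (at x)"
    "\<And>x. \<bar>x\<bar> < d \<Longrightarrow> \<bar>f' x - f' 0\<bar> \<le> (\<bar>D\<bar> + 1) * \<bar>x\<bar>"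
    unfolding eventually_nhds_metric by (auto simp: dist_real_def)
  have ord: "\<bar>f u - f v - f' 0 * (u - v)\<bar> \<le> (\<bar>D\<bar> + 1) * ((\<bar>u\<bar> + \<bar>v\<bar>) * \<bar>u - v\<bar>)"
    if uv: "\<bar>u\<bar> < d" "\<bar>v\<bar> < d" "v < u" for u v
  proof -
    obtain z where z: "v < z" "z < u" "f u - f v = (u - v) * f' z"
      using MVT2[of v u f f'] uv d(2) by auto
    have "f u - f v - f' 0 * (u - v) = (u - v) * (f' z - f' 0)" using z by (simp add: algebra_simps)
    also have "\<bar>\<dots>\<bar> \<le> \<bar>u - v\<bar> * ((\<bar>D\<bar> + 1) * \<bar>z\<bar>)"
      unfolding abs_mult using uv z by (intro mult_left_mono d(3)) auto
    also have "\<dots> \<le> \<bar>u - v\<bar> * ((\<bar>D\<bar> + 1) * (\<bar>u\<bar> + \<bar>v\<bar>))"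
      using z by (intro mult_left_mono) auto
    finally show ?thesis by (simp add: mult_ac)
  qed
  have all: "\<bar>f u - f v - f' 0 * (u - v)\<bar> \<le> (\<bar>D\<bar> + 1) * ((\<bar>u\<bar> + \<bar>v\<bar>) * \<bar>u - v\<bar>)"
    if uv: "\<bar>u\<bar> < d" "\<bar>v\<bar> < d" for u v
  proof (rule linorder_cases[of u v])
    assume "u < v"
    moreover have "f u - f v - f' 0 * (u - v) = - (f v - f u - f' 0 * (v - u))" by (simp add: algebra_simps)
    ultimately show ?thesis
      using ord[OF uv(2,1)] by (simp only: abs_minus_cancel abs_minus_commute[of u v] add.commute[of "\<bar>u\<bar>"])
  qed (use ord uv in auto)
  have "\<forall>\<^sub>F x::real in nhds 0. \<bar>x\<bar> < d"
    using d(1) eventually_nhds_metric[of "\<lambda>x::real. \<bar>x\<bar> < d" 0] by auto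
  then have "\<forall>\<^sub>F x in nhds 0 \<times>\<^sub>F nhds 0. \<bar>fst x\<bar> < d \<and> \<bar>snd x\<bar> < d"
    unfolding eventually_prod_filter by fastforce
  then have "\<forall>\<^sub>F x in nhds (0, 0). \<bar>fst x\<bar> < d \<and> \<bar>snd x\<bar> < d" by (simp add: nhds_prod)
  then have "(\<lambda>x. f (fst x) - f (snd x) - f' 0 * (fst x - snd x)) \<in> pair_order"
    by (intro bigoI[of _ "\<bar>D\<bar> + 1"]) (auto elim!: eventually_mono intro!: all)
  then show ?thesis by (simp add: quad_deriv_def bounded_linear_mult_right)
qed

lemma quad_deriv_powr:
  assumes "0 < x0" shows "quad_deriv (\<lambda>h. (x0 + h) powr e) (\<lambda>h. e * x0 powr (e - 1) * h)"
proof -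
  have "\<forall>\<^sub>F h in nhds 0. \<bar>h\<bar> < x0"
    using assms eventually_nhds_metric[of "\<lambda>h. \<bar>h\<bar> < x0" 0] by auto
  then have "\<forall>\<^sub>F h in nhds 0. ((\<lambda>h. (x0 + h) powr e) has_real_derivative e * (x0 + h) powr (e - 1)) (at h)"
    by eventually_elim (auto intro!: derivative_eq_intros)
  moreover have "((\<lambda>h. e * (x0 + h) powr (e - 1)) has_real_derivative e * ((e - 1) * x0 powr (e - 2))) (at 0)"
    using assms by (auto intro!: derivative_eq_intros)
  ultimately have "quad_deriv (\<lambda>h. (x0 + h) powr e) (\<lambda>h. e * (x0 + 0) powr (e - 1) * h)"
    by (rule quad_deriv_DERIV)
  then show ?thesis by simp
qed

lemma powr_quad_deriv:
  assumes g: "quad_deriv g l" and "0 < g 0"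
  shows "quad_deriv (\<lambda>u. g u powr e) (\<lambda>u. e * g 0 powr (e - 1) * l u)"
proof -
  have "quad_deriv (\<lambda>u. g u + - g 0) (\<lambda>u. l u + 0)" by (intro quad_deriv_add g quad_deriv_const)
  then have "quad_deriv (\<lambda>u. (g 0 + (g u + - g 0)) powr e) (\<lambda>u. e * g 0 powr (e - 1) * (l u + 0))"
    by (rule quad_deriv_comp[OF quad_deriv_powr[OF \<open>0 < g 0\<close>]]) simp
  then show ?thesis by simp
qed

lemma powr_poly_approx:
  assumes g: "poly_approx g" "quad_deriv g l" and "0 < g 0"
  shows "poly_approx (\<lambda>u. g u powr e)"
proof -
  have "poly_approx (\<lambda>u. (g 0 + (g u + - g 0)) powr e)"
  proof (rule poly_approx_comp[OF poly_approx_powr[OF \<open>0 < g 0\<close>]])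
    show "poly_approx (\<lambda>u. g u + - g 0)" by (intro poly_approx_add g poly_approx_const)
    show "(\<lambda>u. g u + - g 0) \<in> O[nhds 0](\<lambda>u. norm u)" using quad_deriv_diff_0[OF g(2)] by simp
    show "((\<lambda>u. g u + - g 0) \<longlongrightarrow> 0) (nhds 0)"
      using quad_deriv_tendsto[OF g(2)] by (auto intro!: tendsto_eq_intros)
  qed
  then show ?thesis by simp
qed

text \<open>An approximating polynomial and the affine map g 0 + l both agree with g up to second
  order. Hence the affine part of the polynomial is g 0 + l, and what remains of it is
  \<open>Q\<close>.\<close>

lemma quad_remainder_poly:
  assumes g: "poly_approx g" "quad_deriv g l" and "2 \<le> m"
  obtains Q where "poly_order 2 Q" "(\<lambda>u. g u - g 0 - l u - Q u) \<in> norm_order m"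
proof -
  obtain P where P: "poly_order 0 P" "(\<lambda>u. g u - P u) \<in> norm_order m"
    using g(1) unfolding poly_approx_def by blast
  obtain c k Q where Q: "bounded_linear k" "poly_order 2 Q" "\<And>u. P u = c + k u + Q u"
    using poly_order_decompose[OF P(1)] by (rule affine_plus_quadraticE) blast
  have l: "bounded_linear l" using g(2) by (simp add: quad_deriv_def)
  have "filterlim (\<lambda>u::'a. (u, 0::'a)) (nhds (0, 0)) (nhds 0)" by (intro tendsto_Pair tendsto_const filterlim_ident)
  from landau_o.big.compose[OF conjunct2[OF g(2)[unfolded quad_deriv_def]] this]
  have "(\<lambda>u. g u - g 0 - l u) \<in> norm_order 2" by (simp add: power2_eq_square)
  moreover have "(\<lambda>u. g u - P u) \<in> norm_order 2"
    using P(2) norm_power_bigo_weaken[OF \<open>2 \<le> m\<close>] by (rule landau_o.big_trans)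
  ultimately have "(\<lambda>u. (g u - P u) - (g u - g 0 - l u) + Q u) \<in> norm_order 2"
    by (intro sum_in_bigo(1)[OF sum_in_bigo(2)] poly_order_bigo[OF Q(2)])
  then have "(\<lambda>u. (g 0 - c) + (l u - k u)) \<in> norm_order 2"
    by (simp add: Q(3) algebra_simps)
  then obtain C where "\<forall>\<^sub>F u in nhds 0. norm ((g 0 - c) + (l u - k u)) \<le> C * norm (norm u ^ 2)"
    by (rule landau_o.bigE)
  then obtain d where d: "0 < d" "\<And>u. norm u < d \<Longrightarrow> \<bar>(g 0 - c) + (l u - k u)\<bar> \<le> C * norm u ^ 2"
    unfolding eventually_nhds_metric by auto
  have c: "c = g 0"
    using d(2)[of 0] d(1) linear_0[OF bounded_linear.linear[OF l]] linear_0[OF bounded_linear.linear[OF Q(1)]] by simp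
  \<comment> \<open>Linear functionals differing by O(|u|^2) are equal: along t u the difference is
    linear in t and the bound quadratic.\<close>
  have "l u = k u" for u
  proof (rule ccontr)
    assume ne: "l u \<noteq> k u"
    have lim: "((\<lambda>t. C * (norm u)\<^sup>2 * t) \<longlongrightarrow> C * (norm u)\<^sup>2 * 0) (at_right 0)"
      "((\<lambda>t. t * norm u) \<longlongrightarrow> 0 * norm u) (at_right 0)"
      by (intro tendsto_intros)+
    have "\<forall>\<^sub>F t in at_right 0. C * (norm u)\<^sup>2 * t < \<bar>l u - k u\<bar>"
      using order_tendstoD(2)[OF lim(1), of "\<bar>l u - k u\<bar>"] ne by simp
    moreover have "\<forall>\<^sub>F t in at_right 0. t * norm u < d"
      using order_tendstoD(2)[OF lim(2), of d] d(1) by simp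
    moreover have "\<forall>\<^sub>F t in at_right 0. (0::real) < t" by (simp add: eventually_at_right_less)
    ultimately have "\<forall>\<^sub>F t in at_right (0::real). False"
    proof eventually_elim
      case (elim t)
      have "\<bar>l (t *\<^sub>R u) - k (t *\<^sub>R u)\<bar> \<le> C * norm (t *\<^sub>R u) ^ 2"
        using d(2)[of "t *\<^sub>R u"] elim c by simp
      then have "t * \<bar>l u - k u\<bar> \<le> t * (C * (norm u)\<^sup>2 * t)"
        using elim by (simp add: linear_cmul[OF bounded_linear.linear] l Q(1)
          right_diff_distrib[symmetric] abs_mult power2_eq_square mult_ac)
      then show ?case using elim by simp
    qed
    then show False by simp
  qed
  then have "(\<lambda>u. g u - g 0 - l u - Q u) \<in> norm_order m"
    using P(2) by (simp add: Q(3) c algebra_simps)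
  with Q(2) show ?thesis by (rule that)
qed

section \<open>Expansion and injectivity of the family of stable solutions\<close>

lemma ebound_norm:
  assumes "\<And>k. ebound \<rho> (\<lambda>x. v x $ k)" shows "ebound \<rho> (\<lambda>x. norm (v x :: real^'k))"
proof (rule ebound_le[where C = 1])
  show "ebound \<rho> (\<lambda>x. \<Sum>k\<in>UNIV. \<bar>v x $ k\<bar>)" by (intro ebound_sum ebound_abs assms)
  show "\<forall>\<^sub>F x in at_top. \<bar>norm (v x)\<bar> \<le> 1 * \<bar>\<Sum>k\<in>UNIV. \<bar>v x $ k\<bar>\<bar>"
    using norm_le_l1_cart by (intro always_eventually allI) (simp add: abs_of_nonneg sum_nonneg)
qed

lemma ebound_imp_tendsto_0:
  assumes "ebound \<rho> g" "\<rho> < 0" shows "(g \<longlongrightarrow> 0) at_top"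
  using ebound_tendsto_0[OF assms] by simp

lemma exp_bound_imp_ebound:
  assumes "\<And>x. T \<le> x \<Longrightarrow> \<bar>g x\<bar> \<le> D * exp (\<rho> * x)" shows "ebound \<rho> g"
  by (rule bigo_exp_imp_ebound, rule bigoI[of _ D])
    (use assms in \<open>auto intro!: eventually_mono[OF eventually_ge_at_top[of T]]\<close>)

context stable_system
begin

text \<open>Gronwall's inequality backwards in time. The sum g of the squared differences satisfies
  g' \<ge> -L g, so g exp(L x) is nondecreasing and a zero of g propagates to the left.\<close>

lemma solution_backward_unique:
  assumes sol: "solution T y z" "solution T y' z'" and "T \<le> T1"
    and eq: "\<And>x. T1 \<le> x \<Longrightarrow> y x = y' x"
  shows "y T = y' T"
proof -
  \<comment> \<open>A point inside the interval of coincidence, so that the derivatives of y and y'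
    agree there too and determine z.\<close>
  define T2 where "T2 = T1 + 1"
  have T2: "T < T2" using \<open>T \<le> T1\<close> by (simp add: T2_def)
  have dy: "((\<lambda>x. y x $ k) has_real_derivative nu k * y x $ k + z x $ k) (at x)"
    "((\<lambda>x. y' x $ k) has_real_derivative nu k * y' x $ k + z' x $ k) (at x)" if "T < x" for x k
    using sol that by (auto simp: solution_def)
  have dz: "((\<lambda>x. z x $ k) has_real_derivative om k * z x $ k + R (y x) $ k) (at x)"
    "((\<lambda>x. z' x $ k) has_real_derivative om k * z' x $ k + R (y' x) $ k) (at x)" if "T < x" for x k
    using sol that by (auto simp: solution_def)
  have "z T2 $ k = z' T2 $ k" for k
  proof -
    have "((\<lambda>x. y' x $ k) has_real_derivative nu k * y T2 $ k + z T2 $ k) (at T2)"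
    proof (rule DERIV_cong_ev[THEN iffD1, rotated -1])
      show "((\<lambda>x. y x $ k) has_real_derivative nu k * y T2 $ k + z T2 $ k) (at T2)" by (rule dy[OF T2])
      have "\<forall>\<^sub>F x in nhds T2. T1 < x" by (rule eventually_nhds_in_open[of "{T1<..}", simplified]) (simp add: T2_def)
      then show "\<forall>\<^sub>F x in nhds T2. y x $ k = y' x $ k" by eventually_elim (simp add: eq)
    qed auto
    from DERIV_unique[OF this dy(2)[OF T2]] show ?thesis using eq[of T2] by (simp add: T2_def)
  qed
  then have zeq: "z T2 = z' T2" by (simp add: vec_eq_iff)
  define a b c where abc: "a k x = y x $ k - y' x $ k" "b k x = z x $ k - z' x $ k"
    "c k x = R (y x) $ k - R (y' x) $ k" for k x
  define g where "g x = (\<Sum>k\<in>UNIV. (a k x)\<^sup>2 + (b k x)\<^sup>2)" for x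
  define g' where "g' x = (\<Sum>k\<in>UNIV. 2 * a k x * (nu k * a k x + b k x) +
      2 * b k x * (om k * b k x + c k x))" for x
  define K where "K = (\<Sum>k\<in>UNIV. \<bar>nu k\<bar>)"
  define M where "M = (2 * C * r)\<^sup>2"
  \<comment> \<open>K absorbs the linear terms in y, the 2 the mixed products, and M the Lipschitz
    constant of R; the terms with om have the favourable sign.\<close>
  define L where "L = 2 * K + 2 + M"
  have K: "\<bar>nu k\<bar> \<le> K" for k unfolding K_def by (rule member_le_sum) auto
  have dg: "(g has_real_derivative g' x) (at x)" if "T < x" for x
    unfolding g_def g'_def abc
    by (rule derivative_eq_intros dy[OF that] dz[OF that] refl | simp add: algebra_simps)+
  have g'_ge: "- L * g x \<le> g' x" if "T < x" for x
  proof -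
    have R2: "(\<Sum>k\<in>UNIV. (c k x)\<^sup>2) \<le> M * (\<Sum>k\<in>UNIV. (a k x)\<^sup>2)"
    proof -
      have ss: "(norm v)\<^sup>2 = (\<Sum>k\<in>UNIV. (v $ k)\<^sup>2)" for v :: "real^'k"
        by (simp add: norm_vec_def L2_set_def sum_nonneg)
      have "norm (R (y x) - R (y' x)) \<le> 2 * C * r * norm (y x - y' x)"
        using sol that by (intro R_lipschitz) (auto simp: solution_def)
      then have "(norm (R (y x) - R (y' x)))\<^sup>2 \<le> (2 * C * r * norm (y x - y' x))\<^sup>2"
        by (intro power_mono) auto
      then show ?thesis by (simp add: power_mult_distrib ss M_def abc)
    qed
    have "- L * g x \<le> - (2 * K + 1) * (\<Sum>k\<in>UNIV. (a k x)\<^sup>2) - 2 * (\<Sum>k\<in>UNIV. (b k x)\<^sup>2)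
        - M * (\<Sum>k\<in>UNIV. (a k x)\<^sup>2)"
    proof -
      have "0 \<le> (2 * K + M) * (\<Sum>k\<in>UNIV. (b k x)\<^sup>2)" "0 \<le> (\<Sum>k\<in>UNIV. (a k x)\<^sup>2)"
        unfolding K_def M_def by (intro mult_nonneg_nonneg sum_nonneg add_nonneg_nonneg; simp)+
      then show ?thesis unfolding g_def L_def sum.distrib by (simp add: algebra_simps)
    qed
    also have "\<dots> \<le> - (2 * K + 1) * (\<Sum>k\<in>UNIV. (a k x)\<^sup>2) - 2 * (\<Sum>k\<in>UNIV. (b k x)\<^sup>2)
        - (\<Sum>k\<in>UNIV. (c k x)\<^sup>2)"
      using R2 by simp
    also have "\<dots> = (\<Sum>k\<in>UNIV. - (2 * K + 1) * (a k x)\<^sup>2 - 2 * (b k x)\<^sup>2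
       - (c k x)\<^sup>2)"
      by (simp add: sum_subtractf sum_distrib_left)
    also have "\<dots> \<le> g' x"
      unfolding g'_def
    proof (rule sum_mono)
      fix k
      have 1: "- (2 * K * (a k x)\<^sup>2) \<le> 2 * nu k * (a k x)\<^sup>2"
      proof -
        have "- K * (a k x)\<^sup>2 \<le> nu k * (a k x)\<^sup>2" using K[of k] by (intro mult_right_mono) auto
        then show ?thesis by simp
      qed
      have 2: "0 \<le> 2 * om k * (b k x)\<^sup>2" using om_nonneg by simp
      have 3: "0 \<le> (a k x + b k x)\<^sup>2" "0 \<le> (b k x + c k x)\<^sup>2" by simp_all
      show "- (2 * K + 1) * (a k x)\<^sup>2 - 2 * (b k x)\<^sup>2 - (c k x)\<^sup>2 \<le>
        2 * a k x * (nu k * a k x + b k x) + 2 * b k x * (om k * b k x + c k x)"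
        using 1 2 3 by (simp add: power2_eq_square algebra_simps)
    qed
    finally show ?thesis .
  qed
  have "g T * exp (L * T) \<le> g T2 * exp (L * T2)"
  proof (rule DERIV_nonneg_imp_increasing_open[where f = "\<lambda>x. g x * exp (L * x)"])
    show "T \<le> T2" using T2 by simp
    show "\<exists>d. ((\<lambda>x. g x * exp (L * x)) has_real_derivative d) (at x) \<and> 0 \<le> d" if "T < x" "x < T2" for x
    proof (intro exI conjI)
      show "((\<lambda>x. g x * exp (L * x)) has_real_derivative (g' x + L * g x) * exp (L * x)) (at x)"
        by (rule derivative_eq_intros dg[OF that(1)] refl | simp add: algebra_simps)+
      show "0 \<le> (g' x + L * g x) * exp (L * x)" using g'_ge[OF that(1)] by simp
    qed
    have "continuous_on {T..T2} y" "continuous_on {T..T2} y'" "continuous_on {T..T2} z" "continuous_on {T..T2} z'"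
      using sol by (auto simp: solution_def intro: continuous_on_subset)
    then show "continuous_on {T..T2} (\<lambda>x. g x * exp (L * x))"
      unfolding g_def abc by (intro continuous_intros)
  qed
  also have "g T2 = 0" using zeq eq[of T2] by (simp add: g_def abc T2_def)
  finally have "g T \<le> 0" by (simp add: mult_le_0_iff)
  moreover have "g T \<ge> 0" unfolding g_def by (intro sum_nonneg) auto
  ultimately have "g T = 0" by simp
  then have "(y T $ k - y' T $ k)\<^sup>2 + (z T $ k - z' T $ k)\<^sup>2 = 0" for k
    unfolding g_def abc by (subst (asm) sum_nonneg_eq_0_iff) auto
  then show ?thesis by (simp add: vec_eq_iff sum_power2_eq_zero_iff)
qed

end

locale expandable_system = stable_system nu om R \<eta> r C
  for nu om :: "'k::finite \<Rightarrow> real" and R \<eta> r C +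
  assumes R_expand: "\<And>m k. \<exists>Q. poly_order 2 Q \<and> (\<lambda>u. R u $ k - Q u) \<in> norm_order m"
begin

text \<open>Bootstrap: if \<open>yE\<close> approximates y with rate -(n+1)\<eta>, the quadratic
  Lipschitz bound makes R(yE) one factor exp(-\<eta> x) closer to R(y). R(yE) is replaced by a
  Taylor polynomial and the two first-order equations are integrated again. The condition on \<tau>
  leaves no exponent in (-2\<eta>, -\<tau>], so each mode is either visible at rate \<tau> or
  allowed in \<open>E\<close>.\<close>

lemma solution_expansion:
  assumes tau: "\<eta> < \<tau>" "\<tau> < 2 * \<eta>" "\<And>k. - \<tau> < nu k \<or> nu k \<le> - 2 * \<eta>"
    and sol: "solution T y z"
    and y_bd: "\<And>x. T \<le> x \<Longrightarrow> norm (y x) \<le> B * exp (- \<eta> * x)"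
    and z_bd: "\<And>k. ebound (- \<tau>) (\<lambda>x. z x $ k)"
    and lead: "\<And>k. ebound (- \<tau>) (\<lambda>x. y x $ k - b k * exp (nu k * x))"
  shows "\<exists>E. \<forall>k. exp_poly (- 2 * \<eta>) (E k) \<and>
    ebound (- (real n + 1) * \<eta>) (\<lambda>x. y x $ k - b k * exp (nu k * x) - E k x)"
proof (induction n)
  case 0
  have "ebound (- \<eta>) (\<lambda>x. y x $ k - b k * exp (nu k * x) - 0)" for k
    using ebound_mono[OF _ lead[of k], of "- \<eta>"] tau by simp
  then show ?case by (intro exI[of _ "\<lambda>_ _. 0"]) (simp add: exp_poly_zero)
next
  case (Suc n)
  then obtain E where E: "\<And>k. exp_poly (- 2 * \<eta>) (E k)"
    "\<And>k. ebound (- (real n + 1) * \<eta>) (\<lambda>x. y x $ k - b k * exp (nu k * x) - E k x)" by blast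
  define \<rho> where "\<rho> = - (real (Suc n) + 1) * \<eta>"
  have rho: "\<rho> \<le> - 2 * \<eta>"
  proof -
    have "0 \<le> real n * \<eta>" using eta_pos by simp
    then show ?thesis by (simp add: \<rho>_def algebra_simps)
  qed
  define yE where "yE x = (\<chi> k. b k * exp (nu k * x) + E k x)" for x
  have yE: "exp_poly (- \<eta>) (\<lambda>x. yE x $ k)" for k
    unfolding yE_def using nu_le[of k] exp_poly_mono[OF E(1)[of k], of "- \<eta>"] eta_pos
    by (auto intro!: exp_poly.add exp_poly_exp)
  have yE_norm: "ebound (- \<eta>) (\<lambda>x. norm (yE x))" by (intro ebound_norm exp_poly_ebound yE)
  have y_norm: "ebound (- \<eta>) (\<lambda>x. norm (y x))"
    using y_bd by (intro exp_bound_imp_ebound[where D = B and T = T]) simp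
  have diff: "ebound (- (real n + 1) * \<eta>) (\<lambda>x. norm (y x - yE x))"
    using E(2) by (intro ebound_norm) (simp add: yE_def diff_diff_eq)
  have yE_small: "\<forall>\<^sub>F x in at_top. norm (yE x) < r"
    using order_tendstoD(2)[OF ebound_imp_tendsto_0[OF yE_norm] r_pos] eta_pos by simp
  have R1: "ebound \<rho> (\<lambda>x. R (y x) $ k - R (yE x) $ k)" for k
  proof (rule ebound_le[where C = C])
    have "ebound (- \<eta> + - (real n + 1) * \<eta>) (\<lambda>x. (norm (y x) + norm (yE x)) * norm (y x - yE x))"
      by (intro ebound_mult ebound_add y_norm yE_norm diff)
    moreover have "- \<eta> + - (real n + 1) * \<eta> = \<rho>" by (simp add: \<rho>_def algebra_simps)
    ultimately show "ebound \<rho> (\<lambda>x. (norm (y x) + norm (yE x)) * norm (y x - yE x))" by simp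
    show "\<forall>\<^sub>F x in at_top. \<bar>R (y x) $ k - R (yE x) $ k\<bar> \<le> C * \<bar>(norm (y x) + norm (yE x)) * norm (y x - yE x)\<bar>"
      using yE_small eventually_ge_at_top[of T]
    proof eventually_elim
      case (elim x)
      have "\<bar>R (y x) $ k - R (yE x) $ k\<bar> \<le> norm (R (y x) - R (yE x))"
        using component_le_norm_cart[of "R (y x) - R (yE x)" k] by simp
      also have "\<dots> \<le> C * (norm (y x) + norm (yE x)) * norm (y x - yE x)"
        using elim sol by (intro R_lip) (auto simp: solution_def)
      finally show ?case by (simp add: abs_mult mult.assoc)
    qed
  qed
  have step: "\<exists>E'. exp_poly (- 2 * \<eta>) E' \<and> ebound \<rho> (\<lambda>x. y x $ k - b k * exp (nu k * x) - E' x)" for k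
  proof -
    \<comment> \<open>Order n + 2 makes the Taylor error exactly as small as the target rate
      \<open>\<rho>\<close>.\<close>
    obtain Q where Q: "poly_order 2 Q" "(\<lambda>u. R u $ k - Q u) \<in> norm_order (n + 2)"
      using R_expand by blast
    have "(yE \<longlongrightarrow> 0) at_top"
      using ebound_imp_tendsto_0[OF yE_norm] eta_pos by (simp add: tendsto_norm_zero_iff)
    from landau_o.big.compose[OF Q(2) this]
    have "(\<lambda>x. R (yE x) $ k - Q (yE x)) \<in> O(\<lambda>x. norm (yE x) ^ (n + 2))" .
    then obtain D where "\<forall>\<^sub>F x in at_top. norm (R (yE x) $ k - Q (yE x)) \<le> D * norm (norm (yE x) ^ (n + 2))"
      by (rule landau_o.bigE)
    then have "ebound (real (n + 2) * (- \<eta>)) (\<lambda>x. R (yE x) $ k - Q (yE x))"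
      by (intro ebound_le[OF ebound_power[OF yE_norm, of "n + 2"], of _ D]) simp
    then have "ebound \<rho> (\<lambda>x. R (yE x) $ k - Q (yE x))" by (simp add: \<rho>_def algebra_simps)
    from ebound_add[OF R1[of k] this] have RQ: "ebound \<rho> (\<lambda>x. R (y x) $ k - Q (yE x))" by simp
    have QE: "exp_poly (- 2 * \<eta>) (\<lambda>x. Q (yE x))"
      using poly_order_exp_poly[OF Q(1) yE] eta_pos by simp
    have dz: "((\<lambda>x. z x $ k) has_real_derivative om k * z x $ k + R (y x) $ k) (at x)" if "T < x" for x
      using sol that by (auto simp: solution_def)
    have dy: "((\<lambda>x. y x $ k) has_real_derivative nu k * y x $ k + z x $ k) (at x)" if "T < x" for x
      using sol that by (auto simp: solution_def)
    obtain A G where G: "exp_poly (- 2 * \<eta>) G" "ebound \<rho> (\<lambda>x. z x $ k - A * exp (om k * x) - G x)"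
      using first_order_expansion[OF dz QE RQ] by blast
    have G': "ebound (- \<eta>) G" using exp_poly_ebound[OF G(1)] eta_pos by (elim ebound_mono[rotated]) simp
    \<comment> \<open>All other terms decay, whereas exp(om k x) does not since om k \<ge> 0; hence
      \<open>A\<close> vanishes.\<close>
    have "ebound (- \<eta>) (\<lambda>x. z x $ k - (z x $ k - A * exp (om k * x) - G x) - G x)"
      using tau rho eta_pos
      by (intro ebound_diff ebound_mono[OF _ z_bd] ebound_mono[OF _ G(2)] G') auto
    then have "ebound (- \<eta>) (\<lambda>x. A * exp (om k * x))" by simp
    then have "A = 0" by (rule ebound_exp_coeff_zero) (use om_nonneg[of k] eta_pos in linarith)
    with G(2) have "ebound \<rho> (\<lambda>x. z x $ k - G x)" by simp
    from first_order_expansion[OF dy G(1) this] obtain A' G2 where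
      G2: "exp_poly (- 2 * \<eta>) G2" "ebound \<rho> (\<lambda>x. y x $ k - A' * exp (nu k * x) - G2 x)" by blast
    consider "- \<tau> < nu k" | "nu k \<le> - 2 * \<eta>" using tau(3) by blast
    then show ?thesis
    proof cases
      \<comment> \<open>A visible mode: the known leading behaviour forces its coefficient to be b
        k.\<close>
      case 1
      have "ebound (- \<tau>) (\<lambda>x. (y x $ k - b k * exp (nu k * x)) - (y x $ k - A' * exp (nu k * x) - G2 x) - G2 x)"
        using tau rho
        by (intro ebound_diff[OF ebound_diff] ebound_mono[OF _ G2(2)] ebound_mono[OF _ exp_poly_ebound[OF G2(1)]] lead)
          auto
      then have "ebound (- \<tau>) (\<lambda>x. (A' - b k) * exp (nu k * x))" by (simp add: algebra_simps)
      then have "A' - b k = 0" by (rule ebound_exp_coeff_zero[OF _ 1])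
      then show ?thesis using G2 by auto
    next
      \<comment> \<open>A fast mode: whatever coefficient occurs, its excess over b k goes into the
        exponential polynomial.\<close>
      case 2
      have "exp_poly (- 2 * \<eta>) (\<lambda>x. (A' - b k) * exp (nu k * x) + G2 x)"
        by (intro exp_poly.add exp_poly_exp 2 G2)
      moreover have "ebound \<rho> (\<lambda>x. y x $ k - b k * exp (nu k * x) - ((A' - b k) * exp (nu k * x) + G2 x))"
        using G2(2) by (simp add: algebra_simps)
      ultimately show ?thesis by blast
    qed
  qed
  then show ?case unfolding \<rho>_def by (rule choice[OF allI])
qed

lemma solution_family:
  obtains T :: "real^'k \<Rightarrow> real" and Y Z :: "real^'k \<Rightarrow> real \<Rightarrow> real^'k"
  where "\<And>x. solution (T x) (Y x) (Z x)"
    and "\<And>x n. \<exists>E. \<forall>k. exp_poly (- 2 * \<eta>) (E k) \<and>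
      ebound (- (real n + 1) * \<eta>) (\<lambda>t. Y x t $ k - x $ k * exp (nu k * t) - E k t)"
    and "\<And>x x'. \<forall>\<^sub>F t in at_top. Y x t = Y x' t \<Longrightarrow> x = x'"
proof -
  \<comment> \<open>The smallest exponent above -2\<eta>. Inserting -\<eta> makes the set nonempty
    and guarantees \<tau> > \<eta> below.\<close>
  define m where "m = Min (insert (- \<eta>) {nu k | k. - 2 * \<eta> < nu k})"
  have fin: "finite (insert (- \<eta>) {nu k | k. - 2 * \<eta> < nu k})" by simp
  have m: "- 2 * \<eta> < m" using Min_in[OF fin] eta_pos unfolding m_def by auto
  have m2: "m \<le> - \<eta>" unfolding m_def by (rule Min_le[OF fin]) simp
  have m': "m \<le> nu k" if "- 2 * \<eta> < nu k" for k
    unfolding m_def by (rule Min_le[OF fin]) (use that in auto)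
  \<comment> \<open>-\<tau> is the midpoint of -2\<eta> and m, so no exponent lies in (-2\<eta>,
    -\<tau>].\<close>
  define \<tau> where "\<tau> = (2 * \<eta> - m) / 2"
  have tau: "\<eta> < \<tau>" "\<tau> < 2 * \<eta>" "- \<tau> < m" using m m2 eta_pos by (auto simp: \<tau>_def field_simps)
  have tau_nu: "- \<tau> < nu k \<or> nu k \<le> - 2 * \<eta>" for k using m'[of k] tau(3) by linarith
  have nonres: "nu k \<noteq> - \<tau>" for k using tau_nu[of k] tau by auto
  \<comment> \<open>\<open>arctan\<close> serves as a bounded injection of the reals, with values
    below 2 in modulus. The size bound \<open>B x\<close> thus depends on the slow coordinates
    alone.\<close>
  define b where "b x k = (if - \<tau> < nu k then x $ k else arctan (x $ k))" for x :: "real^'k" and k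
  define B where "B x = (\<Sum>k\<in>UNIV. if - \<tau> < nu k then \<bar>x $ k\<bar> else 2)" for x :: "real^'k"
  have B: "(\<Sum>k\<in>UNIV. \<bar>b x k\<bar>) \<le> B x" for x
    unfolding B_def
  proof (rule sum_mono)
    fix k
    have "\<bar>arctan (x $ k)\<bar> \<le> 2"
      using arctan_lbound[of "x $ k"] arctan_ubound[of "x $ k"] pi_less_4 by linarith
    then show "\<bar>b x k\<bar> \<le> (if - \<tau> < nu k then \<bar>x $ k\<bar> else 2)" by (simp add: b_def)
  qed
  define good where "good \<beta> T \<longleftrightarrow>
    (\<forall>b. (\<Sum>k\<in>UNIV. \<bar>b k\<bar>) \<le> \<beta> \<longrightarrow> (\<exists>y z. stable_solution \<tau> \<beta> T b y z))" for \<beta> T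
  have "\<exists>T. good \<beta> T" if "0 \<le> \<beta>" for \<beta>
    unfolding good_def by (rule exists_solution_family[OF tau(1,2) nonres that])
  \<comment> \<open>The starting time is selected as a function of the size bound, before x is
    given, so equal bounds mean equal starting times.\<close>
  then obtain T where T: "\<And>\<beta>. 0 \<le> \<beta> \<Longrightarrow> good \<beta> (T \<beta>)" by metis
  have "B x \<ge> 0" for x unfolding B_def by (intro sum_nonneg) auto
  then have "\<exists>y z. stable_solution \<tau> (B x) (T (B x)) (b x) y z" for x
    using T[of "B x", unfolded good_def, rule_format, OF _ B] by simp
  then obtain Y Z where YZ: "\<And>x. stable_solution \<tau> (B x) (T (B x)) (b x) (Y x) (Z x)" by metis
  have lead: "ebound (- \<tau>) (\<lambda>t. Y x t $ k - b x k * exp (nu k * t))"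
    and zb: "ebound (- \<tau>) (\<lambda>t. Z x t $ k)" for x k
  proof -
    obtain D where D: "\<And>t. T (B x) \<le> t \<Longrightarrow> \<bar>Z x t $ k\<bar> \<le> D * exp (- \<tau> * t)"
      "\<And>t. T (B x) \<le> t \<Longrightarrow> \<bar>Y x t $ k - b x k * exp (nu k * t)\<bar> \<le> D * exp (- \<tau> * t)"
      using YZ[of x] unfolding stable_solution_def by blast
    show "ebound (- \<tau>) (\<lambda>t. Y x t $ k - b x k * exp (nu k * t))" "ebound (- \<tau>) (\<lambda>t. Z x t $ k)"
      by (rule exp_bound_imp_ebound[OF D(2)], assumption) (rule exp_bound_imp_ebound[OF D(1)])
  qed
  have expansion: "\<exists>E. \<forall>k. exp_poly (- 2 * \<eta>) (E k) \<and>
      ebound (- (real n + 1) * \<eta>) (\<lambda>t. Y x t $ k - x $ k * exp (nu k * t) - E k t)" for x n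
  proof -
    have sol: "solution (T (B x)) (Y x) (Z x)"
      and bd: "\<And>t. T (B x) \<le> t \<Longrightarrow> norm (Y x t) \<le> (B x + 1) * exp (- \<eta> * t)"
      using YZ[of x] unfolding stable_solution_def by blast+
    obtain E where E: "\<And>k. exp_poly (- 2 * \<eta>) (E k)"
      "\<And>k. ebound (- (real n + 1) * \<eta>) (\<lambda>t. Y x t $ k - b x k * exp (nu k * t) - E k t)"
      using solution_expansion[OF tau(1,2) tau_nu sol bd zb lead, of n] by blast
    \<comment> \<open>Returning from b x k to x $ k changes only fast modes, which the exponential
      polynomial may absorb.\<close>
    have "exp_poly (- 2 * \<eta>) (\<lambda>t. (b x k - x $ k) * exp (nu k * t) + E k t)" for k
    proof (cases "- \<tau> < nu k")
      case True
      then show ?thesis using E(1) by (simp add: b_def)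
    next
      case False
      then show ?thesis using tau_nu[of k] by (intro exp_poly.add exp_poly_exp E(1)) auto
    qed
    moreover have "ebound (- (real n + 1) * \<eta>) (\<lambda>t. Y x t $ k - x $ k * exp (nu k * t) -
        ((b x k - x $ k) * exp (nu k * t) + E k t))" for k
      using E(2)[of k] by (simp add: algebra_simps)
    ultimately show ?thesis
      by (intro exI[of _ "\<lambda>k t. (b x k - x $ k) * exp (nu k * t) + E k t"] allI conjI)
  qed
  have "x = x'" if ev: "\<forall>\<^sub>F t in at_top. Y x t = Y x' t" for x x'
  proof -
    have plus: "x $ k = x' $ k" if k: "- \<tau> < nu k" for k
    proof -
      have "ebound (- \<tau>) (\<lambda>t. (Y x t $ k - b x k * exp (nu k * t)) - (Y x' t $ k - b x' k * exp (nu k * t)))"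
        by (intro ebound_diff[OF lead lead])
      then have "ebound (- \<tau>) (\<lambda>t. (x' $ k - x $ k) * exp (nu k * t))"
        by (rule ebound_le[where C = 1]) (use ev in eventually_elim, simp add: b_def k algebra_simps)
      then have "x' $ k - x $ k = 0" by (rule ebound_exp_coeff_zero[OF _ k])
      then show ?thesis by simp
    qed
    \<comment> \<open>The slow coordinates agree, hence so do the size bounds and the starting
      times.\<close>
    then have "B x = B x'" unfolding B_def by (intro sum.cong) auto
    define T0 where "T0 = T (B x)"
    have sol: "solution T0 (Y x) (Z x)" "solution T0 (Y x') (Z x')"
      using YZ[of x] YZ[of x'] \<open>B x = B x'\<close> by (auto simp: stable_solution_def T0_def)
    obtain T1 where T1: "\<And>t. T1 \<le> t \<Longrightarrow> Y x t = Y x' t"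
      using ev by (auto simp: eventually_at_top_linorder)
    have eq: "Y x T0 = Y x' T0"
      by (rule solution_backward_unique[OF sol, of "max T0 T1"]) (auto intro: T1)
    have "x $ k = x' $ k" if k: "\<not> - \<tau> < nu k" for k
    proof -
      have "nu k < - \<tau>" using k nonres[of k] by linarith
      then have "Y x T0 $ k = b x k * exp (nu k * T0)" "Y x' T0 $ k = b x' k * exp (nu k * T0)"
        using YZ[of x] YZ[of x'] \<open>B x = B x'\<close> by (auto simp: stable_solution_def T0_def)
      then have "b x k = b x' k" using eq by simp
      then show ?thesis using k by (simp add: b_def arctan_eq_iff)
    qed
    with plus show ?thesis by (auto simp: vec_eq_iff)
  qed
  moreover have "solution (T (B x)) (Y x) (Z x)" for x using YZ[of x] by (simp add: stable_solution_def)
  ultimately show ?thesis using expansion by (intro that) auto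
qed

end

section \<open>Diagonalization of self-adjoint operators\<close>

text \<open>Induction on the dimension: a maximizer of the Rayleigh quotient on the unit sphere of V
  is an eigenvector, and its orthogonal complement in V is again invariant by
  self-adjointness.\<close>

lemma self_adjoint_invariant_eigenbasis:
  fixes A :: "'a::euclidean_space \<Rightarrow> 'a"
  assumes A: "linear A" "\<And>u v. A u \<bullet> v = u \<bullet> A v" and V: "subspace V" "A ` V \<subseteq> V"
  shows "\<exists>B. B \<subseteq> V \<and> pairwise orthogonal B \<and> (\<forall>e\<in>B. norm e = 1 \<and> (\<exists>\<mu>. A e = \<mu> *\<^sub>R e)) \<and> V \<subseteq> span B"
  using V
proof (induction "dim V" arbitrary: V rule: less_induct)
  case less
  interpret A: linear A by (rule A(1))
  show ?case
  proof (cases "V \<subseteq> {0}")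
    case True
    then show ?thesis by (intro exI[of _ "{}"]) auto
  next
    case False
    then obtain v0 where v0: "v0 \<in> V" "v0 \<noteq> 0" by auto
    define K where "K = V \<inter> sphere 0 1"
    have "v0 /\<^sub>R norm v0 \<in> K" using v0 subspace_scale[OF less.prems(1)] by (auto simp: K_def)
    moreover have "compact K" unfolding K_def by (intro closed_Int_compact closed_subspace less.prems compact_sphere)
    moreover have "continuous_on K (\<lambda>v. v \<bullet> A v)"
      by (intro continuous_intros linear_continuous_on linear_conv_bounded_linear[THEN iffD1] A(1))
    ultimately obtain e where e: "e \<in> K" "\<And>v. v \<in> K \<Longrightarrow> v \<bullet> A v \<le> e \<bullet> A e"
      using continuous_attains_sup[of K "\<lambda>v. v \<bullet> A v"] by blast
    define \<mu> where "\<mu> = e \<bullet> A e"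
    have eV: "e \<in> V" and ee: "e \<bullet> e = 1" using e(1) by (auto simp: K_def norm_eq_1)
    have max: "v \<bullet> A v \<le> \<mu> * (v \<bullet> v)" if "v \<in> V" for v
    proof (cases "v = 0")
      case False
      then have "v /\<^sub>R norm v \<in> K" using that subspace_scale[OF less.prems(1)] by (auto simp: K_def)
      from e(2)[OF this] have "(v \<bullet> A v) / (norm v)\<^sup>2 \<le> \<mu>"
        by (simp add: \<mu>_def A.scaleR power2_eq_square divide_inverse mult_ac)
      then show ?thesis using False by (simp add: field_simps power2_norm_eq_inner)
    qed (simp add: A.zero)
    have Ae: "A e = \<mu> *\<^sub>R e"
    proof -
      \<comment> \<open>The residual is the test direction in which the quotient could be increased
        if it were nonzero.\<close>
      define v where "v = \<mu> *\<^sub>R e - A e"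
      have vV: "v \<in> V" unfolding v_def using eV less.prems
        by (intro subspace_diff subspace_scale) auto
      define q where "q = \<mu> * (v \<bullet> v) - v \<bullet> A v"
      define \<beta> where "\<beta> = v \<bullet> v"
      have "q \<ge> 0" using max[OF vV] by (simp add: q_def)
      have pos: "0 \<le> 2 * t * \<beta> + t\<^sup>2 * q" for t
      proof -
        have "0 \<le> \<mu> * ((e + t *\<^sub>R v) \<bullet> (e + t *\<^sub>R v)) - (e + t *\<^sub>R v) \<bullet> A (e + t *\<^sub>R v)"
          using max[of "e + t *\<^sub>R v"] eV vV less.prems(1) by (simp add: subspace_add subspace_scale)
        also have "\<dots> = (\<mu> - e \<bullet> A e) + 2 * t * (\<mu> * (e \<bullet> v) - A e \<bullet> v) + t\<^sup>2 * q"
        proof -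
          have "e \<bullet> A v = A e \<bullet> v" "v \<bullet> A e = A e \<bullet> v" "v \<bullet> e = e \<bullet> v"
            by (rule A(2)[symmetric] inner_commute)+
          then show ?thesis
            by (simp add: A.add A.scaleR q_def ee inner_add_left inner_add_right power2_eq_square
              algebra_simps)
        qed
        also have "\<mu> - e \<bullet> A e = 0" by (simp add: \<mu>_def)
        also have "\<mu> * (e \<bullet> v) - A e \<bullet> v = \<beta>" by (simp add: \<beta>_def v_def inner_diff_left)
        finally show ?thesis by simp
      qed
      have "\<beta> \<ge> 0" by (simp add: \<beta>_def)
      have "\<beta> = 0"
      proof (rule ccontr)
        assume "\<beta> \<noteq> 0"
        \<comment> \<open>At t = -s the quadratic in \<open>pos\<close> equals -s^2 (q + 2), hence
          is negative.\<close>
        define s where "s = \<beta> / (q + 1)"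
        have "\<beta> = s * (q + 1)" using \<open>q \<ge> 0\<close> by (simp add: s_def)
        then have "2 * (- s) * \<beta> + (- s)\<^sup>2 * q = - (s\<^sup>2 * (q + 2))"
          by (simp add: power2_eq_square algebra_simps)
        moreover have "0 < s\<^sup>2 * (q + 2)"
          using \<open>q \<ge> 0\<close> \<open>\<beta> \<noteq> 0\<close> by (simp add: s_def)
        ultimately show False using pos[of "- s"] by simp
      qed
      then show ?thesis by (simp add: \<beta>_def v_def)
    qed
    define V' where "V' = {v \<in> V. e \<bullet> v = 0}"
    have V': "subspace V'" using less.prems(1)
      by (auto simp: V'_def subspace_def inner_right_distrib)
    have AV': "A ` V' \<subseteq> V'"
      using less.prems(2) by (auto simp: V'_def A(2)[symmetric] Ae)
    have "V' \<subseteq> V" "e \<notin> V'" using ee by (auto simp: V'_def)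
    then have "V' \<subset> V" using eV by blast
    then have "dim V' < dim V"
      using dim_psubset[of V' V] V' less.prems(1) by (simp add: span_eq_iff[THEN iffD2])
    from less.hyps[OF this V' AV'] obtain B where B: "B \<subseteq> V'" "pairwise orthogonal B"
      "\<And>e. e \<in> B \<Longrightarrow> norm e = 1 \<and> (\<exists>\<mu>. A e = \<mu> *\<^sub>R e)" "V' \<subseteq> span B" by blast
    show ?thesis
    proof (intro exI[of _ "insert e B"] conjI)
      show "insert e B \<subseteq> V" using B(1) eV by (auto simp: V'_def)
      show "pairwise orthogonal (insert e B)"
        using B(1,2) by (auto simp: pairwise_insert V'_def orthogonal_def inner_commute)
      show "\<forall>e\<in>insert e B. norm e = 1 \<and> (\<exists>\<mu>. A e = \<mu> *\<^sub>R e)"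
        using B(3) Ae ee by (auto simp: norm_eq_1)
      show "V \<subseteq> span (insert e B)"
      proof
        fix v assume v: "v \<in> V"
        then have "v - (e \<bullet> v) *\<^sub>R e \<in> V'"
          using eV less.prems(1) by (simp add: V'_def subspace_diff subspace_scale inner_diff_right ee)
        then have "v - (e \<bullet> v) *\<^sub>R e \<in> span (insert e B)"
          using B(4) span_mono[of B "insert e B"] by blast
        moreover have "(e \<bullet> v) *\<^sub>R e \<in> span (insert e B)" by (intro span_scale span_base) auto
        ultimately have "v - (e \<bullet> v) *\<^sub>R e + (e \<bullet> v) *\<^sub>R e \<in> span (insert e B)" by (rule span_add)
        then show "v \<in> span (insert e B)" by simp
      qed
    qed
  qed
qed

lemma self_adjoint_orthonormal_eigenbasis:
  fixes A :: "'a::euclidean_space \<Rightarrow> 'a"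
  assumes "linear A" "\<And>u v. A u \<bullet> v = u \<bullet> A v" and card: "CARD('k::finite) = DIM('a)"
  obtains e :: "'k::finite \<Rightarrow> 'a" and \<mu> :: "'k \<Rightarrow> real"
  where "\<And>k. A (e k) = \<mu> k *\<^sub>R e k" "\<And>k l. e k \<bullet> e l = (if k = l then 1 else 0)"
    "\<And>u. u = (\<Sum>k\<in>UNIV. (e k \<bullet> u) *\<^sub>R e k)"
proof -
  obtain B where B: "pairwise orthogonal B" "\<And>e. e \<in> B \<Longrightarrow> norm e = 1"
    "\<And>e. e \<in> B \<Longrightarrow> \<exists>\<mu>. A e = \<mu> *\<^sub>R e" "UNIV \<subseteq> span B"
    using self_adjoint_invariant_eigenbasis[OF assms(1,2) subspace_UNIV] by auto
  have ind: "independent B" using B(2) by (intro pairwise_orthogonal_independent B(1)) force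
  have "finite B" using independent_imp_finite[OF ind] .
  have "card B = CARD('k)"
    using basis_card_eq_dim[OF subset_UNIV B(4) ind] card by simp
  then obtain e :: "'k \<Rightarrow> 'a" where e: "bij_betw e UNIV B"
    using finite_same_card_bij[of "UNIV :: 'k set" B] \<open>finite B\<close> by auto
  have eB: "e k \<in> B" for k using e by (auto simp: bij_betw_def)
  obtain \<mu> where mu: "\<And>k. A (e k) = \<mu> k *\<^sub>R e k" using B(3)[OF eB] by metis
  have orth: "e k \<bullet> e l = (if k = l then 1 else 0)" for k l
  proof (cases "k = l")
    case True then show ?thesis using B(2)[OF eB] by (simp add: norm_eq_1)
  next
    case False
    then have "e k \<noteq> e l" using e by (auto simp: bij_betw_def inj_on_def)
    then show ?thesis using B(1) eB False by (auto simp: pairwise_def orthogonal_def)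
  qed
  have "u = (\<Sum>k\<in>UNIV. (e k \<bullet> u) *\<^sub>R e k)" for u
  proof -
    define w where "w = u - (\<Sum>k\<in>UNIV. (e k \<bullet> u) *\<^sub>R e k)"
    have "e l \<bullet> w = 0" for l
      by (simp add: w_def inner_diff_right inner_sum_right orth if_distrib cong: if_cong)
    then have "orthogonal w b" if "b \<in> B" for b
      using that e by (auto simp: bij_betw_def orthogonal_def inner_commute)
    then have "orthogonal w w" using B(4) by (intro orthogonal_to_span[of w B]) auto
    then show ?thesis by (simp add: w_def orthogonal_def)
  qed
  with mu orth show ?thesis by (rule that)
qed

section \<open>Newtonian forces with a power law and their linearization\<close>

text \<open>The acceleration field: Newton's force on body i divided by its mass. At noncollision
  points it is the gradient of \<open>potential\<close> for \<open>mass_inner\<close>, see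
  \<open>potential_line_deriv\<close>.\<close>

definition force :: "('n::finite \<Rightarrow> real) \<Rightarrow> real \<Rightarrow> real^'d^'n \<Rightarrow> real^'d^'n" where
  "force lam p \<alpha> = (\<chi> i. - (\<Sum>j\<in>UNIV - {i}.
     (lam j * norm (\<alpha> $ i - \<alpha> $ j) powr - (p + 2)) *\<^sub>R (\<alpha> $ i - \<alpha> $ j)))"

text \<open>For z \<noteq> 0, the differential of the map taking z to |z|^(-e) z, in the direction
  w.\<close>

definition pair_deriv :: "real \<Rightarrow> real^'d \<Rightarrow> real^'d \<Rightarrow> real^'d" where
  "pair_deriv e z w = norm z powr - e *\<^sub>R w - (e * norm z powr - (e + 2) * (z \<bullet> w)) *\<^sub>R z"

definition force_deriv :: "('n::finite \<Rightarrow> real) \<Rightarrow> real \<Rightarrow> real^'d^'n \<Rightarrow> real^'d^'n \<Rightarrow> real^'d^'n" where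
  "force_deriv lam p a u = (\<chi> i. - (\<Sum>j\<in>UNIV - {i}.
     lam j *\<^sub>R pair_deriv (p + 2) (a $ i - a $ j) (u $ i - u $ j)))"

definition mass_inner :: "('n::finite \<Rightarrow> real) \<Rightarrow> real^'d^'n \<Rightarrow> real^'d^'n \<Rightarrow> real" where
  "mass_inner lam u v = (\<Sum>i\<in>UNIV. lam i * (u $ i \<bullet> v $ i))"

text \<open>Exhibits a power of the norm as a real power of a polynomial, which the rules for
  \<open>quad_deriv\<close> and \<open>poly_approx\<close> can handle.\<close>

lemma norm_powr_eq: "norm x powr e = (\<Sum>c\<in>UNIV. x $ c * x $ c) powr (e / 2)" for x :: "real^'d"
proof -
  have "(\<Sum>c\<in>UNIV. x $ c * x $ c) = x \<bullet> x" by (simp add: inner_vec_def)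
  also have "\<dots> = norm x powr 2" by (simp add: dot_square_norm)
  finally have "(\<Sum>c\<in>UNIV. x $ c * x $ c) powr (e / 2) = (norm x powr 2) powr (e / 2)" by simp
  then show ?thesis unfolding powr_powr by simp
qed

context
  fixes z :: "real^'d" and W :: "'a::real_normed_vector \<Rightarrow> real^'d" and e :: real
  assumes z: "z \<noteq> 0" and W: "bounded_linear W"
begin

private lemma lin: "bounded_linear (\<lambda>u. W u $ c)"
  by (rule bounded_linear_compose[OF bounded_linear_vec_nth W])

private lemma W0: "W 0 = 0"
  by (rule linear_0[OF bounded_linear.linear[OF W]])

private definition "N u = (\<Sum>c\<in>UNIV. (z $ c + W u $ c) * (z $ c + W u $ c))"

private lemma norm_powr_N: "norm (z + W u) powr - q = N u powr (- q / 2)"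
  by (subst norm_powr_eq) (simp add: N_def)

private lemma norm_square_quad_deriv: "quad_deriv N (\<lambda>u. 2 * (z \<bullet> W u))"
proof -
  have aff: "quad_deriv (\<lambda>u. z $ c + W u $ c) (\<lambda>u. 0 + W u $ c)" for c
    by (intro quad_deriv_add quad_deriv_const quad_deriv_linear lin)
  have "quad_deriv (\<lambda>u. \<Sum>c\<in>UNIV. (z $ c + W u $ c) * (z $ c + W u $ c))
    (\<lambda>u. \<Sum>c\<in>UNIV. (z $ c + W 0 $ c) * (0 + W u $ c) + (z $ c + W 0 $ c) * (0 + W u $ c))"
    by (intro quad_deriv_sum quad_deriv_mult aff)
  then show ?thesis by (simp add: N_def[abs_def] W0 inner_vec_def sum_distrib_left)
qed

private lemma norm_square_pos: "0 < N 0"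
proof -
  have "N 0 = z \<bullet> z" by (simp add: N_def W0 inner_vec_def)
  then show ?thesis using z by simp
qed

text \<open>The squared norm is polynomial in u and positive at 0 because z \<noteq> 0, so the rules
  for powers and products apply. The linear map \<open>W\<close> will be the difference of the
  displacements of two bodies.\<close>

lemma pair_force_quad_deriv:
  "quad_deriv (\<lambda>u. norm (z + W u) powr - e * (z + W u) $ c) (\<lambda>u. pair_deriv e z (W u) $ c)"
proof -
  have "quad_deriv (\<lambda>u. N u powr (- e / 2) * (z $ c + W u $ c))
     (\<lambda>u. N 0 powr (- e / 2) * (0 + W u $ c) +
       (z $ c + W 0 $ c) * (- e / 2 * N 0 powr (- e / 2 - 1) * (2 * (z \<bullet> W u))))"
    by (intro quad_deriv_mult powr_quad_deriv norm_square_quad_deriv norm_square_pos quad_deriv_add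
        quad_deriv_const quad_deriv_linear lin)
  moreover have "norm z powr - e = N 0 powr (- e / 2)" "norm z powr - (e + 2) = N 0 powr (- e / 2 - 1)"
    using norm_powr_N[of 0 e] norm_powr_N[of 0 "e + 2"] by (simp_all add: W0 field_simps)
  ultimately show ?thesis unfolding norm_powr_N by (simp add: pair_deriv_def W0 mult_ac)
qed

lemma pair_force_poly_approx: "poly_approx (\<lambda>u. norm (z + W u) powr - e * (z + W u) $ c)"
proof -
  have aff: "poly_approx (\<lambda>u. z $ c + W u $ c)" for c
    by (intro poly_approx_add poly_approx_const poly_approx_linear lin)
  have "poly_approx N" unfolding N_def[abs_def] by (intro poly_approx_sum poly_approx_mult aff)
  from poly_approx_mult[OF powr_poly_approx[OF this norm_square_quad_deriv norm_square_pos] aff]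
  show ?thesis unfolding norm_powr_N by simp
qed

end

lemma bounded_linear_nth_diff:
  "bounded_linear W \<Longrightarrow> bounded_linear (\<lambda>u. W u $ i - W u $ j)" for W :: "'a::real_normed_vector \<Rightarrow> real^'d^'n"
  by (intro bounded_linear_sub bounded_linear_compose[OF bounded_linear_vec_nth])

lemma force_component:
  "force lam p (a + u) $ i $ c = (\<Sum>j\<in>UNIV - {i}. - lam j *
    (norm ((a $ i - a $ j) + (u $ i - u $ j)) powr - (p + 2) * ((a $ i - a $ j) + (u $ i - u $ j)) $ c))"
proof -
  have "(a + u) $ i - (a + u) $ j = (a $ i - a $ j) + (u $ i - u $ j)" for j by simp
  then show ?thesis unfolding force_def vec_lambda_beta
    by (simp only:) (simp add: sum_negf mult.assoc)
qed

lemma quad_deriv_cmult: "quad_deriv f l \<Longrightarrow> quad_deriv (\<lambda>u. c * f u) (\<lambda>u. c * l u)"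
  using quad_deriv_mult[OF quad_deriv_const[of c], of f l] by simp

lemma linear_functional_components:
  fixes f :: "real^'d^'n \<Rightarrow> real"
  assumes "bounded_linear f"
  shows "f v = (\<Sum>i\<in>UNIV. \<Sum>c\<in>UNIV. f (axis i (axis c 1)) * v $ i $ c)"
proof -
  interpret bounded_linear f by fact
  have "v = (\<Sum>i\<in>UNIV. \<Sum>c\<in>UNIV. v $ i $ c *\<^sub>R axis i (axis c 1))"
  proof -
    have "(\<Sum>d\<in>UNIV. v $ i $ d * axis i (axis d 1) $ j $ c) = (if j = i then v $ i $ c else 0)" for i j c
      by (cases "j = i") (simp_all add: axis_def if_distrib cong: if_cong)
    then show ?thesis by (simp add: vec_eq_iff)
  qed
  then have "f v = f (\<Sum>i\<in>UNIV. \<Sum>c\<in>UNIV. v $ i $ c *\<^sub>R axis i (axis c 1))" by (rule arg_cong)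
  then show ?thesis by (simp add: sum scaleR mult.commute)
qed

context
  fixes a :: "real^'d^'n" and W :: "'a::real_normed_vector \<Rightarrow> real^'d^'n"
    and f :: "real^'d^'n \<Rightarrow> real" and lam :: "'n \<Rightarrow> real" and p :: real
  assumes a: "a \<in> noncollision" and W: "bounded_linear W" and f: "bounded_linear f"
begin

private lemma ne: "j \<in> UNIV - {i} \<Longrightarrow> a $ i - a $ j \<noteq> 0"
  using a by (auto simp: noncollision_def)

text \<open>General \<open>W\<close> and \<open>f\<close> because there are two applications: in
  eigenbasis coordinates, and along lines when the second variation of the potential is
  computed.\<close>

lemma force_quad_deriv: "quad_deriv (\<lambda>u. f (force lam p (a + W u))) (\<lambda>u. f (force_deriv lam p a (W u)))"
proof -
  have "quad_deriv (\<lambda>u. \<Sum>j\<in>UNIV - {i}. - lam j *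
    (norm ((a $ i - a $ j) + (W u $ i - W u $ j)) powr - (p + 2) * ((a $ i - a $ j) + (W u $ i - W u $ j)) $ c))
    (\<lambda>u. \<Sum>j\<in>UNIV - {i}. - lam j * pair_deriv (p + 2) (a $ i - a $ j) (W u $ i - W u $ j) $ c)" for i c
    by (rule quad_deriv_sum, rule quad_deriv_cmult,
      rule pair_force_quad_deriv[OF ne bounded_linear_nth_diff[OF W]])
  then have "quad_deriv (\<lambda>u. force lam p (a + W u) $ i $ c) (\<lambda>u. force_deriv lam p a (W u) $ i $ c)" for i c
    by (simp add: force_component force_deriv_def sum_negf)
  then show ?thesis
    unfolding linear_functional_components[OF f, of "force lam p (a + W _)"]
      linear_functional_components[OF f, of "force_deriv lam p a (W _)"]
    by (intro quad_deriv_sum quad_deriv_cmult)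
qed

lemma force_poly_approx: "poly_approx (\<lambda>u. f (force lam p (a + W u)))"
proof -
  have "poly_approx (\<lambda>u. force lam p (a + W u) $ i $ c)" for i c
    unfolding force_component
    by (rule poly_approx_sum, rule poly_approx_mult[OF poly_approx_const],
      rule pair_force_poly_approx[OF ne bounded_linear_nth_diff[OF W]])
  then show ?thesis
    unfolding linear_functional_components[OF f, of "force lam p (a + W _)"]
    by (intro poly_approx_sum poly_approx_mult[OF poly_approx_const])
qed

end

lemma sum_pairs_symmetrize:
  fixes H :: "'n::{finite,linorder} \<Rightarrow> 'n \<Rightarrow> real"
  shows "(\<Sum>i\<in>UNIV. \<Sum>j\<in>UNIV - {i}. H i j) = (\<Sum>i\<in>UNIV. \<Sum>j\<in>{j. i < j}. H i j + H j i)"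
proof -
  have "(\<Sum>i\<in>UNIV. \<Sum>j\<in>UNIV - {i}. H i j) = (\<Sum>i\<in>UNIV. (\<Sum>j\<in>{j. i < j}. H i j) + (\<Sum>j\<in>{j. j < i}. H i j))"
  proof (rule sum.cong[OF refl])
    fix i :: 'n
    have "UNIV - {i} = {j. i < j} \<union> {j. j < i}" by auto
    moreover have "sum (H i) ({j. i < j} \<union> {j. j < i}) = sum (H i) {j. i < j} + sum (H i) {j. j < i}"
      by (rule sum.union_disjoint) auto
    ultimately show "(\<Sum>j\<in>UNIV - {i}. H i j) = (\<Sum>j\<in>{j. i < j}. H i j) + (\<Sum>j\<in>{j. j < i}. H i j)"
      by (simp only:)
  qed
  also have "\<dots> = (\<Sum>i\<in>UNIV. \<Sum>j\<in>{j. i < j}. H i j) + (\<Sum>i\<in>UNIV. \<Sum>j\<in>{j. j < i}. H i j)"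
    by (rule sum.distrib)
  also have "(\<Sum>i\<in>UNIV. \<Sum>j\<in>{j. j < i}. H i j) = (\<Sum>i\<in>UNIV. \<Sum>j\<in>{j. i < j}. H j i)"
    using sum.swap_restrict[of "UNIV :: 'n set" "UNIV :: 'n set" H "\<lambda>i j. j < i"]
    by (simp only: finite UNIV_I simp_thms)
  finally show ?thesis by (simp only: sum.distrib)
qed

context
  fixes lam :: "'n::{finite,linorder} \<Rightarrow> real" and p :: real
begin

text \<open>Reversing a pair changes the sign of \<open>pair_deriv\<close>, so the sum over
  unordered pairs involves only differences of u and of v; for fixed z the bilinear form given by
  \<open>pair_deriv\<close> is symmetric.\<close>

lemma mass_inner_force_deriv_commute:
  fixes a :: "(real^'d, 'n) vec"
  shows "mass_inner lam (force_deriv lam p a u) v = mass_inner lam u (force_deriv lam p a v)"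
proof -
  define H where "H u v i j = lam i * lam j * (pair_deriv (p + 2) (a $ i - a $ j) (u $ i - u $ j) \<bullet> v $ i)"
    for u v :: "(real^'d, 'n) vec" and i j
  have eq: "mass_inner lam (force_deriv lam p a u) v = - (\<Sum>i\<in>UNIV. \<Sum>j\<in>UNIV - {i}. H u v i j)" for u v
    by (simp add: mass_inner_def force_deriv_def H_def inner_sum_left sum_distrib_left sum_negf mult_ac)
  have "pair_deriv e (- z) (- w) = - pair_deriv e z w" for e and z w :: "real^'d"
    by (simp add: pair_deriv_def)
  note neg = this
  have H: "H u v i j + H u v j i = lam i * lam j *
     (pair_deriv (p + 2) (a $ i - a $ j) (u $ i - u $ j) \<bullet> (v $ i - v $ j))" for u v i j
  proof -
    have "pair_deriv (p + 2) (a $ j - a $ i) (u $ j - u $ i) = - pair_deriv (p + 2) (a $ i - a $ j) (u $ i - u $ j)"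
      using neg[of "p + 2" "a $ i - a $ j" "u $ i - u $ j"] by simp
    then show ?thesis unfolding H_def by (simp add: inner_diff_right algebra_simps)
  qed
  have "pair_deriv e z w \<bullet> w' = pair_deriv e z w' \<bullet> w" for e and z w w' :: "real^'d"
    by (simp add: pair_deriv_def inner_diff_left inner_commute[of w w'])
  then have "H u v i j + H u v j i = H v u i j + H v u j i" for i j unfolding H by simp
  then have "mass_inner lam (force_deriv lam p a u) v = mass_inner lam (force_deriv lam p a v) u"
    unfolding eq sum_pairs_symmetrize by simp
  then show ?thesis by (simp add: mass_inner_def inner_commute)
qed

lemma mass_inner_force:
  fixes \<alpha> :: "(real^'d, 'n) vec"
  shows "mass_inner lam (force lam p \<alpha>) v = (\<Sum>i\<in>UNIV. \<Sum>j\<in>{j. i < j}.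
    - lam i * lam j * norm (\<alpha> $ i - \<alpha> $ j) powr - (p + 2) * ((\<alpha> $ i - \<alpha> $ j) \<bullet> (v $ i - v $ j)))"
proof -
  define H where "H i j = - lam i * lam j * norm (\<alpha> $ i - \<alpha> $ j) powr - (p + 2) * ((\<alpha> $ i - \<alpha> $ j) \<bullet> v $ i)" for i j
  have "mass_inner lam (force lam p \<alpha>) v = (\<Sum>i\<in>UNIV. \<Sum>j\<in>UNIV - {i}. H i j)"
    by (simp add: mass_inner_def force_def H_def inner_sum_left sum_distrib_left sum_negf mult_ac)
  moreover have "H i j + H j i = - lam i * lam j * norm (\<alpha> $ i - \<alpha> $ j) powr - (p + 2) *
      ((\<alpha> $ i - \<alpha> $ j) \<bullet> (v $ i - v $ j))" for i j
    unfolding H_def norm_minus_commute[of "\<alpha> $ j" "\<alpha> $ i"]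
    by (simp add: inner_diff_left inner_diff_right algebra_simps)
  ultimately show ?thesis by (simp add: sum_pairs_symmetrize)
qed

lemma euler_identity:
  fixes \<alpha> :: "(real^'d, 'n) vec"
  assumes "\<alpha> \<in> noncollision" "p \<noteq> 0"
  shows "mass_inner lam (force lam p \<alpha>) \<alpha> = - p * potential lam p \<alpha>"
proof -
  have "- lam i * lam j * norm (\<alpha> $ i - \<alpha> $ j) powr - (p + 2) * ((\<alpha> $ i - \<alpha> $ j) \<bullet> (\<alpha> $ i - \<alpha> $ j)) =
    - (lam i * lam j / norm (\<alpha> $ i - \<alpha> $ j) powr p)" if "i < j" for i j
  proof -
    define n where "n = norm (\<alpha> $ i - \<alpha> $ j)"
    have "\<alpha> $ i \<noteq> \<alpha> $ j" using assms(1) that by (auto simp: noncollision_def)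
    then have n: "0 < n" by (simp add: n_def)
    have "n powr - (p + 2) * n ^ 2 = n powr - (p + 2) * n powr 2" using n by simp
    also have "\<dots> = n powr - p" by (subst powr_add[symmetric]) simp
    also have "\<dots> = 1 / n powr p" by (simp add: powr_minus_divide)
    finally show ?thesis by (simp add: dot_square_norm n_def[symmetric] mult.assoc)
  qed
  then show ?thesis
    using \<open>p \<noteq> 0\<close> by (simp add: mass_inner_force potential_def sum_negf)
qed

text \<open>Identifies \<open>force\<close> as the gradient of \<open>potential\<close>, with a plus
  sign: the potential of the theorem is the negative of the potential energy.\<close>

lemma potential_line_deriv:
  fixes a v :: "(real^'d, 'n) vec"
  assumes "a + t *\<^sub>R v \<in> noncollision" "p \<noteq> 0"
  shows "((\<lambda>t. potential lam p (a + t *\<^sub>R v)) has_real_derivative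
    mass_inner lam (force lam p (a + t *\<^sub>R v)) v) (at t)"
proof -
  have pair: "((\<lambda>t. (1 / p) * (A / norm (z + t *\<^sub>R w) powr p)) has_real_derivative
     - A * norm (z + t *\<^sub>R w) powr - (p + 2) * ((z + t *\<^sub>R w) \<bullet> w)) (at t)"
    if nz: "z + t *\<^sub>R w \<noteq> 0" for z w :: "real^'d" and A
  proof -
    \<comment> \<open>The squared distance along the line is a quadratic polynomial in t, so only a
      power of a positive function has to be differentiated.\<close>
    define D where "D t = z \<bullet> z + 2 * t * (z \<bullet> w) + t\<^sup>2 * (w \<bullet> w)" for t
    have D: "D t = (norm (z + t *\<^sub>R w))\<^sup>2" for t
      unfolding dot_square_norm[symmetric] D_def
      by (simp add: inner_add_left inner_add_right inner_commute[of w z] power2_eq_square algebra_simps)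
    have Dp: "norm (z + t *\<^sub>R w) powr q = D t powr (q / 2)" for t q
      by (cases "z + t *\<^sub>R w = 0") (simp_all add: D powr_powr flip: powr_numeral)
    have "0 < D t" using nz by (simp add: D)
    have "(D has_real_derivative 2 * (z \<bullet> w) + 2 * t * (w \<bullet> w)) (at t)"
      unfolding D_def by (auto intro!: derivative_eq_intros)
    from DERIV_cmult[OF DERIV_fun_powr[OF this \<open>0 < D t\<close>, of "- p / 2"], of "A / p"]
    have der: "((\<lambda>t. A / p * D t powr (- p / 2)) has_real_derivative
       A / p * (- p / 2 * D t powr (- p / 2 - 1) * (2 * (z \<bullet> w) + 2 * t * (w \<bullet> w)))) (at t)"
      by simp
    have val: "A / p * (- p / 2 * D t powr (- p / 2 - 1) * (2 * (z \<bullet> w) + 2 * t * (w \<bullet> w))) =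
       - A * norm (z + t *\<^sub>R w) powr - (p + 2) * ((z + t *\<^sub>R w) \<bullet> w)"
    proof -
      have "D t powr (- p / 2 - 1) = norm (z + t *\<^sub>R w) powr - (p + 2)"
        unfolding Dp by (simp add: field_simps)
      moreover have "A / p * (- p / 2 * N * (2 * x + 2 * t * y)) = - A * N * (x + t * y)" for N x y :: real
      proof -
        have "A / p * (- p / 2 * N * (2 * x + 2 * t * y)) = (A / p * p) * (- (N * (x + t * y)))"
          by (simp only: divide_inverse) (simp add: algebra_simps)
        then show ?thesis using \<open>p \<noteq> 0\<close> by simp
      qed
      ultimately show ?thesis by (simp only: inner_add_left inner_scaleR_left)
    qed
    have fn: "(\<lambda>t. A / p * D t powr (- p / 2)) = (\<lambda>t. (1 / p) * (A / norm (z + t *\<^sub>R w) powr p))"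
      unfolding Dp by (simp add: powr_minus_divide)
    from der show ?thesis unfolding val fn .
  qed
  have diff: "(a + t *\<^sub>R v) $ i - (a + t *\<^sub>R v) $ j = (a $ i - a $ j) + t *\<^sub>R (v $ i - v $ j)" for i j t
    by (simp add: scaleR_diff_right)
  have "((\<lambda>t. \<Sum>i\<in>UNIV. \<Sum>j\<in>{j. i < j}. (1 / p) * (lam i * lam j /
       norm ((a $ i - a $ j) + t *\<^sub>R (v $ i - v $ j)) powr p)) has_real_derivative
     (\<Sum>i\<in>UNIV. \<Sum>j\<in>{j. i < j}. - (lam i * lam j) * norm ((a $ i - a $ j) + t *\<^sub>R (v $ i - v $ j)) powr - (p + 2) *
       (((a $ i - a $ j) + t *\<^sub>R (v $ i - v $ j)) \<bullet> (v $ i - v $ j)))) (at t)"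
  proof (rule DERIV_sum, rule DERIV_sum, rule pair)
    fix i j :: 'n assume "j \<in> {j. i < j}"
    then have "i \<noteq> j" by auto
    then have "(a + t *\<^sub>R v) $ i \<noteq> (a + t *\<^sub>R v) $ j" using assms(1) unfolding noncollision_def by blast
    then show "(a $ i - a $ j) + t *\<^sub>R (v $ i - v $ j) \<noteq> 0" unfolding diff[symmetric] by simp
  qed
  then show ?thesis
    unfolding potential_def mass_inner_force sum_distrib_left diff by (simp only: mult_minus_left)
qed

end

lemma quad_deriv_line_DERIV:
  fixes g :: "real \<Rightarrow> real"
  assumes "quad_deriv g l" shows "(g has_real_derivative l 1) (at 0)"
proof -
  interpret l: bounded_linear l using assms by (simp add: quad_deriv_def)
  have l: "l h = l 1 * h" for h using l.scaleR[of h 1] by simp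
  have "filterlim (\<lambda>u. (u, 0::real)) (nhds (0, 0)) (nhds 0)" by (intro tendsto_Pair tendsto_const filterlim_ident)
  from landau_o.big.compose[OF conjunct2[OF assms[unfolded quad_deriv_def]] this]
  have "(\<lambda>h. g h - g 0 - l h) \<in> O[nhds 0](\<lambda>h. \<bar>h\<bar> * \<bar>h\<bar>)" by simp
  then obtain C where C: "\<forall>\<^sub>F h in nhds 0. norm (g h - g 0 - l h) \<le> C * norm (\<bar>h\<bar> * \<bar>h\<bar>)"
    by (rule landau_o.bigE)
  have "\<forall>\<^sub>F h in at 0. norm ((g (0 + h) - g 0) / h - l 1) \<le> C * \<bar>h\<bar>"
    using C[unfolded eventually_nhds_conv_at, THEN conjunct1] eventually_neq_at_within[of 0 0 UNIV]
  proof eventually_elim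
    case (elim h)
    have "norm ((g (0 + h) - g 0) / h - l 1) = norm (g h - g 0 - l h) / \<bar>h\<bar>"
    proof -
      have "(g (0 + h) - g 0) / h - l 1 = (g h - g 0 - l h) / h"
        unfolding l[of h] using elim(2) by (simp add: diff_divide_distrib)
      then show ?thesis by (simp add: abs_divide)
    qed
    also have "\<dots> \<le> C * (\<bar>h\<bar> * \<bar>h\<bar>) / \<bar>h\<bar>" using elim by (intro divide_right_mono) (auto simp: abs_mult)
    also have "C * (\<bar>h\<bar> * \<bar>h\<bar>) / \<bar>h\<bar> = C * \<bar>h\<bar>"
    proof -
      have "C * (x * x) / x = C * x" if "x \<noteq> 0" for x :: real using that by simp
      from this[of "\<bar>h\<bar>"] elim(2) show ?thesis by (simp only: abs_eq_0 simp_thms)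
    qed
    finally show ?case .
  qed
  note bound = this
  have "((\<lambda>h. C * \<bar>h\<bar>) \<longlongrightarrow> C * \<bar>0\<bar>) (at 0)" by (intro tendsto_intros)
  then have "((\<lambda>h. C * \<bar>h\<bar>) \<longlongrightarrow> 0) (at 0)" by simp
  from Lim_null_comparison[OF bound this]
  have "((\<lambda>h. (g (0 + h) - g 0) / h) \<longlongrightarrow> l 1) (at 0)" by (rule LIM_zero_cancel)
  then show ?thesis unfolding DERIV_def .
qed

lemma noncollision_neighborhood:
  assumes "a \<in> noncollision" and W: "(W \<longlongrightarrow> 0) F"
  shows "\<forall>\<^sub>F u in F. a + W u \<in> noncollision"
proof -
  have "\<forall>\<^sub>F u in F. j \<noteq> k \<longrightarrow> (a + W u) $ j \<noteq> (a + W u) $ k" for j k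
  proof (cases "j = k")
    case False
    then have ne: "(a + 0) $ j - (a + 0) $ k \<noteq> 0" using assms(1) by (simp add: noncollision_def)
    have "((\<lambda>u. (a + W u) $ j - (a + W u) $ k) \<longlongrightarrow> (a + 0) $ j - (a + 0) $ k) F"
      by (intro tendsto_intros W)
    from tendsto_imp_eventually_ne[OF this ne] show ?thesis by eventually_elim auto
  qed auto
  then show ?thesis unfolding noncollision_def mem_Collect_eq by (intro eventually_all_finite)
qed

context
  fixes lam :: "'n::{finite,linorder} \<Rightarrow> real" and p :: real
  assumes lam: "\<And>i. lam i > 0" and p: "0 < p"
begin

lemma mass_inner_pos:
  fixes u :: "(real^'d, 'n) vec"
  assumes "u \<noteq> 0" shows "0 < mass_inner lam u u"
proof -
  obtain i where "u $ i \<noteq> 0" using assms by (auto simp: vec_eq_iff)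
  then show ?thesis unfolding mass_inner_def
    using lam by (intro sum_pos2[of _ i]) (auto intro!: mult_nonneg_nonneg simp: less_imp_le)
qed

lemma noncollision_nonzero:
  fixes a :: "(real^'d, 'n) vec"
  assumes "CARD('n) \<ge> 2" "a \<in> noncollision" shows "a \<noteq> 0"
proof
  assume "a = 0"
  obtain i j :: 'n where "i \<noteq> j"
    using assms(1) card_le_Suc0_iff_eq[of "UNIV :: 'n set"] by force
  then show False using assms(2) \<open>a = 0\<close> by (auto simp: noncollision_def)
qed

lemma potential_scaleR:
  fixes \<alpha> :: "(real^'d, 'n) vec"
  assumes "0 < k" shows "potential lam p (k *\<^sub>R \<alpha>) = k powr - p * potential lam p \<alpha>"
proof -
  have "norm ((k *\<^sub>R \<alpha>) $ i - (k *\<^sub>R \<alpha>) $ j) powr p = k powr p * norm (\<alpha> $ i - \<alpha> $ j) powr p" for i j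
    using assms by (simp add: scaleR_diff_right[symmetric] powr_mult)
  then show ?thesis unfolding potential_def
    by (simp add: sum_distrib_left powr_minus divide_inverse mult_ac)
qed

lemma potential_nonneg: "0 \<le> potential lam p \<alpha>" for \<alpha> :: "(real^'d, 'n) vec"
  unfolding potential_def using p lam
  by (intro mult_nonneg_nonneg sum_nonneg divide_nonneg_nonneg) (auto intro: less_imp_le)

text \<open>By homogeneity, the constrained minimum of the potential on a sphere becomes a global
  minimum once a suitable multiple of the moment of inertia is added.\<close>
lemma minimal_config_global_min:
  fixes a \<alpha> :: "(real^'d, 'n) vec"
  assumes min: "minimal_config lam p a" and card: "CARD('n) \<ge> 2"
    and crit: "force lam p a = - (2 * c) *\<^sub>R a"
    and \<alpha>: "\<alpha> \<in> noncollision"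
  shows "potential lam p a + c * mass_inner lam a a \<le> potential lam p \<alpha> + c * mass_inner lam \<alpha> \<alpha>"
proof -
  have a: "a \<in> noncollision" using min by (simp add: minimal_config_def)
  define A where "A = mass_inner lam a a"
  define B where "B = mass_inner lam \<alpha> \<alpha>"
  have AB: "0 < A" "0 < B"
    using noncollision_nonzero[OF card] a \<alpha> by (auto simp: A_def B_def intro: mass_inner_pos)
  have wn: "weighted_norm lam u = sqrt (mass_inner lam u u)" for u :: "(real^'d, 'n) vec"
    by (simp add: weighted_norm_def mass_inner_def dot_square_norm)
  \<comment> \<open>Euler's identity expresses the inertia term by the potential, so that everything
    becomes a multiple of \<open>potential lam p a\<close>.\<close>
  have cA: "c * A = p / 2 * potential lam p a"
  proof -
    have "mass_inner lam (force lam p a) a = - (2 * c) * A"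
      unfolding crit by (simp add: mass_inner_def A_def sum_distrib_left mult_ac sum_negf)
    with euler_identity[OF a, of p lam] p show ?thesis by simp
  qed
  \<comment> \<open>Dividing by \<open>r\<close> moves \<alpha> to the sphere through a, where
    minimality applies.\<close>
  define r where "r = sqrt (B / A)"
  have r: "0 < r" "r\<^sup>2 = B / A" using AB by (simp_all add: r_def)
  have scaled: "inverse r *\<^sub>R \<alpha> \<in> noncollision" using \<alpha> r by (auto simp: noncollision_def)
  have "mass_inner lam (inverse r *\<^sub>R \<alpha>) (inverse r *\<^sub>R \<alpha>) = (inverse r)\<^sup>2 * B"
    by (simp add: mass_inner_def B_def sum_distrib_left power2_eq_square mult_ac)
  also have "\<dots> = A" using r AB by (simp add: power_inverse)
  finally have "weighted_norm lam (inverse r *\<^sub>R \<alpha>) = weighted_norm lam a" by (simp add: wn A_def)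
  then have "potential lam p a \<le> potential lam p (inverse r *\<^sub>R \<alpha>)"
    using min scaled by (simp add: minimal_config_def)
  also have "\<dots> = r powr p * potential lam p \<alpha>"
    using r by (simp add: potential_scaleR powr_minus inverse_powr)
  finally have U: "r powr - p * potential lam p a \<le> potential lam p \<alpha>"
    using r by (simp add: powr_minus field_simps)
  \<comment> \<open>The right-hand side as a function of r is smallest at r = 1. The bound combines
    exp(x) \<ge> 1 + x with ln(r^2) \<le> r^2 - 1.\<close>
  have "1 + p / 2 \<le> r powr - p + p / 2 * r\<^sup>2"
  proof -
    have "r\<^sup>2 > 0" using r(1) by (rule zero_less_power)
    have "r powr - p = exp (- (p / 2) * ln (r\<^sup>2))"
      using r(1) by (simp add: powr_def ln_realpow)
    then have "1 - p / 2 * ln (r\<^sup>2) \<le> r powr - p"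
      using exp_ge_add_one_self[of "- (p / 2) * ln (r\<^sup>2)"] by simp
    moreover have "p / 2 * ln (r\<^sup>2) \<le> p / 2 * (r\<^sup>2 - 1)"
      using p ln_le_minus_one[OF \<open>r\<^sup>2 > 0\<close>] by (intro mult_left_mono) auto
    ultimately show ?thesis by (simp add: algebra_simps)
  qed
  then have "(1 + p / 2) * potential lam p a \<le> (r powr - p + p / 2 * r\<^sup>2) * potential lam p a"
    by (intro mult_right_mono potential_nonneg)
  also have "\<dots> = r powr - p * potential lam p a + r\<^sup>2 * (c * A)"
    unfolding cA by (simp add: algebra_simps)
  also have "r\<^sup>2 * (c * A) = c * B" using r AB by simp
  finally show ?thesis using U cA by (simp add: A_def B_def algebra_simps)
qed

lemma bounded_linear_mass_inner: "bounded_linear (\<lambda>u. mass_inner lam u v)"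
  for v :: "(real^'d, 'n) vec"
  unfolding mass_inner_def
  by (intro bounded_linear_sum bounded_linear_const_mult
      bounded_linear_compose[OF bounded_linear_inner_left bounded_linear_vec_nth])

text \<open>The sum of the potential and c times the inertia is minimal at a by
  \<open>minimal_config_global_min\<close>, so its second variation, the right side minus the left
  side, is nonnegative.\<close>

lemma minimal_config_hessian:
  fixes a :: "(real^'d, 'n) vec"
  assumes min: "minimal_config lam p a" and card: "CARD('n) \<ge> 2"
    and crit: "force lam p a = - (2 * c) *\<^sub>R a"
  shows "- (2 * c) * mass_inner lam v v \<le> mass_inner lam (force_deriv lam p a v) v"
proof (rule ccontr)
  assume neg: "\<not> ?thesis"
  have a: "a \<in> noncollision" using min by (simp add: minimal_config_def)
  interpret mi: bounded_linear "\<lambda>u. mass_inner lam u v" by (rule bounded_linear_mass_inner)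
  \<comment> \<open>The derivative of this functional along a + h v. It vanishes at 0 by
    \<open>crit\<close>, and a negative second variation would make it negative just to the right of
    0.\<close>
  define \<psi> where "\<psi> h = mass_inner lam (force lam p (a + h *\<^sub>R v)) v + 2 * c * mass_inner lam (a + h *\<^sub>R v) v" for h
  define \<kappa> where "\<kappa> = mass_inner lam (force_deriv lam p a v) v + 2 * c * mass_inner lam v v"
  have "\<kappa> < 0" using neg by (simp add: \<kappa>_def)
  have lin: "bounded_linear (\<lambda>h. h *\<^sub>R v)" by (rule bounded_linear_scaleR_left)
  have "((\<lambda>h. mass_inner lam (force lam p (a + h *\<^sub>R v)) v) has_real_derivative
      mass_inner lam (force_deriv lam p a (1 *\<^sub>R v)) v) (at 0)"
    by (rule quad_deriv_line_DERIV[OF force_quad_deriv[OF a lin bounded_linear_mass_inner]])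
  moreover have "((\<lambda>h. 2 * c * mass_inner lam (a + h *\<^sub>R v) v) has_real_derivative 2 * c * mass_inner lam v v) (at h)" for h
    unfolding mi.add mi.scaleR by (auto intro!: derivative_eq_intros)
  ultimately have "(\<psi> has_real_derivative \<kappa>) (at 0)"
    unfolding \<psi>_def \<kappa>_def by (auto intro!: DERIV_add)
  from DERIV_neg_dec_right[OF this \<open>\<kappa> < 0\<close>] obtain d1 where d1: "0 < d1" "\<And>h. 0 < h \<Longrightarrow> h < d1 \<Longrightarrow> \<psi> h < \<psi> 0"
    by auto
  have psi0: "\<psi> 0 = 0" unfolding \<psi>_def by (simp add: crit mi.neg mi.scaleR)
  have "\<forall>\<^sub>F h in nhds 0. a + h *\<^sub>R v \<in> noncollision"
    using a by (intro noncollision_neighborhood) (auto intro!: tendsto_eq_intros filterlim_ident)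
  then obtain d2 where d2: "0 < d2" "\<And>h. \<bar>h\<bar> < d2 \<Longrightarrow> a + h *\<^sub>R v \<in> noncollision"
    unfolding eventually_nhds_metric by (auto simp: dist_real_def)
  define \<phi> where "\<phi> h = potential lam p (a + h *\<^sub>R v) + c * mass_inner lam (a + h *\<^sub>R v) (a + h *\<^sub>R v)" for h
  have dphi: "(\<phi> has_real_derivative \<psi> h) (at h)" if "\<bar>h\<bar> < d2" for h
  proof -
    have comm: "mass_inner lam v u = mass_inner lam u v" for u by (simp add: mass_inner_def inner_commute)
    have expand: "mass_inner lam (a + h *\<^sub>R v) (a + h *\<^sub>R v) =
        mass_inner lam a a + 2 * h * mass_inner lam a v + h\<^sup>2 * mass_inner lam v v" for h
      by (simp add: mass_inner_def inner_add_left inner_add_right inner_commute[of "v $ _" "a $ _"]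
        power2_eq_square distrib_left sum.distrib sum_distrib_left mult_ac)
    have "((\<lambda>h. c * mass_inner lam (a + h *\<^sub>R v) (a + h *\<^sub>R v)) has_real_derivative
        2 * c * mass_inner lam (a + h *\<^sub>R v) v) (at h)"
      unfolding expand mi.add mi.scaleR by (auto intro!: derivative_eq_intros simp: algebra_simps)
    with potential_line_deriv[of a h v p lam] d2(2)[OF that] p show ?thesis
      unfolding \<phi>_def \<psi>_def by (auto intro: DERIV_add)
  qed
  define h where "h = min d1 d2 / 2"
  have h: "0 < h" "h < d1" "h < d2" using d1 d2 by (auto simp: h_def)
  obtain t where t: "0 < t" "t < h" "\<phi> h - \<phi> 0 = (h - 0) * \<psi> t"
    using MVT2[of 0 h \<phi> \<psi>] h dphi by auto
  have "\<phi> h < \<phi> 0"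
    using t h d1(2)[of t] psi0 mult_pos_neg[of h "\<psi> t"] by simp
  moreover have "\<phi> 0 \<le> \<phi> h"
    using minimal_config_global_min[OF min card crit d2(2)[of h]] h by (simp add: \<phi>_def)
  ultimately show False by simp
qed

end

section \<open>Solutions asymptotic to a normal configuration\<close>

lemma force_deriv_linear: "linear (force_deriv lam p a)"
proof
  have pd: "pair_deriv e z (u + v) = pair_deriv e z u + pair_deriv e z v"
    "pair_deriv e z (c *\<^sub>R u) = c *\<^sub>R pair_deriv e z u" for e c and z u v :: "real^'d"
    by (simp_all add: pair_deriv_def inner_add_right algebra_simps)
  show "force_deriv lam p a (u + v) = force_deriv lam p a u + force_deriv lam p a v" for u v
  proof -
    have "(u + v) $ i - (u + v) $ j = (u $ i - u $ j) + (v $ i - v $ j)" for i j by simp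
    then have "lam j *\<^sub>R pair_deriv (p + 2) (a $ i - a $ j) ((u + v) $ i - (u + v) $ j) =
        lam j *\<^sub>R pair_deriv (p + 2) (a $ i - a $ j) (u $ i - u $ j) +
        lam j *\<^sub>R pair_deriv (p + 2) (a $ i - a $ j) (v $ i - v $ j)" for i j
      by (simp only: pd scaleR_add_right)
    then show ?thesis unfolding force_deriv_def by (simp only: sum.distrib) (simp add: vec_eq_iff)
  qed
  show "force_deriv lam p a (c *\<^sub>R u) = c *\<^sub>R force_deriv lam p a u" for c u
  proof -
    have "(c *\<^sub>R u) $ i - (c *\<^sub>R u) $ j = c *\<^sub>R (u $ i - u $ j)" for i j
      by (simp add: scaleR_diff_right)
    then have "lam j *\<^sub>R pair_deriv (p + 2) (a $ i - a $ j) ((c *\<^sub>R u) $ i - (c *\<^sub>R u) $ j) =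
        c *\<^sub>R (lam j *\<^sub>R pair_deriv (p + 2) (a $ i - a $ j) (u $ i - u $ j))" for i j
      by (simp only: pd scaleR_left_commute)
    then show ?thesis unfolding force_deriv_def
      by (simp only: scaleR_sum_right[symmetric]) (simp add: vec_eq_iff)
  qed
qed

text \<open>Multiplying each body by the square root of its mass turns \<open>mass_inner\<close>
  into the Euclidean inner product and the linearized force into a self-adjoint operator. Its
  eigenvectors are scaled back; \<open>cf\<close> are the coordinate functionals.\<close>

lemma force_deriv_eigenbasis:
  fixes lam :: "'n::{finite,linorder} \<Rightarrow> real" and a :: "(real^'d, 'n) vec"
  assumes lam: "\<And>i. lam i > 0"
  obtains b :: "'n \<times> 'd::finite \<Rightarrow> (real^'d, 'n) vec" and \<mu> :: "'n \<times> 'd \<Rightarrow> real"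
    and cf :: "'n \<times> 'd \<Rightarrow> (real^'d, 'n) vec \<Rightarrow> real"
  where "\<And>k. force_deriv lam p a (b k) = \<mu> k *\<^sub>R b k" "\<And>k. bounded_linear (cf k)"
    "\<And>u. u = (\<Sum>k\<in>UNIV. cf k u *\<^sub>R b k)" "\<And>k l. cf k (b l) = (if k = l then 1 else 0)"
    "\<And>k. mass_inner lam (b k) (b k) = 1"
proof -
  define rt where "rt u = (\<chi> i. sqrt (lam i) *\<^sub>R u $ i)" for u :: "(real^'d, 'n) vec"
  define ir where "ir u = (\<chi> i. inverse (sqrt (lam i)) *\<^sub>R u $ i)" for u :: "(real^'d, 'n) vec"
  define S where "S u = rt (force_deriv lam p a (ir u))" for u
  have sq: "sqrt (lam i) \<noteq> 0" for i using lam[of i] by simp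
  have rtir [simp]: "rt (ir u) = u" "ir (rt u) = u" for u
    by (simp_all add: rt_def ir_def vec_eq_iff right_inverse[OF sq] left_inverse[OF sq])
  have lin: "linear rt" "linear ir"
    by (auto intro!: linearI simp: rt_def ir_def vec_eq_iff algebra_simps)
  have mi: "mass_inner lam u v = rt u \<bullet> rt v" for u v
  proof -
    have "sqrt (lam i) * (sqrt (lam i) * x) = lam i * x" for i x
      using lam[of i] by (simp add: mult.assoc[symmetric])
    then show ?thesis
      by (simp only: mass_inner_def rt_def inner_vec_def[of "\<chi> i. sqrt (lam i) *\<^sub>R u $ i"] vec_lambda_beta
        inner_scaleR_left inner_scaleR_right)
  qed
  have linS: "linear S" unfolding S_def
    using linear_compose[OF linear_compose[OF lin(2) force_deriv_linear[of lam p a]] lin(1)] by (simp add: o_def)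
  have symS: "S u \<bullet> v = u \<bullet> S v" for u v
    using mass_inner_force_deriv_commute[of lam p a "ir u" "ir v"] by (simp add: mi S_def)
  have card: "CARD('n \<times> 'd) = DIM((real^'d, 'n) vec)" by simp
  obtain e :: "'n \<times> 'd \<Rightarrow> (real^'d, 'n) vec" and \<mu> where e: "\<And>k. S (e k) = \<mu> k *\<^sub>R e k"
    "\<And>k l. e k \<bullet> e l = (if k = l then 1 else 0)" "\<And>u. u = (\<Sum>k\<in>UNIV. (e k \<bullet> u) *\<^sub>R e k)"
    using self_adjoint_orthonormal_eigenbasis[OF linS symS card] by blast
  show ?thesis
  proof
    show "force_deriv lam p a (ir (e k)) = \<mu> k *\<^sub>R ir (e k)" for k
    proof -
      have "ir (S (e k)) = ir (\<mu> k *\<^sub>R e k)" by (simp only: e(1))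
      then show ?thesis by (simp add: S_def linear_cmul[OF lin(2)])
    qed
    show "bounded_linear (\<lambda>u. e k \<bullet> rt u)" for k
      using bounded_linear_compose[OF bounded_linear_inner_right linear_conv_bounded_linear[THEN iffD1, OF lin(1)]]
      by simp
    show "u = (\<Sum>k\<in>UNIV. (e k \<bullet> rt u) *\<^sub>R ir (e k))" for u
    proof -
      have "u = ir (rt u)" by simp
      also have "\<dots> = ir (\<Sum>k\<in>UNIV. (e k \<bullet> rt u) *\<^sub>R e k)" using e(3)[of "rt u"] by simp
      also have "\<dots> = (\<Sum>k\<in>UNIV. (e k \<bullet> rt u) *\<^sub>R ir (e k))"
        by (simp add: linear_sum[OF lin(2)] linear_cmul[OF lin(2)])
      finally show ?thesis .
    qed
    show "e k \<bullet> rt (ir (e l)) = (if k = l then 1 else 0)" for k l by (simp add: e(2))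
    show "mass_inner lam (ir (e k)) (ir (e k)) = 1" for k by (simp add: mi e(2))
  qed
qed

lemma dual_basis_indexed_basis:
  fixes b :: "'n \<times> 'd \<Rightarrow> real^'d^'n"
  assumes lin: "\<And>k. bounded_linear (cf k)" and expand: "\<And>u. u = (\<Sum>k\<in>UNIV. cf k u *\<^sub>R b k)"
    and dual: "\<And>k l. cf k (b l) = (if k = l then 1 else 0)"
  shows "indexed_basis b"
  unfolding indexed_basis_def
proof (intro conjI)
  show "inj b"
  proof (rule injI)
    fix k l assume "b k = b l"
    then have "cf k (b k) = cf k (b l)" by simp
    then show "k = l" by (simp add: dual split: if_splits)
  qed
  show sp: "span (range b) = UNIV"
  proof -
    have "u \<in> span (range b)" for u
      by (subst expand[of u]) (intro span_sum span_scale span_base, simp)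
    then show ?thesis by auto
  qed
  have "card (range b) = CARD('n \<times> 'd)" using \<open>inj b\<close> by (rule card_image)
  then have "card (range b) = dim (UNIV :: (real^'d^'n) set)" by simp
  then show "independent (range b)"
    by (intro card_le_dim_spanning[of _ UNIV]) (auto simp: sp)
qed

lemma nbody_force_eq:
  fixes A B :: "real^'d^'n"
  shows "lam i *\<^sub>R (B $ i) = - (\<Sum>j\<in>UNIV - {i}. (lam i * lam j / norm (\<alpha> $ i - \<alpha> $ j) powr (p + 2)) *\<^sub>R (\<alpha> $ i - \<alpha> $ j))
    \<longleftrightarrow> lam i *\<^sub>R (B $ i) = lam i *\<^sub>R (force lam p \<alpha> $ i)"
proof -
  have "lam i *\<^sub>R (force lam p \<alpha> $ i) =
      - (\<Sum>j\<in>UNIV - {i}. (lam i * lam j / norm (\<alpha> $ i - \<alpha> $ j) powr (p + 2)) *\<^sub>R (\<alpha> $ i - \<alpha> $ j))"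
    unfolding force_def by (simp add: scaleR_sum_right powr_minus_divide del: minus_add_distrib)
  then show ?thesis by simp
qed

text \<open>The system is evaluated at t = 1, where the second derivative of t^s a is s(s - 1)
  a.\<close>

lemma normal_config_force:
  fixes a :: "real^'d^('n::{finite,linorder})"
  assumes normal: "normal_config lam p a" and lam: "\<And>i. lam i > 0" and p: "0 < p"
  shows "force lam p a = - (2 * (p / (p + 2)\<^sup>2)) *\<^sub>R a"
proof -
  define s where "s = 2 / (p + 2)"
  define \<alpha> where "\<alpha> t = t powr s *\<^sub>R a" for t
  have da: "(\<alpha> has_vector_derivative (s * t powr (s - 1)) *\<^sub>R a) (at t)" if "0 < t" for t
    unfolding \<alpha>_def using that
    by (auto intro!: derivative_eq_intros simp: has_real_derivative_iff_has_vector_derivative[symmetric])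
  have "nbody_solution lam p 0 (\<lambda>t. (\<alpha> t, vector_derivative \<alpha> (at t)))"
    using normal by (simp add: normal_config_def \<alpha>_def[abs_def] s_def Let_def)
  from conjunct2[OF this[unfolded nbody_solution_def, rule_format, of 1, OF zero_less_one]]
  obtain A B where "((\<lambda>t. snd (\<alpha> t, vector_derivative \<alpha> (at t))) has_vector_derivative B) (at 1)"
    "\<forall>i. A $ i = snd (\<alpha> 1, vector_derivative \<alpha> (at 1)) $ i \<and>
      lam i *\<^sub>R (B $ i) = - (\<Sum>j\<in>UNIV - {i}. (lam i * lam j /
        norm (fst (\<alpha> 1, vector_derivative \<alpha> (at 1)) $ i - fst (\<alpha> 1, vector_derivative \<alpha> (at 1)) $ j) powr (p + 2)) *\<^sub>R
        (fst (\<alpha> 1, vector_derivative \<alpha> (at 1)) $ i - fst (\<alpha> 1, vector_derivative \<alpha> (at 1)) $ j))"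
    by blast
  then have B: "((\<lambda>t. vector_derivative \<alpha> (at t)) has_vector_derivative B) (at 1)"
    "lam i *\<^sub>R (B $ i) = - (\<Sum>j\<in>UNIV - {i}. (lam i * lam j / norm (\<alpha> 1 $ i - \<alpha> 1 $ j) powr (p + 2)) *\<^sub>R (\<alpha> 1 $ i - \<alpha> 1 $ j))" for i
    by (simp_all only: snd_conv fst_conv)
  have "((\<lambda>t. (s * t powr (s - 1)) *\<^sub>R a) has_vector_derivative (s * ((s - 1) * 1 powr (s - 1 - 1))) *\<^sub>R a) (at 1)"
    by (auto intro!: derivative_eq_intros simp: has_real_derivative_iff_has_vector_derivative[symmetric])
  \<comment> \<open>The formula for \<open>vector_derivative\<close> holds for t > 0, hence the
    transfer on an open half-line.\<close>
  then have "((\<lambda>t. vector_derivative \<alpha> (at t)) has_vector_derivative (s * ((s - 1) * 1 powr (s - 1 - 1))) *\<^sub>R a) (at 1)"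
    by (rule has_vector_derivative_transform_within_open[where S = "{0<..}"])
      (auto simp: vector_derivative_at[OF da])
  then have "B = (s * (s - 1)) *\<^sub>R a" using vector_derivative_unique_at[OF B(1)] by simp
  moreover have "B $ i = force lam p (\<alpha> 1) $ i" for i
    using B(2)[of i] lam[of i] unfolding nbody_force_eq by simp
  then have "B = force lam p a" by (simp add: vec_eq_iff \<alpha>_def)
  moreover have "s * (s - 1) = - (2 * (p / (p + 2)\<^sup>2))"
    using p by (simp add: s_def power2_eq_square field_simps)
  ultimately show ?thesis by simp
qed

lemma force_scaleR:
  assumes "0 < k" shows "force lam p (k *\<^sub>R \<alpha>) = k powr - (p + 1) *\<^sub>R force lam p \<alpha>"
proof -
  have k: "k powr - (p + 2) * k = k powr - (p + 1)"
  proof -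
    have "k powr - (p + 2) * k = k powr - (p + 2) * k powr 1" using assms by simp
    moreover have "- (p + 2) + 1 = - (p + 1)" by simp
    ultimately show ?thesis by (simp only: powr_add[symmetric])
  qed
  have "(lam j * norm ((k *\<^sub>R \<alpha>) $ i - (k *\<^sub>R \<alpha>) $ j) powr - (p + 2)) *\<^sub>R ((k *\<^sub>R \<alpha>) $ i - (k *\<^sub>R \<alpha>) $ j) =
      k powr - (p + 1) *\<^sub>R ((lam j * norm (\<alpha> $ i - \<alpha> $ j) powr - (p + 2)) *\<^sub>R (\<alpha> $ i - \<alpha> $ j))" for i j
  proof -
    define D where "D = \<alpha> $ i - \<alpha> $ j"
    have "(k *\<^sub>R \<alpha>) $ i - (k *\<^sub>R \<alpha>) $ j = k *\<^sub>R D" by (simp add: D_def scaleR_diff_right)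
    moreover have "norm (k *\<^sub>R D) powr - (p + 2) = k powr - (p + 2) * norm D powr - (p + 2)"
      using assms by (simp only: norm_scaleR powr_mult abs_of_pos)
    moreover have "(lam j * (K * N)) *\<^sub>R (k *\<^sub>R D) = (K * k) *\<^sub>R ((lam j * N) *\<^sub>R D)" for K N
      by (simp add: mult_ac)
    ultimately show ?thesis by (simp only: k D_def[symmetric])
  qed
  then show ?thesis
    unfolding force_def by (simp only: scaleR_sum_right[symmetric]) (simp add: vec_eq_iff)
qed

text \<open>There are finitely many components, so one ball and one constant can be extracted from
  the filter statements. In the difference the values at 0 cancel and the linear parts combine to l
  (u - v).\<close>

lemma quad_deriv_remainder_lipschitz:
  fixes g l :: "'k::finite \<Rightarrow> 'a::real_normed_vector \<Rightarrow> real"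
  assumes "\<And>k. quad_deriv (g k) (l k)"
  obtains r C where "0 < r" "0 \<le> C"
    "\<And>u v. norm u \<le> r \<Longrightarrow> norm v \<le> r \<Longrightarrow>
      norm ((\<chi> k. g k u - g k 0 - l k u) - (\<chi> k. g k v - g k 0 - l k v)) \<le> C * (norm u + norm v) * norm (u - v)"
proof -
  let ?le = "\<lambda>c k x. norm (g k (fst x) - g k (snd x) - l k (fst x - snd x)) \<le>
      c * norm ((norm (fst x) + norm (snd x)) * norm (fst x - snd x))"
  have "\<exists>c. \<forall>\<^sub>F x in nhds (0, 0). ?le c k x" for k
  proof -
    have "(\<lambda>x. g k (fst x) - g k (snd x) - l k (fst x - snd x)) \<in> pair_order"
      using assms[of k] by (simp add: quad_deriv_def)
    then show ?thesis by (rule landau_o.bigE) blast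
  qed
  then have "\<exists>c. \<forall>k. \<forall>\<^sub>F x in nhds (0, 0). ?le (c k) k x" by (rule choice[OF allI])
  then obtain c where c: "\<And>k. \<forall>\<^sub>F x in nhds (0, 0). ?le (c k) k x" by blast
  then have "\<forall>\<^sub>F x in nhds 0 \<times>\<^sub>F nhds 0. \<forall>k. ?le (c k) k x"
    unfolding nhds_prod by (rule eventually_all_finite)
  then obtain P Q where PQ: "eventually P (nhds 0)" "eventually Q (nhds 0)"
    "\<And>u v k. P u \<Longrightarrow> Q v \<Longrightarrow> norm (g k u - g k v - l k (u - v)) \<le> c k * norm ((norm u + norm v) * norm (u - v))"
    unfolding eventually_prod_filter fst_conv snd_conv by blast
  then obtain d where d: "0 < d" "\<And>u. norm u < d \<Longrightarrow> P u \<and> Q u"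
    using eventually_conj[OF PQ(1,2)] unfolding eventually_nhds_metric by auto
  show ?thesis
  proof (rule that[of "d / 2" "\<Sum>k\<in>UNIV. \<bar>c k\<bar>"])
    fix u v :: 'a assume uv: "norm u \<le> d / 2" "norm v \<le> d / 2"
    let ?D = "(\<chi> k. g k u - g k 0 - l k u) - (\<chi> k. g k v - g k 0 - l k v)"
    have "norm ?D \<le> (\<Sum>k\<in>UNIV. \<bar>?D $ k\<bar>)" by (rule norm_le_l1_cart)
    also have "\<dots> \<le> (\<Sum>k\<in>UNIV. \<bar>c k\<bar> * ((norm u + norm v) * norm (u - v)))"
    proof (rule sum_mono)
      fix k
      have "?D $ k = g k u - g k v - l k (u - v)"
        using assms[of k] by (simp add: quad_deriv_def linear_diff[OF bounded_linear.linear])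
      then have "\<bar>?D $ k\<bar> \<le> c k * norm ((norm u + norm v) * norm (u - v))"
        using PQ(3)[of u v k] d uv by simp
      also have "\<dots> \<le> \<bar>c k\<bar> * ((norm u + norm v) * norm (u - v))"
        by (simp add: abs_mult mult_right_mono)
      finally show "\<bar>?D $ k\<bar> \<le> \<bar>c k\<bar> * ((norm u + norm v) * norm (u - v))" .
    qed
    also have "\<dots> = (\<Sum>k\<in>UNIV. \<bar>c k\<bar>) * (norm u + norm v) * norm (u - v)"
      by (simp add: sum_distrib_right mult.assoc)
    finally show "norm ?D \<le> (\<Sum>k\<in>UNIV. \<bar>c k\<bar>) * (norm u + norm v) * norm (u - v)" .
  qed (use d in \<open>auto intro: sum_nonneg\<close>)
qed

section \<open>Return from logarithmic time to power-logarithm sums and little-o rates\<close>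

lemma powlog_space_zero: "(\<lambda>_. 0) \<in> powlog_space c"
  unfolding powlog_space_def by (auto intro!: exI[of _ 0])

lemma powlog_space_add:
  assumes "f \<in> powlog_space c" "g \<in> powlog_space c" shows "(\<lambda>t. f t + g t) \<in> powlog_space c"
proof -
  obtain m y q k where f: "\<forall>i\<in>{1..m::nat}. q i \<le> c" "\<forall>t>0. f t = (\<Sum>i=1..m. (t powr q i * ln t ^ k i) *\<^sub>R y i)"
    using assms(1) unfolding powlog_space_def by blast
  obtain m' y' q' k' where g: "\<forall>i\<in>{1..m'::nat}. q' i \<le> c" "\<forall>t>0. g t = (\<Sum>i=1..m'. (t powr q' i * ln t ^ k' i) *\<^sub>R y' i)"
    using assms(2) unfolding powlog_space_def by blast
  \<comment> \<open>Concatenates the two families; indices start at 1, so the second one occupies m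
    + 1 to m + m'.\<close>
  define Q K Y where "Q i = (if i \<le> m then q i else q' (i - m))" and "K i = (if i \<le> m then k i else k' (i - m))"
    and "Y i = (if i \<le> m then y i else y' (i - m))" for i
  have "(\<Sum>i=1..m+m'. (t powr Q i * ln t ^ K i) *\<^sub>R Y i) = f t + g t" if "0 < t" for t
  proof -
    have "{1..m+m'} = {1..m} \<union> {m+1..m+m'}" by auto
    then have "(\<Sum>i=1..m+m'. (t powr Q i * ln t ^ K i) *\<^sub>R Y i) =
      (\<Sum>i=1..m. (t powr Q i * ln t ^ K i) *\<^sub>R Y i) + (\<Sum>i=m+1..m+m'. (t powr Q i * ln t ^ K i) *\<^sub>R Y i)"
      by (simp only:) (rule sum.union_disjoint, auto)
    also have "(\<Sum>i=1..m. (t powr Q i * ln t ^ K i) *\<^sub>R Y i) = f t"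
      using f(2) that by (auto simp: Q_def K_def Y_def intro!: sum.cong)
    also have "(\<Sum>i=m+1..m+m'. (t powr Q i * ln t ^ K i) *\<^sub>R Y i) = (\<Sum>i=1..m'. (t powr Q (i + m) * ln t ^ K (i + m)) *\<^sub>R Y (i + m))"
      using sum.shift_bounds_cl_nat_ivl[of "\<lambda>i. (t powr Q i * ln t ^ K i) *\<^sub>R Y i" 1 m m'] by (simp add: add.commute)
    also have "\<dots> = g t"
      using g(2) that by (auto simp: Q_def K_def Y_def intro!: sum.cong)
    finally show ?thesis .
  qed
  moreover have "Q i \<le> c" if "i \<in> {1..m+m'}" for i
  proof (cases "i \<le> m")
    case True
    then show ?thesis using f(1) that by (simp add: Q_def)
  next
    case False
    then have "i - m \<in> {1..m'}" using that by auto
    then show ?thesis using g(1) False by (simp add: Q_def)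
  qed
  ultimately show ?thesis
    unfolding powlog_space_def mem_Collect_eq by (intro exI[of _ "m + m'"] exI[of _ Y] exI[of _ Q] exI[of _ K]) auto
qed

lemma powlog_space_sum:
  "(\<And>i. i \<in> A \<Longrightarrow> f i \<in> powlog_space c) \<Longrightarrow> (\<lambda>t. \<Sum>i\<in>A. f i t) \<in> powlog_space c"
  by (induction A rule: infinite_finite_induct) (auto intro: powlog_space_zero powlog_space_add)

lemma exp_poly_powlog_space:
  "exp_poly c E \<Longrightarrow> (\<lambda>t. (t powr s * E (ln t)) *\<^sub>R v) \<in> powlog_space (s + c)"
proof (induction rule: exp_poly.induct)
  case (monomial q A k)
  have "t powr s * exp (q * ln t) = t powr (s + q)" if "0 < t" for t
    using that by (simp add: powr_def exp_add[symmetric] algebra_simps)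
  then have "\<forall>t>0. (t powr s * (A * (exp (q * ln t) * ln t ^ k))) *\<^sub>R v = (\<Sum>i=1..1::nat. (t powr (s + q) * ln t ^ k) *\<^sub>R (A *\<^sub>R v))"
    by (simp add: mult_ac)
  then show ?case unfolding powlog_space_def mem_Collect_eq using monomial
    by (intro exI[of _ 1] exI[of _ "\<lambda>_. A *\<^sub>R v"] exI[of _ "\<lambda>_. s + q"] exI[of _ "\<lambda>_. k"]) auto
next
  case (add f g)
  from powlog_space_add[OF add.IH] show ?case by (simp add: algebra_simps)
qed

lemma little_o_plus_add:
  "little_o_plus \<mu> f \<Longrightarrow> little_o_plus \<mu> g \<Longrightarrow> little_o_plus \<mu> (\<lambda>t. f t + g t)"
  unfolding little_o_plus_def by (auto simp: scaleR_add_right intro!: tendsto_add_zero)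

lemma little_o_plus_sum:
  "(\<And>i. i \<in> A \<Longrightarrow> little_o_plus \<mu> (f i)) \<Longrightarrow> little_o_plus \<mu> (\<lambda>t. \<Sum>i\<in>A. f i t)"
  by (induction A rule: infinite_finite_induct) (auto intro: little_o_plus_add simp: little_o_plus_def[of _ "\<lambda>_. 0"])

lemma little_o_plus_cong:
  assumes "little_o_plus \<mu> g" "\<And>t. 0 < t \<Longrightarrow> f t = g t" shows "little_o_plus \<mu> f"
  unfolding little_o_plus_def
proof (intro allI impI)
  fix \<epsilon> :: real assume "\<epsilon> > 0"
  then have "((\<lambda>t. g t /\<^sub>R (t powr (\<mu> + \<epsilon>))) \<longlongrightarrow> 0) at_top" using assms(1) by (simp add: little_o_plus_def)
  then show "((\<lambda>t. f t /\<^sub>R (t powr (\<mu> + \<epsilon>))) \<longlongrightarrow> 0) at_top"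
  proof (rule Lim_transform_eventually)
    show "\<forall>\<^sub>F t in at_top. g t /\<^sub>R (t powr (\<mu> + \<epsilon>)) = f t /\<^sub>R (t powr (\<mu> + \<epsilon>))"
      using eventually_gt_at_top[of "0 :: real"] by eventually_elim (simp add: assms(2))
  qed
qed

lemma ebound_little_o_plus:
  assumes "ebound r g" shows "little_o_plus (s + r) (\<lambda>t. (t powr s * g (ln t)) *\<^sub>R v)"
  unfolding little_o_plus_def
proof (intro allI impI)
  fix e :: real assume "e > 0"
  have "((\<lambda>x. g x * exp (- (r + e) * x)) \<longlongrightarrow> 0) at_top" by (intro ebound_tendsto_0[OF assms]) (use \<open>e > 0\<close> in simp)
  from filterlim_compose[OF this ln_at_top]
  have "((\<lambda>t. (g (ln t) * exp (- (r + e) * ln t)) *\<^sub>R v) \<longlongrightarrow> 0 *\<^sub>R v) at_top" by (intro tendsto_scaleR tendsto_const)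
  then have "((\<lambda>t. (g (ln t) * exp (- (r + e) * ln t)) *\<^sub>R v) \<longlongrightarrow> 0) at_top" by simp
  then show "((\<lambda>t. ((t powr s * g (ln t)) *\<^sub>R v) /\<^sub>R (t powr (s + r + e))) \<longlongrightarrow> 0) at_top"
  proof (rule Lim_transform_eventually)
    show "\<forall>\<^sub>F t in at_top. (g (ln t) * exp (- (r + e) * ln t)) *\<^sub>R v = ((t powr s * g (ln t)) *\<^sub>R v) /\<^sub>R (t powr (s + r + e))"
      using eventually_gt_at_top[of 0]
    proof eventually_elim
      case (elim t)
      have "inverse (t powr (s + r + e)) * t powr s = exp (- (r + e) * ln t)"
        using elim by (simp add: powr_def exp_minus[symmetric] exp_add[symmetric] algebra_simps)
      then show ?case by (simp add: mult_ac)
    qed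
  qed
qed



lemma DERIV_scaleR_const:
  "(f has_real_derivative f') (at x) \<Longrightarrow> ((\<lambda>x. f x *\<^sub>R v) has_vector_derivative f' *\<^sub>R v) (at x)"
  using has_vector_derivative_scaleR[OF _ has_vector_derivative_const, of f f' x UNIV v] by simp

text \<open>With D = d/d(ln t), the second derivative of t^s v(ln t) is t^(s-2) (D^2 + (2s-1) D +
  s(s-1)) v, and homogeneity gives the force the same factor. The conditions \<open>roots\<close>
  say that (D - nu k)(D - om k) is this operator minus \<mu> k.\<close>

lemma ansatz_solution:
  fixes b :: "'k::finite \<Rightarrow> real^'d^'n" and y z :: "real \<Rightarrow> real^'k" and R :: "real^'k \<Rightarrow> real^'k"
    and nu om \<mu> :: "'k \<Rightarrow> real"
  defines "u \<equiv> \<lambda>x. \<Sum>k\<in>UNIV. y x $ k *\<^sub>R b k"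
    and "w \<equiv> \<lambda>x. \<Sum>k\<in>UNIV. (nu k * y x $ k + z x $ k) *\<^sub>R b k"
  assumes s: "s * (p + 2) = 2"
    and roots: "\<And>k. nu k + om k = 1 - 2 * s" "\<And>k. nu k * om k = s * (s - 1) - \<mu> k"
    and y: "\<And>k x. T < x \<Longrightarrow> ((\<lambda>x. y x $ k) has_real_derivative nu k * y x $ k + z x $ k) (at x)"
    and z: "\<And>k x. T < x \<Longrightarrow> ((\<lambda>x. z x $ k) has_real_derivative om k * z x $ k + R (y x) $ k) (at x)"
    and nc: "\<And>x. T < x \<Longrightarrow> a + u x \<in> noncollision"
    and force: "\<And>x. T < x \<Longrightarrow> force lam p (a + u x) =
      (s * (s - 1)) *\<^sub>R a + (\<Sum>k\<in>UNIV. (\<mu> k * y x $ k + R (y x) $ k) *\<^sub>R b k)"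
  shows "nbody_solution lam p (exp T)
    (\<lambda>t. (t powr s *\<^sub>R (a + u (ln t)), t powr (s - 1) *\<^sub>R (s *\<^sub>R (a + u (ln t)) + w (ln t))))"
proof -
  define \<alpha> \<beta> where "\<alpha> t = t powr s *\<^sub>R (a + u (ln t))" and "\<beta> t = t powr (s - 1) *\<^sub>R (s *\<^sub>R (a + u (ln t)) + w (ln t))" for t
  \<comment> \<open>The second derivative of u, written out with the two first-order
    equations.\<close>
  define w' where "w' x = (\<Sum>k\<in>UNIV. (nu k * (nu k * y x $ k + z x $ k) + (om k * z x $ k + R (y x) $ k)) *\<^sub>R b k)" for x
  have du: "(u has_vector_derivative w x) (at x)" if "T < x" for x
    unfolding u_def w_def by (intro has_vector_derivative_sum DERIV_scaleR_const y that)
  have dw: "(w has_vector_derivative w' x) (at x)" if "T < x" for x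
    unfolding w_def w'_def
    by (intro has_vector_derivative_sum DERIV_scaleR_const DERIV_add DERIV_cmult y z that)
  show ?thesis
    unfolding nbody_solution_def fst_conv snd_conv \<alpha>_def[symmetric] \<beta>_def[symmetric]
  proof (intro allI impI conjI)
    fix t assume t: "exp T < t"
    then have t0: "0 < t" using exp_gt_zero[of T] by linarith
    have "exp T < exp (ln t)" using t t0 by simp
    then have lnt: "T < ln t" by (simp only: exp_less_cancel_iff)
    show "\<alpha> t \<in> noncollision"
      using nc[OF lnt] t0 by (auto simp: noncollision_def \<alpha>_def)
    have dln: "(ln has_vector_derivative 1 / t) (at t)"
      using DERIV_ln_divide[OF t0] by (simp add: has_real_derivative_iff_has_vector_derivative)
    have dul: "((\<lambda>t. u (ln t)) has_vector_derivative (1 / t) *\<^sub>R w (ln t)) (at t)"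
      using vector_diff_chain_at[OF dln du[OF lnt]] by (simp add: o_def)
    have dwl: "((\<lambda>t. w (ln t)) has_vector_derivative (1 / t) *\<^sub>R w' (ln t)) (at t)"
      using vector_diff_chain_at[OF dln dw[OF lnt]] by (simp add: o_def)
    have dpow: "((\<lambda>t. t powr e) has_real_derivative e * t powr (e - 1)) (at t)" for e
      using t0 by (auto intro!: derivative_eq_intros)
    have tp: "t powr e * (1 / t) = t powr (e - 1)" for e
      using t0 by (simp add: powr_diff)
    have "(\<alpha> has_vector_derivative
        t powr s *\<^sub>R (0 + (1 / t) *\<^sub>R w (ln t)) + (s * t powr (s - 1)) *\<^sub>R (a + u (ln t))) (at t)"
      unfolding \<alpha>_def[abs_def]
      by (intro has_vector_derivative_scaleR dpow has_vector_derivative_add has_vector_derivative_const dul)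
    moreover have "t powr s *\<^sub>R (0 + (1 / t) *\<^sub>R w (ln t)) + (s * t powr (s - 1)) *\<^sub>R (a + u (ln t)) = \<beta> t"
      unfolding \<beta>_def by (simp only: add_0 scaleR_scaleR tp scaleR_add_right) (simp add: mult.commute add_ac)
    ultimately have dA: "(\<alpha> has_vector_derivative \<beta> t) (at t)" by simp
    have "(\<beta> has_vector_derivative
        t powr (s - 1) *\<^sub>R (s *\<^sub>R (0 + (1 / t) *\<^sub>R w (ln t)) + (1 / t) *\<^sub>R w' (ln t)) +
        ((s - 1) * t powr (s - 1 - 1)) *\<^sub>R (s *\<^sub>R (a + u (ln t)) + w (ln t))) (at t)"
      unfolding \<beta>_def[abs_def]
      by (intro has_vector_derivative_scaleR dpow has_vector_derivative_add has_vector_derivative_const dul dwl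
          bounded_linear.has_vector_derivative[OF bounded_linear_scaleR_right])
    moreover have "t powr (s - 1) *\<^sub>R (s *\<^sub>R (0 + (1 / t) *\<^sub>R w (ln t)) + (1 / t) *\<^sub>R w' (ln t)) +
        ((s - 1) * t powr (s - 1 - 1)) *\<^sub>R (s *\<^sub>R (a + u (ln t)) + w (ln t)) =
        force lam p (\<alpha> t)"
    proof -
      define x where "x = ln t"
      have "w' x + (2 * s - 1) *\<^sub>R w x + (s * (s - 1)) *\<^sub>R u x = (\<Sum>k\<in>UNIV. (\<mu> k * y x $ k + R (y x) $ k) *\<^sub>R b k)"
        unfolding w'_def w_def u_def scaleR_sum_right sum.distrib[symmetric] scaleR_scaleR scaleR_add_left[symmetric]
      proof (intro sum.cong refl arg_cong2[where f = scaleR])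
        fix k
        have om: "om k = 1 - 2 * s - nu k" using roots(1)[of k] by simp
        have "nu k * (1 - 2 * s - nu k) = s * (s - 1) - \<mu> k" using roots(2)[of k] unfolding om .
        then have mu: "\<mu> k = s * (s - 1) - nu k * (1 - 2 * s - nu k)" by simp
        show "nu k * (nu k * y x $ k + z x $ k) + (om k * z x $ k + R (y x) $ k) +
          (2 * s - 1) * (nu k * y x $ k + z x $ k) + s * (s - 1) * y x $ k = \<mu> k * y x $ k + R (y x) $ k"
          unfolding om mu by (simp add: algebra_simps)
      qed
      then have F: "force lam p (a + u x) = (s * (s - 1)) *\<^sub>R (a + u x) + (2 * s - 1) *\<^sub>R w x + w' x"
        using force[OF lnt] by (simp add: x_def scaleR_add_right add_ac)
      \<comment> \<open>The relation s(p + 2) = 2 enters as -s(p + 1) = s - 2.\<close>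
      have "(t powr s) powr - (p + 1) = t powr (s - 2)"
      proof -
        have "s * - (p + 1) = s - 2" using s by (simp add: algebra_simps)
        then show ?thesis by (simp only: powr_powr)
      qed
      then have "force lam p (t powr s *\<^sub>R (a + u x)) = t powr (s - 2) *\<^sub>R force lam p (a + u x)"
        using t0 by (simp add: force_scaleR)
      moreover have "s - 1 - 1 = s - 2" by simp
      moreover have "t powr (s - 1) *\<^sub>R (s *\<^sub>R (0 + (1 / t) *\<^sub>R W) + (1 / t) *\<^sub>R W') =
        t powr (s - 2) *\<^sub>R (s *\<^sub>R W + W')" for W W' :: "real^'d^'n"
      proof -
        have "s *\<^sub>R (0 + (1 / t) *\<^sub>R W) + (1 / t) *\<^sub>R W' = (1 / t) *\<^sub>R (s *\<^sub>R W + W')"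
          by (simp add: scaleR_add_right)
        then show ?thesis using tp[of "s - 1"] by simp
      qed
      moreover have "t powr (s - 2) *\<^sub>R (s *\<^sub>R W + W') + ((s - 1) * t powr (s - 2)) *\<^sub>R (s *\<^sub>R V + W) =
        t powr (s - 2) *\<^sub>R ((s * (s - 1)) *\<^sub>R V + (2 * s - 1) *\<^sub>R W + W')" for V W W' :: "real^'d^'n"
      proof -
        have "(2 * s - 1) *\<^sub>R W = s *\<^sub>R W + (s - 1) *\<^sub>R W" by (simp add: scaleR_add_left[symmetric])
        then show ?thesis by (simp only: scaleR_add_right scaleR_scaleR) (simp add: mult_ac add_ac)
      qed
      ultimately show ?thesis unfolding \<alpha>_def x_def[symmetric] by (simp only: F)
    qed
    ultimately have dB: "(\<beta> has_vector_derivative force lam p (\<alpha> t)) (at t)" by simp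
    show "\<exists>A B. (\<alpha> has_vector_derivative A) (at t) \<and> (\<beta> has_vector_derivative B) (at t) \<and>
        (\<forall>i. A $ i = \<beta> t $ i \<and>
          lam i *\<^sub>R (B $ i) = - (\<Sum>j\<in>UNIV - {i}.
            (lam i * lam j / norm (\<alpha> t $ i - \<alpha> t $ j) powr (p + 2)) *\<^sub>R (\<alpha> t $ i - \<alpha> t $ j)))"
      unfolding nbody_force_eq using dA dB by blast
  qed
qed

theorem theorem2:
  fixes lam :: "'n::{finite,linorder} \<Rightarrow> real"
    and p :: real
    and a :: "real^'d^('n::{finite,linorder})"
  assumes "CARD('n) \<ge> 2"
    and "\<forall>i. lam i > 0"
    and "0 < p" and "p < 2"
    and "normal_config lam p a"
  shows "\<exists>(b :: 'n \<times> 'd::finite \<Rightarrow> real^'d^('n::{finite,linorder})) (q :: 'n \<times> 'd \<Rightarrow> real).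
    indexed_basis b \<and> (\<forall>k. q k \<le> p / (p + 2)) \<and>
    (\<exists>P :: real^'d^('n::{finite,linorder}) \<Rightarrow> real \<Rightarrow> (real^'d^('n::{finite,linorder})) \<times> (real^'d^('n::{finite,linorder})).
      (\<forall>x. \<exists>\<delta>>0. \<exists>T0>0. \<exists>f\<in>powlog_space ((2 * p - 2) / (p + 2)).
         nbody_solution lam p T0 (P x) \<and>
         little_o_plus (- \<delta>) (\<lambda>t. fst (P x t) - (leading_part p a b q x t + f t))) \<and>
      (\<forall>x y. x \<noteq> y \<longrightarrow> \<not> (\<forall>\<^sub>F t in at_top. P x t = P y t)) \<and>
      (p < 1 \<longrightarrow>
        (\<forall>x. little_o_plus (- ((2 - 2 * p) / (p + 2)))
               (\<lambda>t. fst (P x t) - leading_part p a b q x t))))"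
proof -
  note lam = assms(2)[rule_format] and p = assms(3,4)
  have min: "minimal_config lam p a" using assms(5) by (simp add: normal_config_def)
  then have a: "a \<in> noncollision" by (simp add: minimal_config_def)
  \<comment> \<open>Chosen so that 2c = s(1 - s), the multiplier in the equation of central
    configurations.\<close>
  define c where "c = p / (p + 2)\<^sup>2"
  have crit: "force lam p a = - (2 * c) *\<^sub>R a"
    unfolding c_def by (rule normal_config_force[OF assms(5) lam p(1)])
  obtain b :: "'n \<times> 'd \<Rightarrow> (real^'d, 'n) vec" and \<mu> :: "'n \<times> 'd \<Rightarrow> real"
    and cf :: "'n \<times> 'd \<Rightarrow> (real^'d, 'n) vec \<Rightarrow> real" where
    eigen: "\<And>k. force_deriv lam p a (b k) = \<mu> k *\<^sub>R b k" and cf: "\<And>k. bounded_linear (cf k)"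
    and expand: "\<And>u. u = (\<Sum>k\<in>UNIV. cf k u *\<^sub>R b k)"
    and dual: "\<And>k l. cf k (b l) = (if k = l then 1 else 0)"
    and unit: "\<And>k. mass_inner lam (b k) (b k) = 1"
    by (rule force_deriv_eigenbasis[where lam = lam and p = p and a = a, OF lam]) (rule that)
  interpret M: linear "force_deriv lam p a" by (rule force_deriv_linear)

  define s \<eta> where "s = 2 / (p + 2)" and "\<eta> = (2 - p) / (p + 2)"
  have s: "0 < s" "s * (p + 2) = 2" "s * (s - 1) = - (2 * c)"
  proof -
    show "0 < s" using p by (simp add: s_def)
    have "p + 2 \<noteq> 0" using p by simp
    from nonzero_eq_divide_eq[OF this, of s 2] show "s * (p + 2) = 2" by (simp add: s_def)
    have "s - 1 = - p / (p + 2)" using p by (simp add: s_def field_simps)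
    then show "s * (s - 1) = - (2 * c)" by (simp add: s_def c_def power2_eq_square)
  qed
  have eta: "0 < \<eta>" "(1 - \<eta>) / 2 = p / (p + 2)" "(1 + \<eta>) / 2 = s" "p / (p + 2) - s = - \<eta>"
    "s - 2 * \<eta> = (2 * p - 2) / (p + 2)" "1 - 8 * c = \<eta>\<^sup>2"
  proof -
    show "0 < \<eta>" using p by (simp add: \<eta>_def)
    show "(1 - \<eta>) / 2 = p / (p + 2)" using p by (simp add: \<eta>_def field_simps)
    show "(1 + \<eta>) / 2 = s" using p by (simp add: \<eta>_def s_def field_simps)
    show "p / (p + 2) - s = - \<eta>" using p by (simp add: \<eta>_def s_def diff_divide_distrib)
    show "s - 2 * \<eta> = (2 * p - 2) / (p + 2)" using p by (simp add: \<eta>_def s_def diff_divide_distrib)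
    show "1 - 8 * c = \<eta>\<^sup>2"
      using p by (simp add: \<eta>_def c_def power_divide diff_divide_eq_iff) (simp add: power2_eq_square algebra_simps)
  qed
  \<comment> \<open>The second variation inequality, tested on a unit eigenvector.\<close>
  have mu: "- (2 * c) \<le> \<mu> k" for k
  proof -
    have "mass_inner lam (\<mu> k *\<^sub>R b k) (b k) = \<mu> k * mass_inner lam (b k) (b k)"
      by (simp add: mass_inner_def sum_distrib_left mult_ac)
    with minimal_config_hessian[where lam = lam, OF lam p(1) min assms(1) crit, of "b k"] show ?thesis
      by (simp add: eigen unit)
  qed
  \<comment> \<open>The root of the discriminant of q(q - 1) = \<mu> k. The lower bound on \<mu> k
    and 1 - 8c = \<eta>^2 make the discriminant at least \<eta>^2.\<close>
  define sq where "sq k = sqrt (1 + 4 * \<mu> k)" for k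
  have sq: "\<eta> \<le> sq k" "sq k * sq k = 1 + 4 * \<mu> k" for k
  proof -
    have "\<eta>\<^sup>2 \<le> 1 + 4 * \<mu> k" using mu[of k] eta(6) by linarith
    then show "\<eta> \<le> sq k" unfolding sq_def by (rule real_le_rsqrt)
    have "0 \<le> 1 + 4 * \<mu> k" using \<open>\<eta>\<^sup>2 \<le> 1 + 4 * \<mu> k\<close> by (rule order_trans[rotated]) simp
    then show "sq k * sq k = 1 + 4 * \<mu> k" by (simp add: sq_def)
  qed
  \<comment> \<open>The smaller root is the exponent of the perturbation; nu and om are the two
    roots relative to the leading power s.\<close>
  define q where "q k = (1 - sq k) / 2" for k
  define nu where "nu k = q k - s" for k
  define om where "om k = (1 + sq k) / 2 - s" for k
  have q_le: "q k \<le> p / (p + 2)" for k using sq(1)[of k] eta(2) by (simp add: q_def)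
  have nu: "nu k \<le> - \<eta>" for k using q_le[of k] eta(4) unfolding nu_def by linarith
  have om: "0 \<le> om k" for k using sq(1)[of k] by (simp add: om_def eta(3)[symmetric])
  have roots: "nu k + om k = 1 - 2 * s" "nu k * om k = s * (s - 1) - \<mu> k" for k
  proof -
    show "nu k + om k = 1 - 2 * s" by (simp add: nu_def om_def q_def field_simps)
    have "nu k * om k = (1 - sq k * sq k) / 4 + s * (s - 1)"
      by (simp add: nu_def om_def q_def field_simps)
    then show "nu k * om k = s * (s - 1) - \<mu> k" by (simp add: sq(2))
  qed

  define emb where "emb y = (\<Sum>k\<in>UNIV. y $ k *\<^sub>R b k)" for y :: "real^('n \<times> 'd)"
  have emb: "bounded_linear emb"
    unfolding emb_def
    by (intro bounded_linear_sum bounded_linear_compose[OF bounded_linear_scaleR_left bounded_linear_vec_nth])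
  have cf_emb: "cf k (emb y) = y $ k" for k y
  proof -
    interpret cf: bounded_linear "cf k" by (rule cf)
    show ?thesis unfolding emb_def cf.sum cf.scaleR dual by (simp add: if_distrib cong: if_cong)
  qed
  have emb0: "emb 0 = 0" by (simp add: emb_def)
  define g where "g k y = cf k (force lam p (a + emb y))" for k y
  define l where "l k y = cf k (force_deriv lam p a (emb y))" for k y
  have gl: "quad_deriv (g k) (l k)" and g_approx: "poly_approx (g k)" for k
    unfolding g_def l_def by (rule force_quad_deriv[OF a emb cf] force_poly_approx[OF a emb cf])+
  define R where "R y = (\<chi> k. g k y - g k 0 - l k y)" for y
  obtain r0 C where r0: "0 < r0" "0 \<le> C" "\<And>u v. norm u \<le> r0 \<Longrightarrow> norm v \<le> r0 \<Longrightarrow>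
      norm (R u - R v) \<le> C * (norm u + norm v) * norm (u - v)"
    by (rule quad_deriv_remainder_lipschitz[where g = g and l = l, OF gl, folded R_def]) (rule that)
  have "(emb \<longlongrightarrow> 0) (nhds 0)"
    using bounded_linear.tendsto[OF emb filterlim_ident[of "nhds 0"]] by (simp add: emb0)
  from noncollision_neighborhood[OF a this] obtain r1 where r1: "0 < r1"
    "\<And>y. norm y < r1 \<Longrightarrow> a + emb y \<in> noncollision"
    unfolding eventually_nhds_metric by auto
  \<comment> \<open>Half of r1, so that a closed ball fits into the open ball of
    noncollision.\<close>
  define r where "r = min r0 (r1 / 2)"
  have r: "0 < r" "r \<le> r0" "r < r1" using r0 r1 by (auto simp: r_def)
  have "l k 0 = 0" for k
    using gl[of k] by (intro linear_0 bounded_linear.linear) (simp add: quad_deriv_def)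
  then have R0: "R 0 = 0" by (simp add: R_def vec_eq_iff)
  interpret expandable_system nu om R \<eta> r C
  proof
    show "norm (R u - R v) \<le> C * (norm u + norm v) * norm (u - v)" if "norm u \<le> r" "norm v \<le> r" for u v
      using that r(2) by (intro r0(3)) linarith+
    show "\<exists>Q. poly_order 2 Q \<and> (\<lambda>u. R u $ k - Q u) \<in> norm_order m" for m k
    proof -
      have m2: "2 \<le> max 2 m" by simp
      obtain Q where Q: "poly_order 2 Q" "(\<lambda>u. g k u - g k 0 - l k u - Q u) \<in> norm_order (max 2 m)"
        by (rule quad_remainder_poly[OF g_approx[of k] gl[of k] m2]) (rule that)
      have "(\<lambda>u. g k u - g k 0 - l k u - Q u) \<in> norm_order m"
        by (rule landau_o.big_trans[OF Q(2) norm_power_bigo_weaken]) simp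
      with Q(1) show ?thesis unfolding R_def vec_lambda_beta by blast
    qed
  qed (fact eta(1) r(1) r0(2) nu om R0)+
  obtain T Y Z where sol: "\<And>x. solution (T x) (Y x) (Z x)"
    and asym: "\<And>x n. \<exists>E. \<forall>k. exp_poly (- 2 * \<eta>) (E k) \<and>
      ebound (- (real n + 1) * \<eta>) (\<lambda>t. Y x t $ k - x $ k * exp (nu k * t) - E k t)"
    and inj: "\<And>x x'. \<forall>\<^sub>F t in at_top. Y x t = Y x' t \<Longrightarrow> x = x'"
    using solution_family by blast

  \<comment> \<open>The parameter x as one vector indexed by pairs, matching the index set of the
    eigenbasis.\<close>
  define flat where "flat x = (\<chi> k. x $ fst k $ snd k)" for x :: "(real^'d, 'n) vec"
  define u where "u x t = (\<Sum>k\<in>UNIV. Y (flat x) t $ k *\<^sub>R b k)" for x t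
  define w where "w x t = (\<Sum>k\<in>UNIV. (nu k * Y (flat x) t $ k + Z (flat x) t $ k) *\<^sub>R b k)" for x t
  define P where "P x = (\<lambda>t. (t powr s *\<^sub>R (a + u x (ln t)),
    t powr (s - 1) *\<^sub>R (s *\<^sub>R (a + u x (ln t)) + w x (ln t))))" for x

  have P_sol: "nbody_solution lam p (exp (T (flat x))) (P x)" for x
    unfolding P_def u_def w_def
  proof (rule ansatz_solution[OF s(2) roots])
    let ?y = "Y (flat x)" and ?T = "T (flat x)"
    show "((\<lambda>t. ?y t $ k) has_real_derivative nu k * ?y t $ k + Z (flat x) t $ k) (at t)"
      "((\<lambda>t. Z (flat x) t $ k) has_real_derivative om k * Z (flat x) t $ k + R (?y t) $ k) (at t)"
      if "?T < t" for k t
      using sol[of "flat x"] that unfolding solution_def by blast+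
    have small: "norm (?y t) < r1" if "?T < t" for t
      using sol[of "flat x"] that r(3) unfolding solution_def by (meson less_imp_le order_le_less_trans)
    show "a + (\<Sum>k\<in>UNIV. ?y t $ k *\<^sub>R b k) \<in> noncollision" if "?T < t" for t
      using r1(2)[OF small[OF that]] by (simp add: emb_def)
    show "force lam p (a + (\<Sum>k\<in>UNIV. ?y t $ k *\<^sub>R b k)) =
      (s * (s - 1)) *\<^sub>R a + (\<Sum>k\<in>UNIV. (\<mu> k * ?y t $ k + R (?y t) $ k) *\<^sub>R b k)" for t
    proof -
      let ?F = "force lam p (a + emb (?y t))"
      have M: "force_deriv lam p a (emb (?y t)) = emb (\<chi> k. \<mu> k * ?y t $ k)"
        by (simp add: emb_def M.sum M.scaleR eigen mult.commute)
      have "cf k (?F - force lam p a) = \<mu> k * ?y t $ k + R (?y t) $ k" for k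
        using cf_emb[of k "\<chi> k. \<mu> k * ?y t $ k"]
        by (simp add: R_def g_def l_def emb0 M linear_diff[OF bounded_linear.linear[OF cf]])
      then have "?F - force lam p a = (\<Sum>k\<in>UNIV. (\<mu> k * ?y t $ k + R (?y t) $ k) *\<^sub>R b k)"
        using expand[of "?F - force lam p a"] by simp
      then show ?thesis unfolding emb_def crit s(3) by (simp add: algebra_simps)
    qed
  qed

  have diff: "fst (P x t) - leading_part p a b q x t =
      (\<Sum>k\<in>UNIV. (t powr s * (Y (flat x) (ln t) $ k - flat x $ k * exp (nu k * ln t))) *\<^sub>R b k)" if "0 < t" for x t
  proof -
    have "t powr s * exp (nu k * ln t) = t powr q k" for k
      using that by (simp add: powr_def nu_def exp_add[symmetric] algebra_simps)
    then have coef: "t powr s * (flat x $ k * exp (nu k * ln t)) = flat x $ k * t powr q k" for k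
      by (metis mult.left_commute)
    have "(\<Sum>(i, j)\<in>UNIV. (x $ i $ j * t powr q (i, j)) *\<^sub>R b (i, j)) =
        (\<Sum>k\<in>UNIV. (t powr s * (flat x $ k * exp (nu k * ln t))) *\<^sub>R b k)"
      unfolding coef by (simp add: flat_def case_prod_beta)
    then show ?thesis
      by (simp add: P_def leading_part_def s_def[symmetric] u_def scaleR_add_right scaleR_sum_right
        right_diff_distrib scaleR_diff_left sum_subtractf)
  qed
  \<comment> \<open>The order n is still free and f depends on it. A large n gives a decaying
    remainder, n = 1 the statement for p < 1.\<close>
  have remainder: "\<exists>f\<in>powlog_space ((2 * p - 2) / (p + 2)).
      little_o_plus (s - (real n + 1) * \<eta>) (\<lambda>t. fst (P x t) - (leading_part p a b q x t + f t)) \<and>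
      little_o_plus ((2 * p - 2) / (p + 2)) f" for x n
  proof -
    obtain E where E: "\<And>k. exp_poly (- 2 * \<eta>) (E k)"
      "\<And>k. ebound (- (real n + 1) * \<eta>) (\<lambda>t. Y (flat x) t $ k - flat x $ k * exp (nu k * t) - E k t)"
      using asym[where x = "flat x" and n = n] by blast
    define f where "f t = (\<Sum>k\<in>UNIV. (t powr s * E k (ln t)) *\<^sub>R b k)" for t
    have gamma: "s + (- 2 * \<eta>) = (2 * p - 2) / (p + 2)" using eta(5) by simp
    have "f \<in> powlog_space (s + (- 2 * \<eta>))"
      unfolding f_def[abs_def] by (intro powlog_space_sum exp_poly_powlog_space E)
    moreover have "little_o_plus (s + (- 2 * \<eta>)) f"
      unfolding f_def[abs_def] by (intro little_o_plus_sum ebound_little_o_plus exp_poly_ebound E)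
    moreover have "little_o_plus (s + - (real n + 1) * \<eta>) (\<lambda>t. fst (P x t) - (leading_part p a b q x t + f t))"
    proof (rule little_o_plus_cong)
      show "little_o_plus (s + - (real n + 1) * \<eta>) (\<lambda>t. \<Sum>k\<in>UNIV.
        (t powr s * (Y (flat x) (ln t) $ k - flat x $ k * exp (nu k * ln t) - E k (ln t))) *\<^sub>R b k)"
        by (intro little_o_plus_sum ebound_little_o_plus E)
      show "fst (P x t) - (leading_part p a b q x t + f t) = (\<Sum>k\<in>UNIV.
        (t powr s * (Y (flat x) (ln t) $ k - flat x $ k * exp (nu k * ln t) - E k (ln t))) *\<^sub>R b k)" if "0 < t" for t
        unfolding diff_diff_eq[symmetric] diff[OF that] f_def
        by (simp add: sum_subtractf[symmetric] right_diff_distrib scaleR_diff_left)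
    qed
    ultimately show ?thesis unfolding gamma by (intro bexI[of _ f] conjI) (simp_all add: algebra_simps)
  qed

  show ?thesis
  proof (intro exI[of _ b] exI[of _ q] exI[of _ P] conjI allI impI)
    show "indexed_basis b" by (rule dual_basis_indexed_basis[OF cf expand dual])
    show "q k \<le> p / (p + 2)" for k by (rule q_le)
    show "\<exists>\<delta>>0. \<exists>T0>0. \<exists>f\<in>powlog_space ((2 * p - 2) / (p + 2)). nbody_solution lam p T0 (P x) \<and>
         little_o_plus (- \<delta>) (\<lambda>t. fst (P x t) - (leading_part p a b q x t + f t))" for x
    proof -
      \<comment> \<open>Any n with (n + 1) \<eta> > s makes the remainder decay.\<close>
      obtain n :: nat where "s / \<eta> < real n" using reals_Archimedean2 by blast
      then have n: "0 < (real n + 1) * \<eta> - s" using eta(1) by (simp add: field_simps)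
      obtain f where "f \<in> powlog_space ((2 * p - 2) / (p + 2))"
        "little_o_plus (s - (real n + 1) * \<eta>) (\<lambda>t. fst (P x t) - (leading_part p a b q x t + f t))"
        using remainder[where x = x and n = n] by blast
      moreover have "s - (real n + 1) * \<eta> = - ((real n + 1) * \<eta> - s)" by simp
      ultimately have "\<exists>f\<in>powlog_space ((2 * p - 2) / (p + 2)). nbody_solution lam p (exp (T (flat x))) (P x) \<and>
          little_o_plus (- ((real n + 1) * \<eta> - s)) (\<lambda>t. fst (P x t) - (leading_part p a b q x t + f t))"
        using P_sol[of x] by (intro bexI[of _ f] conjI) (simp_all only:)
      with n exp_gt_zero[of "T (flat x)"] show ?thesis by blast
    qed
    show "\<not> (\<forall>\<^sub>F t in at_top. P x t = P y t)" if "x \<noteq> y" for x y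
    proof
      assume "\<forall>\<^sub>F t in at_top. P x t = P y t"
      \<comment> \<open>Back in logarithmic time, the position determines the coordinates y through
        the dual functionals.\<close>
      then have "\<forall>\<^sub>F t in at_top. P x (exp t) = P y (exp t)"
        by (rule eventually_compose_filterlim[OF _ exp_at_top])
      then have "\<forall>\<^sub>F t in at_top. Y (flat x) t = Y (flat y) t"
      proof eventually_elim
        case (elim t)
        then have "emb (Y (flat x) t) = emb (Y (flat y) t)" by (simp add: P_def u_def emb_def)
        then have "cf k (emb (Y (flat x) t)) = cf k (emb (Y (flat y) t))" for k by simp
        then show ?case by (simp add: cf_emb vec_eq_iff)
      qed
      then have "flat x = flat y" by (rule inj)
      then have "flat x $ (i, j) = flat y $ (i, j)" for i j by simp
      then have "x $ i $ j = y $ i $ j" for i j by (simp add: flat_def)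
      then show False using that by (simp add: vec_eq_iff)
    qed
    show "little_o_plus (- ((2 - 2 * p) / (p + 2))) (\<lambda>t. fst (P x t) - leading_part p a b q x t)" if "p < 1" for x
    proof -
      \<comment> \<open>For n = 1 the remainder has exactly the order s - 2\<eta> of f, so f can be
        absorbed.\<close>
      have gamma: "s - (real 1 + 1) * \<eta> = (2 * p - 2) / (p + 2)" "- ((2 - 2 * p) / (p + 2)) = (2 * p - 2) / (p + 2)"
        using eta(5) by (simp_all add: minus_divide_left)
      obtain f where f: "little_o_plus ((2 * p - 2) / (p + 2)) (\<lambda>t. fst (P x t) - (leading_part p a b q x t + f t))"
        "little_o_plus ((2 * p - 2) / (p + 2)) f"
        using remainder[where x = x and n = 1] unfolding gamma by blast
      from little_o_plus_add[OF f] show ?thesis unfolding gamma by simp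
    qed
  qed
qed

end
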